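(* As $T\to\infty$, $T^{-2}\langle|\chi_T|^2\rangle\to0$.
   Context: $A(y)=(a_{ij}^{\alpha\beta}(y))$ is real, satisfies $\mu|\xi|^2\le a_{ij}^{\alpha\beta}(y)\xi_i^\alpha\xi_j^\beta\le\mu^{-1}|\xi|^2$ ($\mu>0$), and is uniformly almost-periodic (uniform limit of real trigonometric polynomials). Approximate correctors: $P_j^\beta(y)=y_je^\beta$; for $T>0$, $\chi_{T,j}^\beta$ is the unique $u\in H^1_{loc}(\mathbb{R}^d;\mathbb{R}^m)$ with $\sup_x\int_{B(x,1)}(|\nabla u|^2+|u|^2)<\infty$ and $-\mathrm{div}(A\nabla u)+T^{-2}u=\mathrm{div}(A\nabla P_j^\beta)$ weakly in $\mathbb{R}^d$; $\chi_T=(\chi_{T,j}^{\alpha\beta})$. The mean value is $\langle h\rangle=\lim_{L\to\infty}|B(0,L)|^{-1}\int_{B(0,L)}h$ (which exists for $h=|\chi_T|^2$). *)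

theory Defs
  imports "HOL-Analysis.Analysis"
begin

text \<open>Points of R^d are vectors real^'d ('d a finite index type, d = CARD('d));
  R^m-valued functions are functions into 'm \<Rightarrow> real ('m finite, m = CARD('m)).
  The coefficient tensor is A y i j \<alpha> \<beta> = a_ij^{\<alpha>\<beta>}(y).\<close>

definition trig_poly :: "(real^'d \<Rightarrow> real) \<Rightarrow> bool" where
  "trig_poly p \<longleftrightarrow> (\<exists>(n::nat) (lam::nat \<Rightarrow> real^'d) (c::nat \<Rightarrow> real) (s::nat \<Rightarrow> real).
      \<forall>y. p y = (\<Sum>k<n. c k * cos (lam k \<bullet> y) + s k * sin (lam k \<bullet> y)))"

definition unif_almost_periodic :: "(real^'d \<Rightarrow> real) \<Rightarrow> bool" where
  "unif_almost_periodic f \<longleftrightarrow> (\<forall>\<epsilon>>0. \<exists>p. trig_poly p \<and> (\<forall>y. \<bar>f y - p y\<bar> < \<epsilon>))"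

definition pd :: "'d \<Rightarrow> (real^'d \<Rightarrow> real) \<Rightarrow> real^'d \<Rightarrow> real" where
  "pd i f x = deriv (\<lambda>t. f (x + t *\<^sub>R axis i 1)) 0"

fun iter_pd :: "'d list \<Rightarrow> (real^'d \<Rightarrow> real) \<Rightarrow> real^'d \<Rightarrow> real" where
  "iter_pd [] f = f"
| "iter_pd (i # is) f = pd i (iter_pd is f)"

definition test_fn :: "(real^'d \<Rightarrow> real) \<Rightarrow> bool" where
  "test_fn \<phi> \<longleftrightarrow>
     (\<forall>is. continuous_on UNIV (iter_pd is \<phi>) \<and>
           (\<forall>i x. (\<lambda>t. iter_pd is \<phi> (x + t *\<^sub>R axis i 1)) differentiable (at 0))) \<and>
     (\<exists>K. compact K \<and> (\<forall>x. x \<notin> K \<longrightarrow> \<phi> x = 0))"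

definition L2loc :: "(real^'d \<Rightarrow> real) \<Rightarrow> bool" where
  "L2loc f \<longleftrightarrow> f \<in> borel_measurable lebesgue \<and>
     (\<forall>K. compact K \<longrightarrow> set_integrable lebesgue K (\<lambda>x. (f x)^2))"

definition weak_gradient :: "(real^'d \<Rightarrow> 'm \<Rightarrow> real) \<Rightarrow> (real^'d \<Rightarrow> 'd \<Rightarrow> 'm \<Rightarrow> real) \<Rightarrow> bool" where
  "weak_gradient u G \<longleftrightarrow>
     (\<forall>\<alpha>. L2loc (\<lambda>x. u x \<alpha>)) \<and> (\<forall>i \<alpha>. L2loc (\<lambda>x. G x i \<alpha>)) \<and>
     (\<forall>\<phi> i \<alpha>. test_fn \<phi> \<longrightarrow>
        (\<integral>x. u x \<alpha> * pd i \<phi> x \<partial>lebesgue) = - (\<integral>x. G x i \<alpha> * \<phi> x \<partial>lebesgue))"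

text \<open>u is the approximate corrector chi_{T,j}^beta: u in H^1_loc, sup_x of the integral over B(x,1)
  of |grad u|^2+|u|^2 is finite, and -div(A grad u) + T^{-2} u = div(A grad P_j^beta) weakly,
  where (A grad P_j^beta)_i^alpha = a_ij^{alpha beta}.\<close>
definition approx_corrector ::
  "(real^'d \<Rightarrow> 'd \<Rightarrow> 'd \<Rightarrow> 'm \<Rightarrow> 'm \<Rightarrow> real) \<Rightarrow> real \<Rightarrow> 'd \<Rightarrow> 'm \<Rightarrow> (real^'d \<Rightarrow> 'm \<Rightarrow> real) \<Rightarrow> bool" where
  "approx_corrector A T j \<beta> u \<longleftrightarrow>
     (\<exists>G. weak_gradient u G \<and>
        (\<exists>C. \<forall>x. (LINT y:ball x 1|lebesgue. (\<Sum>i\<in>UNIV. \<Sum>\<alpha>\<in>UNIV. (G y i \<alpha>)^2) + (\<Sum>\<alpha>\<in>UNIV. (u y \<alpha>)^2)) \<le> C) \<and>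
        (\<forall>\<phi> :: real^'d \<Rightarrow> 'm \<Rightarrow> real. (\<forall>\<alpha>. test_fn (\<lambda>x. \<phi> x \<alpha>)) \<longrightarrow>
           (\<integral>x. (\<Sum>i\<in>UNIV. \<Sum>\<alpha>\<in>UNIV. \<Sum>k\<in>UNIV. \<Sum>\<gamma>\<in>UNIV.
                     A x i k \<alpha> \<gamma> * G x k \<gamma> * pd i (\<lambda>y. \<phi> y \<alpha>) x)
                 + (1 / T^2) * (\<Sum>\<alpha>\<in>UNIV. u x \<alpha> * \<phi> x \<alpha>) \<partial>lebesgue)
           = - (\<integral>x. (\<Sum>i\<in>UNIV. \<Sum>\<alpha>\<in>UNIV. A x i j \<alpha> \<beta> * pd i (\<lambda>y. \<phi> y \<alpha>) x) \<partial>lebesgue)))"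

definition mean_value :: "(real^'d \<Rightarrow> real) \<Rightarrow> real" where
  "mean_value h = Lim at_top (\<lambda>L::real. (LINT x:ball 0 L|lebesgue. h x) / measure lebesgue (ball (0::real^'d) L))"

end

theory Submission
  imports Defs "HOL-Library.Function_Algebras"
begin

text \<open>Fix a filter finer than \<open>L \<rightarrow> \<infinity>\<close> along which every bounded function of \<open>L\<close> converges, and
  take means of uniformly locally integrable functions along it. On the space \<open>V\<close> of functions whose
  squares and whose gradients' squares are uniformly locally integrable, the means of \<open>u \<cdot> v\<close>,
  \<open>\<nabla>u \<cdot> \<nabla>v\<close> and \<open>A \<nabla>u \<cdot> \<nabla>v\<close> are bilinear forms \<open>p\<close>, \<open>q\<close>, \<open>B\<close>, and testing the corrector equation with
  \<open>v\<close> times a cutoff at scale \<open>L\<close> gives \<open>B(\<chi>\<^sub>T, v) + T\<^sup>-\<^sup>2 p(\<chi>\<^sub>T, v) = F(v)\<close> with \<open>F\<close> bounded in the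
  seminorm of \<open>q\<close>.

  By Lax--Milgram, for each \<open>\<epsilon> > 0\<close> there is \<open>v \<in> V\<close>, independent of \<open>T\<close>, with
  \<open>\<bar>F(w) - B(v, w)\<bar> \<le> \<epsilon> q(w, w)\<^bsup>1/2\<^esup>\<close> for all \<open>w \<in> V\<close>. Taking \<open>w = \<chi>\<^sub>T - v\<close>, coercivity yields
  \<open>T\<^sup>-\<^sup>2 p(\<chi>\<^sub>T, \<chi>\<^sub>T) \<le> \<epsilon>\<^sup>2 / (2 \<mu>) + T\<^sup>-\<^sup>2 p(v, v)\<close>, and the right-hand side tends to \<open>\<epsilon>\<^sup>2 / (2 \<mu>)\<close>.\<close>

subsection \<open>Lax--Milgram in incomplete spaces\<close>

text \<open>The space must contain both the comparison function v and every corrector, and averages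
  of products of its members need not converge as \<open>L\<close> grows; hence the filter. The
  seminorm of q ignores square-integrable perturbations of the gradient and the space need not be
  complete, so Riesz and Lax--Milgram are proved only up to a tolerance, which is enough since
  \<epsilon> is arbitrary. There is no Poincare inequality bounding p by q. Thus p(v, v) may blow up
  as \<epsilon> tends to 0, and the limit in T is taken with v fixed. The constant 2 \<mu> arises
  because Young's inequality absorbs the error into the coercive term at the price \<epsilon>^2 / (4
  \<mu>), and the nonnegativity of p(w, w) bounds p(\<chi>, \<chi>) - p(v, v) by 2 p(\<chi>, w),
  which doubles that price. A further obstacle is that v times a cutoff is not smooth; it becomes
  admissible through mollification. Finally, averages against the smooth cutoff differ from the ball
  averages of \<open>mean_value\<close>, but dominate them up to a constant, which suffices for a
  limit equal to 0.\<close>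

instantiation "fun" :: (type, scaleR) scaleR
begin
definition scaleR_fun_def: "c *\<^sub>R f = (\<lambda>x. c *\<^sub>R f x)"
instance ..
end

text \<open>Pairs of a vector-valued function and its gradient thereby form a real vector space, and
  the abstract argument applies to them with \<open>unif_H1\<close> as a subspace.\<close>

instance "fun" :: (type, real_vector) real_vector
  by standard (auto simp: scaleR_fun_def plus_fun_def fun_eq_iff scaleR_add_right scaleR_add_left)

text \<open>The case \<open>a = 0\<close> is included because the forms below are only semidefinite
  and may vanish at a nonzero vector.\<close>

lemma nonneg_quadratic_discriminant:
  fixes a b c :: real
  assumes "\<And>t. 0 \<le> a * t^2 + 2 * b * t + c" and "0 \<le> a"
  shows "b^2 \<le> a * c"
proof (cases "a = 0")
  case True
  have "b = 0"
  proof (rule ccontr)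
    assume "b \<noteq> 0"
    \<comment> \<open>At this value of \<open>t\<close> the remaining affine function equals
      \<open>-1\<close>.\<close>
    then show False
      using assms(1)[of "- (c + 1) / (2 * b)"] True by (simp add: field_simps)
  qed
  with True show ?thesis by simp
next
  case False
  then have "a > 0" using assms(2) by simp
  have "a * (-b/a)^2 + 2 * b * (-b/a) + c = c - b^2 / a"
    using \<open>a > 0\<close> by (simp add: field_simps power2_eq_square)
  then have "0 \<le> c - b^2 / a"
    using assms(1)[of "-b/a"] by simp
  then show ?thesis using \<open>a > 0\<close> by (simp add: field_simps)
qed

text \<open>The axioms are restricted to a carrier because a generalized mean is known to be
  additive only on functions whose weighted averages converge.\<close>

locale bilinear_form_on =
  fixes V :: "'a::real_vector set" and B :: "'a \<Rightarrow> 'a \<Rightarrow> real"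
  assumes subspace: "subspace V"
    and add_left: "\<lbrakk>x \<in> V; y \<in> V; z \<in> V\<rbrakk> \<Longrightarrow> B (x + y) z = B x z + B y z"
    and add_right: "\<lbrakk>x \<in> V; y \<in> V; z \<in> V\<rbrakk> \<Longrightarrow> B z (x + y) = B z x + B z y"
    and scale_left: "\<lbrakk>x \<in> V; z \<in> V\<rbrakk> \<Longrightarrow> B (c *\<^sub>R x) z = c * B x z"
    and scale_right: "\<lbrakk>x \<in> V; z \<in> V\<rbrakk> \<Longrightarrow> B z (c *\<^sub>R x) = c * B z x"
begin

lemma diff_left: "\<lbrakk>x \<in> V; y \<in> V; z \<in> V\<rbrakk> \<Longrightarrow> B (x - y) z = B x z - B y z"
  using add_left[of x "(-1) *\<^sub>R y" z] scale_left[of y z "-1"] subspace_scale[OF subspace, of y "-1"] by simp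

lemma diff_right: "\<lbrakk>x \<in> V; y \<in> V; z \<in> V\<rbrakk> \<Longrightarrow> B z (x - y) = B z x - B z y"
  using add_right[of x "(-1) *\<^sub>R y" z] scale_right[of y z "-1"] subspace_scale[OF subspace, of y "-1"] by simp

lemma zero_left: "z \<in> V \<Longrightarrow> B 0 z = 0"
  using scale_left[of 0 z 0] subspace_0[OF subspace] by simp

lemma square_add: "\<lbrakk>x \<in> V; y \<in> V\<rbrakk> \<Longrightarrow> B (x + y) (x + y) = B x x + B x y + B y x + B y y"
  by (simp add: add_left add_right subspace_add[OF subspace])

lemma square_diff: "\<lbrakk>x \<in> V; y \<in> V\<rbrakk> \<Longrightarrow> B (x - y) (x - y) = B x x - B x y - B y x + B y y"
  by (simp add: diff_left diff_right subspace_diff[OF subspace])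

end

text \<open>The form is only semidefinite: in the application every square-integrable function has
  mean square 0.\<close>

locale semi_inner_on = bilinear_form_on V q for V :: "'a::real_vector set" and q +
  assumes commute: "\<lbrakk>x \<in> V; y \<in> V\<rbrakk> \<Longrightarrow> q x y = q y x"
    and nonneg: "x \<in> V \<Longrightarrow> 0 \<le> q x x"
begin

definition nrm where "nrm x = sqrt (q x x)"

lemma nrm_nonneg: "x \<in> V \<Longrightarrow> 0 \<le> nrm x"
  by (simp add: nrm_def nonneg)

lemma nrm_square: "x \<in> V \<Longrightarrow> (nrm x)^2 = q x x"
  by (simp add: nrm_def nonneg)

lemma cauchy_schwarz:
  assumes "x \<in> V" "y \<in> V"
  shows "\<bar>q x y\<bar> \<le> nrm x * nrm y"
proof -
  have "(q x y)^2 \<le> q y y * q x x"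
  proof (rule nonneg_quadratic_discriminant)
    fix t
    have "0 \<le> q (x + t *\<^sub>R y) (x + t *\<^sub>R y)"
      using assms by (intro nonneg subspace_add subspace_scale subspace)
    also have "\<dots> = q y y * t^2 + 2 * q x y * t + q x x"
      using assms subspace_scale[OF subspace, of y t]
      by (simp add: square_add scale_left scale_right commute[of y x] power2_eq_square)
    finally show "0 \<le> q y y * t^2 + 2 * q x y * t + q x x" .
  qed (simp add: nonneg assms)
  also have "\<dots> = (nrm x * nrm y)^2"
    using assms by (simp add: power_mult_distrib nrm_square)
  finally show ?thesis
    using assms by (metis abs_le_square_iff abs_of_nonneg mult_nonneg_nonneg nrm_nonneg)
qed

text \<open>The bound \<open>s\<close> is an explicit argument since the iteration below follows how
  it shrinks from one residual to the next.\<close>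

definition functional_on :: "('a \<Rightarrow> real) \<Rightarrow> real \<Rightarrow> bool" where
  "functional_on G s \<longleftrightarrow> (\<forall>x\<in>V. \<forall>y\<in>V. G (x + y) = G x + G y) \<and> (\<forall>c. \<forall>x\<in>V. G (c *\<^sub>R x) = c * G x) \<and>
     (\<forall>x\<in>V. \<bar>G x\<bar> \<le> s * nrm x)"

lemma functional_onD:
  assumes "functional_on G s" "x \<in> V" "y \<in> V"
  shows "G (x + y) = G x + G y" "G (c *\<^sub>R x) = c * G x" "\<bar>G x\<bar> \<le> s * nrm x"
  using assms by (auto simp: functional_on_def)

text \<open>Since \<open>V\<close> need not be complete, the Riesz representative is only approximate: a
  near-minimizer of \<open>q v v - 2 G v\<close>.\<close>

lemma approx_riesz:
  assumes G: "functional_on G s" and "\<delta> > 0"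
  obtains R where "R \<in> V" "\<And>x. x \<in> V \<Longrightarrow> \<bar>G x - q R x\<bar> \<le> \<delta> * nrm x"
proof -
  define J where "J v = q v v - 2 * G v" for v
  have lower: "- (s^2) \<le> J v" if "v \<in> V" for v
  proof -
    have "0 \<le> (nrm v - s)^2" by simp
    also have "\<dots> = q v v - 2 * (s * nrm v) + s^2"
      using that by (simp add: power2_diff nrm_square)
    finally show ?thesis
      using functional_onD(3)[OF G that that] by (simp add: J_def)
  qed
  then have bdd: "bdd_below (J ` V)" by (intro bdd_belowI2) auto
  have ne: "J ` V \<noteq> {}" using subspace_0[OF subspace] by blast
  \<comment> \<open>A gap of \<open>\<delta>^2\<close> above the infimum is turned by the
    discriminant inequality, applied to \<open>J\<close> along lines through \<open>R\<close>, into
    an error \<delta> in the residual.\<close>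
  have "Inf (J ` V) < Inf (J ` V) + \<delta>^2" using \<open>\<delta> > 0\<close> by simp
  then obtain R where R: "R \<in> V" "J R < Inf (J ` V) + \<delta>^2"
    using cInf_lessD[OF ne] by blast
  show ?thesis
  proof (rule that[OF R(1)])
    fix x assume x: "x \<in> V"
    have "(q R x - G x)^2 \<le> q x x * \<delta>^2"
    proof (rule nonneg_quadratic_discriminant)
      fix t
      have tx: "t *\<^sub>R x \<in> V" "R + t *\<^sub>R x \<in> V"
        using x R(1) by (auto intro!: subspace_add subspace_scale subspace)
      have "J R \<le> J (R + t *\<^sub>R x) + \<delta>^2"
        using R(2) cINF_lower[OF bdd tx(2)] by linarith
      also have "J (R + t *\<^sub>R x) = J R + (q x x * t^2 + 2 * (q R x - G x) * t)"
        using R(1) x tx functional_onD[OF G] commute[of x R]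
        by (simp add: J_def square_add scale_left scale_right power2_eq_square algebra_simps)
      finally show "0 \<le> q x x * t^2 + 2 * (q R x - G x) * t + \<delta>^2" by simp
    qed (simp add: nonneg x)
    also have "\<dots> = (\<delta> * nrm x)^2"
      using x by (simp add: power_mult_distrib nrm_square)
    finally show "\<bar>G x - q R x\<bar> \<le> \<delta> * nrm x"
      using x \<open>\<delta> > 0\<close>
      by (metis abs_le_square_iff abs_minus_commute abs_of_nonneg less_imp_le mult_nonneg_nonneg nrm_nonneg)
  qed
qed

text \<open>Testing with \<open>R\<close> itself bounds \<open>(nrm R)^2\<close> by
  \<open>(s + \<delta>) * nrm R\<close>.\<close>

lemma approx_riesz_bound:
  assumes G: "functional_on G s" and R: "R \<in> V" "\<And>x. x \<in> V \<Longrightarrow> \<bar>G x - q R x\<bar> \<le> \<delta> * nrm x"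
    and "0 \<le> s" "0 \<le> \<delta>"
  shows "nrm R \<le> s + \<delta>"
proof -
  have "(nrm R)^2 \<le> (s + \<delta>) * nrm R"
    using functional_onD(3)[OF G R(1) R(1)] R(2)[OF R(1)] nrm_square[OF R(1)]
    by (simp add: distrib_right)
  then show ?thesis
    using nrm_nonneg[OF R(1)] assms(4,5) by (cases "nrm R = 0") (auto simp: power2_eq_square)
qed

end

locale coercive_form_on = semi_inner_on V q + B: bilinear_form_on V B
  for V :: "'a::real_vector set" and q B +
  fixes c M :: real
  assumes c_pos: "0 < c" and M_pos: "0 < M"
    and coercive: "x \<in> V \<Longrightarrow> c * q x x \<le> B x x"
    and bounded: "\<lbrakk>x \<in> V; y \<in> V\<rbrakk> \<Longrightarrow> \<bar>B x y\<bar> \<le> M * nrm x * nrm y"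
begin

lemma functional_on_form: "x \<in> V \<Longrightarrow> functional_on (B x) (M * nrm x)"
  by (auto simp: functional_on_def B.add_right B.scale_right bounded)

text \<open>One step of the Richardson iteration behind the Lax--Milgram theorem, with step size
  \<open>\<rho> = c / M\<^sup>2\<close>: the exact contraction factor would be \<open>sqrt (1 - c\<^sup>2 / M\<^sup>2)\<close>.\<close>

lemma residual_contraction:
  obtains \<theta> where "0 < \<theta>" "\<theta> < 1"
    "\<And>G s. functional_on G s \<Longrightarrow> 0 < s \<Longrightarrow> \<exists>R\<in>V. \<forall>x\<in>V. \<bar>G x - B R x\<bar> \<le> \<theta> * s * nrm x"
proof -
  define \<rho> where "\<rho> = c / M^2"
  have \<rho>: "\<rho> > 0" using c_pos M_pos by (simp add: \<rho>_def)
  \<comment> \<open>With \<open>\<rho> = c / M^2\<close> the polynomial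
    \<open>1 - 2 * \<rho> * c + \<rho>^2 * M^2\<close> equals \<open>1 - c^2 / M^2\<close>.
    Coercivity and boundedness force \<open>c \<le> M\<close> unless the seminorm vanishes
    identically; the maximum covers that degenerate case.\<close>
  define \<theta>0 where "\<theta>0 = max 0 (1 - c^2 / M^2)"
  have \<theta>0: "0 \<le> \<theta>0" "\<theta>0 < 1" using c_pos M_pos by (auto simp: \<theta>0_def)
  have \<theta>0_le: "1 - 2 * \<rho> * c + \<rho>^2 * M^2 \<le> \<theta>0"
    using M_pos by (simp add: \<theta>0_def \<rho>_def field_simps power2_eq_square)
  \<comment> \<open>The midpoint between \<open>sqrt \<theta>0\<close> and 1 leaves room for the
    tolerances of two approximate Riesz representatives.\<close>
  define \<theta> where "\<theta> = (1 + sqrt \<theta>0) / 2"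
  have s1: "sqrt \<theta>0 < 1" using \<theta>0 by simp
  have \<theta>: "0 < \<theta>" "\<theta> < 1" "sqrt \<theta>0 < \<theta>" using s1 \<theta>0 by (auto simp: \<theta>_def add_pos_nonneg)
  show ?thesis
  proof (rule that[OF \<theta>(1,2)])
    fix G s assume G: "functional_on G s" and s: "(0::real) < s"
    \<comment> \<open>\<open>P \<delta>\<close> will bound the squared seminorm of \<open>Z\<close>,
      and \<open>N \<delta>\<close> the whole new residual. Since
      \<open>N 0 = sqrt \<theta>0 * s\<close>, continuity at 0 provides an admissible
      tolerance.\<close>
    define P where "P \<delta> = \<theta>0 * (s+\<delta>)^2 + (2 * \<rho> * \<delta> * (s+\<delta>) + \<rho>^2 * (2 * M * (s+\<delta>) * \<delta> + \<delta>^2))" for \<delta>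
    define N where "N \<delta> = \<delta> + \<rho> * \<delta> + sqrt (P \<delta>)" for \<delta>
    have "(N \<longlongrightarrow> N 0) (at_right 0)"
      unfolding N_def P_def by (intro tendsto_intros)
    moreover have "N 0 < \<theta> * s"
      using \<theta>(3) s by (simp add: N_def P_def real_sqrt_mult)
    ultimately have "\<forall>\<^sub>F \<delta> in at_right 0. N \<delta> < \<theta> * s"
      by (rule order_tendstoD)
    then have "\<forall>\<^sub>F \<delta> in at_right 0. N \<delta> < \<theta> * s \<and> \<delta> > 0"
      by (intro eventually_conj eventually_at_right_less)
    then obtain \<delta> where \<delta>: "N \<delta> < \<theta> * s" "\<delta> > 0"
      using eventually_happens' trivial_limit_at_right_real by blast
    obtain R where R: "R \<in> V" "\<And>x. x \<in> V \<Longrightarrow> \<bar>G x - q R x\<bar> \<le> \<delta> * nrm x"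
      using approx_riesz[OF G \<delta>(2)] by blast
    obtain W where W: "W \<in> V" "\<And>x. x \<in> V \<Longrightarrow> \<bar>B R x - q W x\<bar> \<le> \<delta> * nrm x"
      using approx_riesz[OF functional_on_form[OF R(1)] \<delta>(2)] by blast
    define r where "r = nrm R"
    have r: "0 \<le> r" "r \<le> s + \<delta>" "q R R = r^2"
      using approx_riesz_bound[OF G R] s \<delta>(2) nrm_nonneg[OF R(1)] nrm_square[OF R(1)]
      by (auto simp: r_def)
    have "nrm W \<le> M * r + \<delta>"
      using approx_riesz_bound[OF functional_on_form[OF R(1)] W] M_pos r \<delta>(2) by (simp add: r_def)
    then have qW: "q W W \<le> (M * r + \<delta>)^2"
      using nrm_square[OF W(1)] nrm_nonneg[OF W(1)] by (metis power_mono)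
    have qWR: "c * r^2 - \<delta> * r \<le> q W R"
      using W(2)[OF R(1)] coercive[OF R(1)] r by (simp add: r_def)
    \<comment> \<open>\<open>R\<close> represents \<open>G\<close> and \<open>W\<close> represents
      \<open>B R\<close>, so \<open>Z\<close> represents the residual of
      \<open>\<rho> *\<^sub>R R\<close> up to the tolerances; its seminorm is what has to
      shrink.\<close>
    define Z where "Z = R - \<rho> *\<^sub>R W"
    have Z: "Z \<in> V" "\<rho> *\<^sub>R W \<in> V"
      using R W unfolding Z_def by (auto intro!: subspace_diff subspace_scale subspace)
    have "q Z Z = r^2 - 2 * \<rho> * q W R + \<rho>^2 * q W W"
      unfolding Z_def using R(1) W(1) Z(2) commute[of R W] r(3)
      by (simp add: square_diff scale_left scale_right power2_eq_square)
    also have "\<dots> \<le> r^2 - 2 * \<rho> * (c * r^2 - \<delta> * r) + \<rho>^2 * (M * r + \<delta>)^2"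
    proof -
      have "2 * \<rho> * (c * r^2 - \<delta> * r) \<le> 2 * \<rho> * q W R" "\<rho>^2 * q W W \<le> \<rho>^2 * (M * r + \<delta>)^2"
        using qWR qW \<rho> by (auto intro!: mult_left_mono)
      then show ?thesis by linarith
    qed
    also have "\<dots> = (1 - 2 * \<rho> * c + \<rho>^2 * M^2) * r^2 + (2 * \<rho> * \<delta> * r + \<rho>^2 * (2 * M * r * \<delta> + \<delta>^2))"
      by (simp add: algebra_simps power2_eq_square)
    also have "\<dots> \<le> \<theta>0 * r^2 + (2 * \<rho> * \<delta> * r + \<rho>^2 * (2 * M * r * \<delta> + \<delta>^2))"
      using \<theta>0_le by (intro add_right_mono mult_right_mono) auto
    also have "\<dots> \<le> P \<delta>"
      unfolding P_def using r \<theta>0 \<rho> \<delta>(2) M_pos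
      by (intro add_mono mult_left_mono power_mono mult_right_mono) auto
    finally have "nrm Z \<le> sqrt (P \<delta>)" by (simp add: nrm_def)
    have "\<bar>G x - B (\<rho> *\<^sub>R R) x\<bar> \<le> \<theta> * s * nrm x" if x: "x \<in> V" for x
    proof -
      have "G x - B (\<rho> *\<^sub>R R) x = (G x - q R x) - \<rho> * (B R x - q W x) + q Z x"
        using R(1) W(1) x Z(2) by (simp add: Z_def diff_left scale_left B.scale_left algebra_simps)
      then have "\<bar>G x - B (\<rho> *\<^sub>R R) x\<bar> \<le> \<bar>G x - q R x\<bar> + \<rho> * \<bar>B R x - q W x\<bar> + \<bar>q Z x\<bar>"
        using \<rho> abs_mult[of \<rho> "B R x - q W x"] by (simp add: abs_if split: if_splits)
      also have "\<dots> \<le> \<delta> * nrm x + \<rho> * (\<delta> * nrm x) + sqrt (P \<delta>) * nrm x"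
        using R(2)[OF x] W(2)[OF x] cauchy_schwarz[OF Z(1) x] \<rho>
          mult_right_mono[OF \<open>nrm Z \<le> sqrt (P \<delta>)\<close> nrm_nonneg[OF x]]
        by (intro add_mono mult_left_mono) auto
      also have "\<dots> = N \<delta> * nrm x" by (simp add: N_def algebra_simps)
      also have "\<dots> \<le> \<theta> * s * nrm x" using \<delta>(1) nrm_nonneg[OF x] by (intro mult_right_mono) auto
      finally show ?thesis .
    qed
    moreover have "\<rho> *\<^sub>R R \<in> V" using R(1) by (intro subspace_scale subspace)
    ultimately show "\<exists>R\<in>V. \<forall>x\<in>V. \<bar>G x - B R x\<bar> \<le> \<theta> * s * nrm x" by blast
  qed
qed

text \<open>The residual \<open>F - B v\<close> is again a functional, with a smaller bound, so
  corrections can be added to \<open>v\<close> repeatedly. A positive tolerance is reached after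
  finitely many steps, and no limit in \<open>V\<close> is taken.\<close>

lemma approx_lax_milgram:
  assumes F: "functional_on F K" and "\<epsilon> > 0"
  obtains v where "v \<in> V" "\<And>x. x \<in> V \<Longrightarrow> \<bar>F x - B v x\<bar> \<le> \<epsilon> * nrm x"
proof -
  obtain \<theta> where \<theta>: "0 < \<theta>" "\<theta> < 1"
    "\<And>G s. functional_on G s \<Longrightarrow> 0 < s \<Longrightarrow> \<exists>R\<in>V. \<forall>x\<in>V. \<bar>G x - B R x\<bar> \<le> \<theta> * s * nrm x"
    using residual_contraction by blast
  \<comment> \<open>\<open>residual_contraction\<close> asks for a strictly positive bound, and
    \<open>K\<close> may fail to be positive.\<close>
  define K' where "K' = max K 1"
  have "\<exists>v\<in>V. \<forall>x\<in>V. \<bar>F x - B v x\<bar> \<le> \<theta>^n * K' * nrm x" for n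
  proof (induction n)
    case 0
    have "\<bar>F x\<bar> \<le> K' * nrm x" if "x \<in> V" for x
      using functional_onD(3)[OF F that that] mult_right_mono[of K K' "nrm x"] nrm_nonneg[OF that]
      by (simp add: K'_def)
    then show ?case using subspace_0[OF subspace] by (intro bexI[of _ 0]) (auto simp: B.zero_left)
  next
    case (Suc n)
    then obtain v where v: "v \<in> V" "\<And>x. x \<in> V \<Longrightarrow> \<bar>F x - B v x\<bar> \<le> \<theta>^n * K' * nrm x" by blast
    have "functional_on (\<lambda>x. F x - B v x) (\<theta>^n * K')"
      using functional_onD[OF F] v by (auto simp: functional_on_def B.add_right B.scale_right algebra_simps)
    moreover have "0 < \<theta>^n * K'" using \<theta> by (simp add: K'_def)
    ultimately obtain R where R: "R \<in> V" "\<And>x. x \<in> V \<Longrightarrow> \<bar>F x - B v x - B R x\<bar> \<le> \<theta> * (\<theta>^n * K') * nrm x"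
      using \<theta>(3) by blast
    then have "\<bar>F x - B (v + R) x\<bar> \<le> \<theta>^Suc n * K' * nrm x" if "x \<in> V" for x
      using R(2)[OF that] v(1) R(1) that by (simp add: B.add_left algebra_simps)
    then show ?case using subspace_add[OF subspace v(1) R(1)] by blast
  qed
  moreover obtain n where "\<theta>^n < \<epsilon> / K'"
    using real_arch_pow_inv[of "\<epsilon> / K'" \<theta>] \<theta> \<open>\<epsilon> > 0\<close> by (auto simp: K'_def)
  then have "\<theta>^n * K' \<le> \<epsilon>" by (simp add: field_simps K'_def)
  ultimately show ?thesis
    using that by (meson mult_right_mono nrm_nonneg order_trans)
qed

section \<open>Vanishing of the zero-order term\<close>

theorem resolvent_vanishes:
  assumes p: "semi_inner_on V p" and F: "functional_on F K"
    and u: "\<And>l. 0 < l \<Longrightarrow> u l \<in> V"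
    and eq: "\<And>l x. 0 < l \<Longrightarrow> x \<in> V \<Longrightarrow> B (u l) x + l * p (u l) x = F x"
  shows "((\<lambda>l. l * p (u l) (u l)) \<longlongrightarrow> 0) (at_right 0)"
proof -
  interpret p: semi_inner_on V p by (rule p)
  have bound: "\<exists>P\<ge>0. \<forall>l>0. l * p (u l) (u l) \<le> \<epsilon>^2 / (2 * c) + l * P" if "\<epsilon> > 0" for \<epsilon>
  proof -
    obtain v where v: "v \<in> V" "\<And>x. x \<in> V \<Longrightarrow> \<bar>F x - B v x\<bar> \<le> \<epsilon> * nrm x"
      using approx_lax_milgram[OF F \<open>\<epsilon> > 0\<close>] by blast
    have "l * p (u l) (u l) \<le> \<epsilon>^2 / (2 * c) + l * p v v" if l: "l > 0" for l
    proof -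
      define z where "z = u l - v"
      have z: "z \<in> V" unfolding z_def by (intro subspace_diff subspace u l v)
      have "B z z + l * p (u l) z = F z - B v z"
        using eq[OF l z] u[OF l] v(1) z by (simp add: z_def B.diff_left)
      also have "\<dots> \<le> \<epsilon> * nrm z" using v(2)[OF z] by linarith
      also have "\<dots> \<le> c * (nrm z)^2 + \<epsilon>^2 / (4 * c)"
      proof -
        have "0 \<le> (2 * c * nrm z - \<epsilon>)^2" by simp
        then show ?thesis using c_pos by (simp add: field_simps power2_eq_square)
      qed
      also have "c * (nrm z)^2 \<le> B z z" using coercive[OF z] by (simp add: nrm_square z)
      finally have 1: "l * p (u l) z \<le> \<epsilon>^2 / (4 * c)" by simp
      have "0 \<le> p z z" using z by (rule p.nonneg)
      also have "p z z = p (u l) (u l) - 2 * p (u l) v + p v v"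
        unfolding z_def using p.square_diff[OF u[OF l] v(1)] p.commute[OF u[OF l] v(1)] by simp
      finally have "p (u l) (u l) - p v v \<le> 2 * p (u l) z"
        unfolding z_def using p.diff_right[OF u[OF l] v(1) u[OF l]] by simp
      then have "l * (p (u l) (u l) - p v v) \<le> 2 * (l * p (u l) z)"
        using l mult_left_mono[of _ _ l] by (simp add: mult.left_commute)
      with 1 have "l * (p (u l) (u l) - p v v) \<le> 2 * (\<epsilon>^2 / (4 * c))" by linarith
      then show ?thesis by (simp add: algebra_simps)
    qed
    then show ?thesis using p.nonneg[OF v(1)] by blast
  qed
  show ?thesis
  proof (rule tendstoI)
    fix e :: real assume e: "e > 0"
    \<comment> \<open>This makes \<open>\<epsilon>^2 / (2 * c)\<close> half of \<open>e\<close>; the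
      other half is left for \<open>l * P\<close>.\<close>
    define \<epsilon> where "\<epsilon> = sqrt (c * e)"
    have \<epsilon>: "\<epsilon> > 0" "\<epsilon>^2 / (2 * c) = e / 2"
      using e c_pos by (auto simp: \<epsilon>_def field_simps)
    obtain P where P: "P \<ge> 0" "\<And>l. l > 0 \<Longrightarrow> l * p (u l) (u l) \<le> e / 2 + l * P"
      using bound[OF \<epsilon>(1)] \<epsilon>(2) by auto
    have "\<forall>\<^sub>F l in at_right 0. l < e / 2 / (P + 1)"
      using e P(1) by (intro eventually_at_right_field[THEN iffD2] exI[of _ "e / 2 / (P + 1)"]) auto
    moreover have "\<forall>\<^sub>F l::real in at_right 0. 0 < l" by (rule eventually_at_right_less)
    ultimately show "\<forall>\<^sub>F l in at_right 0. dist (l * p (u l) (u l)) 0 < e"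
    proof eventually_elim
      case (elim l)
      have "l * (P + 1) < e / 2" using elim P(1) by (simp add: field_simps)
      then have "l * P < e / 2" using elim by (simp add: algebra_simps)
      moreover have "0 \<le> l * p (u l) (u l)" using elim p.nonneg[OF u] by simp
      ultimately show ?case using P(2)[OF elim(2)] by (simp add: dist_norm)
    qed
  qed
qed

end

subsection \<open>Limits along a filter\<close>

text \<open>Such a filter acts as a generalized limit: bounded averages converge along it, and
  limits that exist as \<open>L\<close> tends to infinity are kept since
  \<open>F \<le> at_top\<close>.\<close>

locale limit_filter =
  fixes F :: "real filter"
  assumes not_bot: "F \<noteq> bot" and le_at_top: "F \<le> at_top"
    and convergent: "\<And>h C. (\<forall>\<^sub>F L in at_top. \<bar>h L\<bar> \<le> C) \<Longrightarrow> \<exists>l. (h \<longlongrightarrow> (l::real)) F"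

text \<open>Tychonoff's theorem for the evaluation map \<open>x \<mapsto> (h x)\<^sub>h\<close> replaces an ultrafilter.\<close>

lemma ex_limit_filter: "\<exists>F. limit_filter F"
proof -
  \<comment> \<open>An eventual bound of \<open>h\<close>, with an irrelevant value if there is
    none. Clamping to it places every \<open>ev x\<close> in a compact product of intervals and
    eventually leaves a bounded \<open>h\<close> unchanged.\<close>
  define b where "b h = (SOME C. \<forall>\<^sub>F x in at_top. \<bar>h x\<bar> \<le> C)" for h :: "real \<Rightarrow> real"
  define ev where "ev x h = max (- \<bar>b h\<bar>) (min \<bar>b h\<bar> (h x))" for x and h :: "real \<Rightarrow> real"
  define S where "S = PiE UNIV (\<lambda>h::real \<Rightarrow> real. {- \<bar>b h\<bar>..\<bar>b h\<bar>})"
  have "compactin (product_topology (\<lambda>_. euclidean) UNIV) S"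
    unfolding S_def by (subst compactin_PiE) auto
  then have "compact S" by (simp add: euclidean_product_topology)
  moreover have "eventually (\<lambda>y. y \<in> S) (filtermap ev at_top)"
    by (simp add: eventually_filtermap S_def ev_def PiE_def)
  moreover have "filtermap ev at_top \<noteq> bot" by (simp add: filtermap_bot_iff)
  ultimately obtain e where e: "inf (nhds e) (filtermap ev at_top) \<noteq> bot"
    unfolding compact_filter by blast
  \<comment> \<open>This filter describes \<open>x\<close> tending to infinity in such a way that
    \<open>ev x\<close> approaches the cluster point \<open>e\<close>.\<close>
  define F where "F = inf (filtercomap ev (nhds e)) at_top"
  have "F \<noteq> bot"
  proof
    assume "F = bot"
    then have "eventually (\<lambda>_. False) F" by simp
    then obtain P Q where PQ: "eventually P (nhds e)" "eventually Q at_top" "\<And>x. P (ev x) \<Longrightarrow> Q x \<Longrightarrow> False"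
      unfolding F_def eventually_inf eventually_filtercomap by metis
    have "eventually (\<lambda>y. \<not> P y) (filtermap ev at_top)"
      unfolding eventually_filtermap using PQ(2) by eventually_elim (use PQ(3) in blast)
    then have "eventually (\<lambda>_. False) (inf (nhds e) (filtermap ev at_top))"
      unfolding eventually_inf using PQ(1) by blast
    with e show False by (simp add: eventually_False)
  qed
  moreover have "F \<le> at_top" by (simp add: F_def)
  moreover have "\<exists>l. (h \<longlongrightarrow> l) F" if h: "\<forall>\<^sub>F x in at_top. \<bar>h x\<bar> \<le> C" for h :: "real \<Rightarrow> real" and C
  proof -
    have "filterlim ev (nhds e) F"
      unfolding F_def by (rule filterlim_mono[OF filterlim_filtercomap order_refl inf_le1])
    then have "((\<lambda>x. ev x h) \<longlongrightarrow> e h) F"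
      by (rule continuous_on_tendsto_compose[OF continuous_on_product_coordinates[of h]]) simp_all
    moreover have "\<forall>\<^sub>F x in at_top. \<bar>h x\<bar> \<le> b h"
      unfolding b_def using h by (rule someI)
    then have "\<forall>\<^sub>F x in F. \<bar>h x\<bar> \<le> b h" using \<open>F \<le> at_top\<close> by (simp add: filter_leD)
    then have "\<forall>\<^sub>F x in F. ev x h = h x" by eventually_elim (auto simp: ev_def)
    ultimately have "(h \<longlongrightarrow> e h) F" by (rule Lim_transform_eventually)
    then show ?thesis ..
  qed
  ultimately have "limit_filter F" by unfold_locales simp_all
  then show ?thesis ..
qed

subsection \<open>Test functions\<close>

text \<open>The recursion is on the derivative taken first, whereas \<open>iter_pd\<close> recurses
  on the one taken last. In this order closure under products and compositions is a plain
  induction.\<close>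

fun Ck :: "nat \<Rightarrow> (real^'d \<Rightarrow> real) \<Rightarrow> bool" where
  "Ck 0 f \<longleftrightarrow> continuous_on UNIV f"
| "Ck (Suc n) f \<longleftrightarrow> continuous_on UNIV f \<and>
     (\<forall>i x. (\<lambda>t. f (x + t *\<^sub>R axis i 1)) differentiable (at 0)) \<and> (\<forall>i. Ck n (pd i f))"

lemma Ck_imp_continuous: "Ck n f \<Longrightarrow> continuous_on UNIV f"
  by (cases n) auto

lemma Ck_SucD: "Ck (Suc n) f \<Longrightarrow> Ck n f"
  by (induction n arbitrary: f) auto

lemma pd_eqI:
  "((\<lambda>t. f (x + t *\<^sub>R axis i 1)) has_field_derivative D) (at 0) \<Longrightarrow> pd i f x = D"
  unfolding pd_def by (rule DERIV_imp_deriv)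

lemma has_pd:
  "(\<lambda>t. f (x + t *\<^sub>R axis i 1)) differentiable (at 0) \<Longrightarrow>
   ((\<lambda>t. f (x + t *\<^sub>R axis i 1)) has_field_derivative pd i f x) (at 0)"
  unfolding pd_def by (simp add: DERIV_deriv_iff_real_differentiable)

lemma Ck_SucI:
  assumes "continuous_on UNIV f"
    and D: "\<And>i x. ((\<lambda>t. f (x + t *\<^sub>R axis i 1)) has_field_derivative D i x) (at 0)"
    and "\<And>i. Ck n (D i)"
  shows "Ck (Suc n) f"
proof -
  have "pd i f = D i" for i by (intro ext pd_eqI D)
  then show ?thesis using assms(1,3) D real_differentiable_def by (metis Ck.simps(2))
qed

lemma Ck_const: "Ck n (\<lambda>x. c)"
proof (induction n arbitrary: c)
  case (Suc n)
  show ?case by (rule Ck_SucI[where D = "\<lambda>_ _. 0"]) (auto intro: Suc)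
qed simp

lemma Ck_coord: "Ck n (\<lambda>x. x $ j)"
proof (cases n)
  case (Suc m)
  show ?thesis unfolding Suc
    by (rule Ck_SucI[where D = "\<lambda>i _. axis i 1 $ j"])
       (auto intro!: Ck_const continuous_intros derivative_eq_intros)
qed (auto intro!: continuous_intros)

lemma Ck_add: "Ck n f \<Longrightarrow> Ck n g \<Longrightarrow> Ck n (\<lambda>x. f x + g x)"
proof (induction n arbitrary: f g)
  case (Suc n)
  show ?case
    by (rule Ck_SucI[where D = "\<lambda>i x. pd i f x + pd i g x"])
       (use Suc in \<open>auto intro!: continuous_on_add DERIV_add has_pd\<close>)
qed (auto intro!: continuous_on_add)

lemma Ck_mult: "Ck n f \<Longrightarrow> Ck n g \<Longrightarrow> Ck n (\<lambda>x. f x * g x)"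
proof (induction n arbitrary: f g)
  case (Suc n)
  show ?case
  proof (rule Ck_SucI[where D = "\<lambda>i x. pd i f x * g x + pd i g x * f x"])
    show "((\<lambda>t. f (x + t *\<^sub>R axis i 1) * g (x + t *\<^sub>R axis i 1)) has_field_derivative
             pd i f x * g x + pd i g x * f x) (at 0)" for i x
      using DERIV_mult[OF has_pd[of f x i] has_pd[of g x i]] Suc.prems by simp
    show "Ck n (\<lambda>x. pd i f x * g x + pd i g x * f x)" for i
      using Suc.prems Ck_SucD[OF Suc.prems(1)] Ck_SucD[OF Suc.prems(2)] by (intro Ck_add Suc.IH) auto
  qed (use Suc.prems in \<open>auto intro!: continuous_on_mult\<close>)
qed (auto intro!: continuous_on_mult)

lemma Ck_cmult: "Ck n f \<Longrightarrow> Ck n (\<lambda>x. c * f x)"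
  by (intro Ck_mult Ck_const)

lemma Ck_sum: "finite I \<Longrightarrow> (\<And>i. i \<in> I \<Longrightarrow> Ck n (f i)) \<Longrightarrow> Ck n (\<lambda>x. \<Sum>i\<in>I. f i x)"
  by (induction I rule: finite_induct) (auto intro: Ck_const Ck_add)

lemma Ck_iter_pd: "Ck (length is + k) f \<Longrightarrow> Ck k (iter_pd is f)"
proof (induction "is" arbitrary: k)
  case (Cons i "is")
  then have "Ck (Suc k) (iter_pd is f)" by (metis add_Suc_right add_Suc length_Cons)
  then show ?case by simp
qed simp

lemma iter_pd_snoc: "iter_pd (is @ [i]) f = iter_pd is (pd i f)"
  by (induction "is") auto

lemma smooth_iff_Ck:
  "(\<forall>is. continuous_on UNIV (iter_pd is f) \<and>
     (\<forall>i x. (\<lambda>t. iter_pd is f (x + t *\<^sub>R axis i 1)) differentiable (at 0))) \<longleftrightarrow> (\<forall>n. Ck n f)"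
  (is "?S f \<longleftrightarrow> _")
proof
  assume "?S f"
  then have "Ck n f" for n
  proof (induction n arbitrary: f)
    case 0
    then show ?case by (metis Ck.simps(1) iter_pd.simps(1))
  next
    case (Suc n)
    have "?S (pd i f)" for i using Suc.prems by (metis iter_pd_snoc)
    then show ?case using Suc by (metis Ck.simps(2) iter_pd.simps(1))
  qed
  then show "\<forall>n. Ck n f" ..
next
  assume Ck: "\<forall>n. Ck n f"
  show "?S f"
  proof (intro allI conjI)
    fix "is"
    have "Ck (Suc 0) (iter_pd is f)" using Ck by (intro Ck_iter_pd) simp
    then show "continuous_on UNIV (iter_pd is f)"
      "(\<lambda>t. iter_pd is f (x + t *\<^sub>R axis i 1)) differentiable (at 0)" for i x by auto
  qed
qed

lemma test_fn_iff:
  "test_fn \<phi> \<longleftrightarrow> (\<forall>n. Ck n \<phi>) \<and> (\<exists>K. compact K \<and> (\<forall>x. x \<notin> K \<longrightarrow> \<phi> x = 0))"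
  unfolding test_fn_def smooth_iff_Ck ..

lemma test_fn_mult: "test_fn f \<Longrightarrow> test_fn g \<Longrightarrow> test_fn (\<lambda>x. f x * g x)"
  unfolding test_fn_iff by (auto intro: Ck_mult)

lemma test_fn_zero: "test_fn (\<lambda>x. 0)"
  unfolding test_fn_iff by (auto intro: Ck_const intro!: exI[of _ "{}"])

lemma test_fn_continuous: "test_fn \<phi> \<Longrightarrow> continuous_on UNIV \<phi>"
  by (metis Ck.simps(1) test_fn_iff)

lemma test_fn_has_pd:
  "test_fn \<phi> \<Longrightarrow> ((\<lambda>t. \<phi> (x + t *\<^sub>R axis i 1)) has_field_derivative pd i \<phi> x) (at 0)"
  by (metis Ck.simps(2) test_fn_iff has_pd)

lemma test_fn_pd_continuous: "test_fn \<phi> \<Longrightarrow> continuous_on UNIV (pd i \<phi>)"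
  by (metis Ck.simps(2) Ck_imp_continuous test_fn_iff)

lemma pd_mult:
  assumes "test_fn f" "test_fn g"
  shows "pd i (\<lambda>x. f x * g x) x = pd i f x * g x + f x * pd i g x"
  using DERIV_mult[OF test_fn_has_pd[OF assms(1), of x i] test_fn_has_pd[OF assms(2), of x i]]
  by (intro pd_eqI) (simp add: mult.commute)

lemma pd_zero: "pd i (\<lambda>x. 0) x = 0"
  by (intro pd_eqI) simp

lemma test_fn_support:
  assumes "test_fn \<phi>"
  obtains R where "R > 0" "\<And>x. R \<le> norm x \<Longrightarrow> \<phi> x = 0" "\<And>x i. R \<le> norm x \<Longrightarrow> pd i \<phi> x = 0"
proof -
  obtain K where K: "compact K" "\<And>x. x \<notin> K \<Longrightarrow> \<phi> x = 0"
    using assms by (auto simp: test_fn_iff)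
  obtain r where r: "\<And>x. x \<in> K \<Longrightarrow> norm x \<le> r"
    using compact_imp_bounded[OF K(1)] by (auto simp: bounded_iff)
  \<comment> \<open>One unit is added so that \<phi> vanishes on a neighbourhood of every point with
    \<open>R \<le> norm x\<close>, which makes its derivatives vanish there too.\<close>
  define R where "R = \<bar>r\<bar> + 1"
  have 0: "\<phi> x = 0" if "r < norm x" for x
    using K(2) r that by fastforce
  have "pd i \<phi> x = 0" if x: "R \<le> norm x" for x i
  proof (rule pd_eqI)
    have "open {x::real^'d. r < norm x}" by (intro open_Collect_less continuous_intros)
    moreover have "isCont (\<lambda>t::real. x + t *\<^sub>R axis i 1) 0"
      by (intro continuous_intros)
    then have "((\<lambda>t::real. x + t *\<^sub>R axis i 1) \<longlongrightarrow> x + 0 *\<^sub>R axis i 1) (nhds 0)"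
      using tendsto_at_iff_tendsto_nhds[of "\<lambda>t. x + t *\<^sub>R axis i 1" 0] by (simp add: isCont_def)
    ultimately have "\<forall>\<^sub>F t in nhds 0. x + t *\<^sub>R axis i 1 \<in> {x. r < norm x}"
      using x by (intro topological_tendstoD) (auto simp: R_def)
    then have "\<forall>\<^sub>F t in nhds 0. \<phi> (x + t *\<^sub>R axis i 1) = 0"
      by eventually_elim (simp add: 0)
    then show "((\<lambda>t. \<phi> (x + t *\<^sub>R axis i 1)) has_field_derivative 0) (at 0)"
      by (subst DERIV_cong_ev[where g = "\<lambda>_. 0", OF refl _ refl]) (simp_all only: DERIV_const)
  qed
  then show ?thesis using that[of R] 0 by (force simp: R_def)
qed

section \<open>Flat functions and radial bumps\<close>

definition flat :: "nat \<Rightarrow> real \<Rightarrow> real" where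
  "flat k t = (if t > 0 then exp (- 1 / t) / t^k else 0)"

lemma flat_nonneg: "0 \<le> flat k t" and flat_pos: "t > 0 \<Longrightarrow> 0 < flat k t"
  and flat_eq_0: "t \<le> 0 \<Longrightarrow> flat k t = 0"
  by (auto simp: flat_def)

lemma flat_tendsto_0: "(flat k \<longlongrightarrow> 0) (at 0)"
proof (rule filterlim_split_at)
  show "(flat k \<longlongrightarrow> 0) (at_left 0)"
    by (rule tendsto_eventually) (auto simp: eventually_at_left_field flat_def intro!: exI[of _ "-1"])
  have "((\<lambda>t. inverse t ^ k / exp (inverse t)) \<longlongrightarrow> 0) (at_right (0::real))"
    by (rule filterlim_compose[OF tendsto_power_div_exp_0 filterlim_inverse_at_top_right])
  moreover have "\<forall>\<^sub>F t in at_right 0. inverse t ^ k / exp (inverse t) = flat k t"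
    using eventually_at_right_less[of 0]
    by eventually_elim (simp add: flat_def field_simps exp_minus)
  ultimately show "(flat k \<longlongrightarrow> 0) (at_right 0)"
    by (rule Lim_transform_eventually)
qed

text \<open>The powers \<open>t^k\<close> in \<open>flat\<close> are there for this formula: the
  family is closed under differentiation up to linear combinations, so smoothness of all its members
  follows by one induction in \<open>Ck_flat\<close>.\<close>

lemma flat_DERIV: "(flat k has_field_derivative flat (k + 2) t - k * flat (k + 1) t) (at t)"
proof -
  consider "t > 0" | "t < 0" | "t = 0" by linarith
  then show ?thesis
  proof cases
    case 1
    have "((\<lambda>t. exp (- inverse t) * inverse t ^ k) has_field_derivative
        exp (- inverse t) * (inverse t)\<^sup>2 * inverse t ^ k
        + exp (- inverse t) * (real k * inverse t ^ (k - 1) * - (inverse t)\<^sup>2)) (at t)"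
      using 1 by (auto intro!: derivative_eq_intros simp: power2_eq_square)
    also have "exp (- inverse t) * (inverse t)\<^sup>2 * inverse t ^ k
        + exp (- inverse t) * (real k * inverse t ^ (k - 1) * - (inverse t)\<^sup>2)
        = flat (k + 2) t - k * flat (k + 1) t"
      using 1 by (cases k) (simp_all add: flat_def field_simps power2_eq_square)
    also have "(\<lambda>t::real. exp (- inverse t) * inverse t ^ k) = (\<lambda>t. exp (- 1 / t) / t ^ k)"
      by (intro ext) (simp add: power_inverse divide_inverse)
    finally have "((\<lambda>t. exp (- 1 / t) / t^k) has_field_derivative flat (k + 2) t - k * flat (k + 1) t) (at t)" .
    moreover have "\<forall>\<^sub>F s in nhds t. exp (- 1 / s) / s^k = flat k s"
      using eventually_nhds_in_open[of "{0<..}" t] 1 by (auto elim!: eventually_mono simp: flat_def)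
    ultimately show ?thesis by (subst (asm) DERIV_cong_ev[OF refl _ refl])
  next
    case 2
    have "\<forall>\<^sub>F s in nhds t. flat k s = 0"
      using eventually_nhds_in_open[of "{..<0}" t] 2 by (auto elim!: eventually_mono simp: flat_def)
    then have "(flat k has_field_derivative 0) (at t)"
      by (subst DERIV_cong_ev[where g = "\<lambda>_. 0", OF refl _ refl]) (simp_all only: DERIV_const)
    then show ?thesis using 2 by (simp add: flat_eq_0)
  next
    case 3
    \<comment> \<open>The difference quotient of \<open>flat k\<close> at 0 is
      \<open>flat (k + 1)\<close>, whose limit is known.\<close>
    have "(flat k has_field_derivative 0) (at 0)"
      unfolding has_field_derivative_iff
    proof (rule Lim_transform_eventually[OF flat_tendsto_0[of "k+1"]])
      show "\<forall>\<^sub>F s in at 0. flat (k + 1) s = (flat k s - flat k 0) / (s - 0)"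
        by (intro always_eventually) (auto simp: flat_def)
    qed
    then show ?thesis using 3 by (simp add: flat_eq_0)
  qed
qed

lemma continuous_on_flat [continuous_intros]:
  "continuous_on S g \<Longrightarrow> continuous_on S (\<lambda>x. flat k (g x))"
  using flat_DERIV[THEN DERIV_isCont] continuous_on_compose2[of UNIV "flat k" S g]
  by (auto simp: continuous_on_eq_continuous_at)

lemma Ck_flat: "(\<And>n. Ck n g) \<Longrightarrow> Ck n (\<lambda>x. flat k (g x))"
proof (induction n arbitrary: k)
  case 0
  then show ?case using continuous_on_flat[OF Ck_imp_continuous[of 0 g]] by simp
next
  case (Suc n)
  have g: "((\<lambda>t. g (x + t *\<^sub>R axis i 1)) has_field_derivative pd i g x) (at 0)" "Ck n (pd i g)" for i x
    using Suc.prems[of "Suc n"] by (auto intro: has_pd)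
  show ?case
  proof (rule Ck_SucI[where D = "\<lambda>i x. (flat (k + 2) (g x) + (- real k) * flat (k + 1) (g x)) * pd i g x"])
    show "continuous_on UNIV (\<lambda>x. flat k (g x))"
      using Suc.prems by (intro continuous_on_flat Ck_imp_continuous[of 0])
    show "((\<lambda>t. flat k (g (x + t *\<^sub>R axis i 1))) has_field_derivative
           (flat (k + 2) (g x) + (- real k) * flat (k + 1) (g x)) * pd i g x) (at 0)" for i x
      using DERIV_chain2[OF flat_DERIV[of k "g (x + 0 *\<^sub>R axis i 1)"] g(1)[of x i]] by simp
    show "Ck n (\<lambda>x. (flat (k + 2) (g x) + (- real k) * flat (k + 1) (g x)) * pd i g x)" for i
      by (intro Ck_mult Ck_add Ck_cmult Suc.IH Suc.prems g)
  qed
qed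

text \<open>It serves twice: with \<open>a = 1\<close> as a mollifier, with
  \<open>a = 1 / L^2\<close> as a cutoff at scale \<open>L\<close>. The squared distance keeps the
  inner function polynomial, hence smooth also at the centre.\<close>

definition bump :: "real \<Rightarrow> real \<Rightarrow> real^'d \<Rightarrow> real^'d \<Rightarrow> real" where
  "bump r a c x = flat 0 (r - a * (norm (x - c))^2)"

lemma bump_commute: "bump r a c x = bump r a x c"
  by (simp add: bump_def norm_minus_commute)

lemma bump_nonneg: "0 \<le> bump r a c x"
  by (simp add: bump_def flat_nonneg)

lemma norm_diff_square_sum: "(norm (x - c))^2 = (\<Sum>j\<in>UNIV. (x $ j + (- c $ j)) * (x $ j + (- c $ j)))"
  for x :: "real^'d"
  by (simp add: power2_norm_eq_inner inner_vec_def)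

lemma bump_pd: "pd i (bump r a c) x = - 2 * a * (x - c) $ i * flat 2 (r - a * (norm (x - c))^2)"
proof (rule pd_eqI)
  have n: "((\<lambda>t. (norm (x + t *\<^sub>R axis i 1 - c))^2) has_field_derivative 2 * (x - c) $ i) (at 0)"
  proof -
    have eq: "(norm (x + t *\<^sub>R axis i 1 - c))^2 = (norm (x - c))^2 + 2 * t * (x - c) $ i + t^2" for t
    proof -
      have "x + t *\<^sub>R axis i 1 - c = (x - c) + t *\<^sub>R axis i 1" by simp
      then show ?thesis
        unfolding power2_norm_eq_inner \<open>x + t *\<^sub>R axis i 1 - c = (x - c) + t *\<^sub>R axis i 1\<close>
        by (simp only: inner_add_left inner_add_right inner_commute[of "axis i 1" "x - c"]
            inner_scaleR_left inner_scaleR_right)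
          (simp add: inner_axis inner_axis_axis power2_eq_square algebra_simps)
    qed
    show ?thesis unfolding eq by (auto intro!: derivative_eq_intros)
  qed
  show "((\<lambda>t. bump r a c (x + t *\<^sub>R axis i 1)) has_field_derivative
      - 2 * a * (x - c) $ i * flat 2 (r - a * (norm (x - c))^2)) (at 0)"
    unfolding bump_def
    using DERIV_chain2[OF flat_DERIV[of 0 "r - a * (norm (x + 0 *\<^sub>R axis i 1 - c))^2"]
      DERIV_diff[OF DERIV_const[of r] DERIV_cmult[OF n, of a]]]
    by (simp add: mult_ac numeral_2_eq_2)
qed

text \<open>This antisymmetry moves a derivative from one variable of the kernel to the other, where
  the weak gradient of the mollified function can absorb it.\<close>

lemma bump_pd_swap: "pd i (bump r a x) y = - pd i (bump r a y) x"
  by (simp add: bump_pd norm_minus_commute algebra_simps)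

lemma test_fn_bump:
  assumes "a > 0"
  shows "test_fn (bump r a c)"
  unfolding test_fn_iff
proof (intro conjI allI)
  show "Ck n (bump r a c)" for n
  proof -
    have "Ck n (\<lambda>x. r + (- a) * (\<Sum>j\<in>UNIV. (x $ j + (- c $ j)) * (x $ j + (- c $ j))))" for n
      by (intro Ck_add Ck_const Ck_cmult Ck_sum Ck_mult Ck_coord) auto
    from Ck_flat[OF this, of n 0] show ?thesis
      by (simp add: bump_def[abs_def] norm_diff_square_sum)
  qed
  show "\<exists>K. compact K \<and> (\<forall>x. x \<notin> K \<longrightarrow> bump r a c x = 0)"
  proof (intro exI[of _ "cball c (sqrt (\<bar>r\<bar> / a))"] conjI allI impI)
    fix x assume "x \<notin> cball c (sqrt (\<bar>r\<bar> / a))"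
    then have "sqrt (\<bar>r\<bar> / a) < norm (x - c)" by (simp add: dist_norm norm_minus_commute)
    then have "\<bar>r\<bar> / a < (norm (x - c))^2"
      using assms power_strict_mono[of "sqrt (\<bar>r\<bar> / a)" "norm (x - c)" 2] by simp
    then have "r - a * (norm (x - c))^2 \<le> 0" using assms by (simp add: field_simps)
    then show "bump r a c x = 0" by (simp add: bump_def flat_eq_0)
  qed simp
qed

subsection \<open>Translations in \<open>L\<^sup>2\<close>\<close>

lemma
  fixes f :: "'a::euclidean_space \<Rightarrow> 'b::{banach, second_countable_topology}"
  assumes [measurable]: "f \<in> borel_measurable borel"
  shows integrable_lborel_translate: "integrable lborel (\<lambda>x. f (x + z)) \<longleftrightarrow> integrable lborel f"
    and integral_lborel_translate: "(\<integral>x. f (x + z) \<partial>lborel) = (\<integral>x. f x \<partial>lborel)"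
proof -
  show "integrable lborel (\<lambda>x. f (x + z)) \<longleftrightarrow> integrable lborel f"
    by (subst (2) lborel_distr_plus[of z, symmetric]) (simp add: integrable_distr_eq add.commute)
  show "(\<integral>x. f (x + z) \<partial>lborel) = (\<integral>x. f x \<partial>lborel)"
    by (subst (2) lborel_distr_plus[of z, symmetric]) (simp add: integral_distr add.commute)
qed

text \<open>The free weight \<open>s\<close> makes the bound linear in the squares, hence compatible
  with any monotone linear mean; optimizing over \<open>s\<close> afterwards recovers
  Cauchy--Schwarz.\<close>

lemma abs_mult_le_young:
  fixes a b s :: real
  assumes "s > 0"
  shows "\<bar>a * b\<bar> \<le> (s * a^2 + b^2 / s) / 2"
proof -
  have "0 \<le> (s * \<bar>a\<bar> - \<bar>b\<bar>)^2 / s" using assms by simp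
  also have "\<dots> = s * a^2 - 2 * \<bar>a * b\<bar> + b^2 / s"
    using assms by (simp add: power2_diff power_mult_distrib abs_mult field_simps power2_eq_square)
  finally show ?thesis by simp
qed

lemma integrable_mult_square:
  fixes a b :: "'a \<Rightarrow> real"
  assumes [measurable]: "a \<in> borel_measurable M" "b \<in> borel_measurable M"
    and "integrable M (\<lambda>x. (a x)^2)" "integrable M (\<lambda>x. (b x)^2)"
  shows "integrable M (\<lambda>x. a x * b x)"
proof (rule Bochner_Integration.integrable_bound)
  show "integrable M (\<lambda>x. ((a x)^2 + (b x)^2) / 2)" using assms by simp
  show "AE x in M. norm (a x * b x) \<le> norm (((a x)^2 + (b x)^2) / 2)"
    using abs_mult_le_young[of 1] by (intro AE_I2) simp
qed simp

lemma integrable_diff_square: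
  fixes a b :: "'a \<Rightarrow> real"
  assumes "a \<in> borel_measurable M" "b \<in> borel_measurable M"
    and "integrable M (\<lambda>x. (a x)^2)" "integrable M (\<lambda>x. (b x)^2)"
  shows "integrable M (\<lambda>x. (a x - b x)^2)"
  using assms integrable_mult_square[OF assms] by (simp add: power2_diff mult.assoc)

lemma integral_mult_le_young:
  fixes a b :: "'a \<Rightarrow> real"
  assumes "a \<in> borel_measurable M" "b \<in> borel_measurable M"
    and "integrable M (\<lambda>x. (a x)^2)" "integrable M (\<lambda>x. (b x)^2)" and "s > 0"
  shows "\<bar>\<integral>x. a x * b x \<partial>M\<bar> \<le> (s * (\<integral>x. (a x)^2 \<partial>M) + (\<integral>x. (b x)^2 \<partial>M) / s) / 2"
proof -
  have "\<bar>\<integral>x. a x * b x \<partial>M\<bar> \<le> (\<integral>x. \<bar>a x * b x\<bar> \<partial>M)"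
    by (rule integral_abs_bound)
  also have "\<dots> \<le> (\<integral>x. (s * (a x)^2 + (b x)^2 / s) / 2 \<partial>M)"
    using assms integrable_mult_square[OF assms(1-4)]
    by (intro integral_mono abs_mult_le_young) auto
  also have "\<dots> = (s * (\<integral>x. (a x)^2 \<partial>M) + (\<integral>x. (b x)^2 \<partial>M) / s) / 2"
    using assms by simp
  finally show ?thesis .
qed

lemma integrable_continuous_compact_support:
  fixes g :: "'a::euclidean_space \<Rightarrow> real"
  assumes "continuous_on UNIV g" "\<And>x. R \<le> norm x \<Longrightarrow> g x = 0"
  shows "integrable lborel g"
proof -
  have "integrable lborel (\<lambda>x. indicator (cball 0 R) x *\<^sub>R g x)"
    using assms(1) by (intro borel_integrable_compact) (auto intro: continuous_on_subset)
  also have "(\<lambda>x. indicator (cball 0 R) x *\<^sub>R g x) = g"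
    using assms(2) by (force simp: indicator_def)
  finally show ?thesis .
qed

section \<open>Density of compactly supported continuous functions in mean square\<close>

lemma integral_square_approx_bounded_support:
  fixes b :: "'a::euclidean_space \<Rightarrow> real"
  assumes [measurable]: "b \<in> borel_measurable borel" and b: "integrable lborel (\<lambda>x. (b x)^2)" and "\<epsilon> > 0"
  obtains b' k where "b' \<in> borel_measurable borel" "\<And>x. \<bar>b' x\<bar> \<le> k" "\<And>x. k \<le> norm x \<Longrightarrow> b' x = 0"
    "integrable lborel (\<lambda>x. (b' x)^2)" "(\<integral>x. (b x - b' x)^2 \<partial>lborel) < \<epsilon>" "k > 0"
proof -
  define bb where "bb n x = (if \<bar>b x\<bar> \<le> real n \<and> norm x < real n then b x else 0)" for n x
  have [measurable]: "bb n \<in> borel_measurable borel" for n unfolding bb_def by measurable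
  have "(\<lambda>n. \<integral>x. (b x - bb n x)^2 \<partial>lborel) \<longlonglongrightarrow> (\<integral>x. 0 \<partial>(lborel::'a measure))"
  proof (rule integral_dominated_convergence[where w = "\<lambda>x. (b x)^2"])
    show "AE x in lborel. (\<lambda>n. (b x - bb n x)^2) \<longlonglongrightarrow> 0"
    proof (intro AE_I2 tendsto_eventually)
      fix x
      obtain N where N: "\<bar>b x\<bar> + norm x < real N" using reals_Archimedean2 by blast
      show "\<forall>\<^sub>F n in sequentially. (b x - bb n x)^2 = 0"
        using eventually_ge_at_top[of N]
      proof eventually_elim
        case (elim n)
        then have "real N \<le> real n" by simp
        with N have "\<bar>b x\<bar> \<le> real n" "norm x < real n" using norm_ge_zero[of x] by linarith+
        then show ?case by (simp add: bb_def)
      qed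
    qed
  qed (auto intro!: b simp: bb_def)
  then have "(\<lambda>n. \<integral>x. (b x - bb n x)^2 \<partial>lborel) \<longlonglongrightarrow> 0" by simp
  from order_tendstoD(2)[OF this \<open>\<epsilon> > 0\<close>] obtain n where n: "(\<integral>x. (b x - bb n x)^2 \<partial>lborel) < \<epsilon>"
    using eventually_happens' sequentially_bot by blast
  have "integrable lborel (\<lambda>x. (bb n x)^2)"
    by (rule Bochner_Integration.integrable_bound[OF b]) (auto simp: bb_def)
  then show ?thesis using n by (intro that[of "bb n" "real n + 1"]) (auto simp: bb_def)
qed

text \<open>A measurable function is almost everywhere a limit of continuous ones. Clamping these at
  the bound of the truncation \<open>b'\<close> and cutting them off outside its support keeps the
  limit and supplies an integrable majorant, so they converge in mean square as well.\<close>

lemma integral_square_approx_continuous: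
  fixes b :: "'a::euclidean_space \<Rightarrow> real"
  assumes b: "b \<in> borel_measurable borel" "integrable lborel (\<lambda>x. (b x)^2)" and "\<epsilon> > 0"
  obtains g R where "continuous_on UNIV g" "\<And>x. R \<le> norm x \<Longrightarrow> g x = 0" "R > 0"
    "(\<integral>x. (b x - g x)^2 \<partial>lborel) < \<epsilon>"
proof -
  obtain b' k where [measurable]: "b' \<in> borel_measurable borel" and b': "\<And>x. \<bar>b' x\<bar> \<le> k" "\<And>x. k \<le> norm x \<Longrightarrow> b' x = 0"
    "integrable lborel (\<lambda>x. (b' x)^2)" and bb': "(\<integral>x. (b x - b' x)^2 \<partial>lborel) < \<epsilon> / 4" and "k > 0"
    using integral_square_approx_bounded_support[OF b, of "\<epsilon> / 4"] \<open>\<epsilon> > 0\<close> by auto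
  note [measurable] = b(1)
  have "b' \<in> borel_measurable lebesgue" by (intro measurable_completion) simp
  then have "b' measurable_on UNIV" by (intro lebesgue_measurable_imp_measurable_on) auto
  then obtain N g where N: "negligible N" and g: "\<And>n. continuous_on UNIV (g n)"
      "\<And>x. x \<notin> N \<Longrightarrow> (\<lambda>n. g n x) \<longlonglongrightarrow> b' x"
    unfolding measurable_on_def by auto
  obtain N' where N': "N' \<in> null_sets lborel" "N \<subseteq> N'"
    using N unfolding negligible_iff_null_sets null_sets_completion_iff2 by blast
  define h where "h n x = max (- k) (min k (g n x)) * max 0 (min 1 (k + 1 - norm x))" for n x
  have h: "continuous_on UNIV (h n)" for n
    unfolding h_def by (intro continuous_intros g)
  then have [measurable]: "h n \<in> borel_measurable borel" for n by (rule borel_measurable_continuous_onI)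
  have h0: "h n x = 0" if "k + 1 \<le> norm x" for n x using that by (simp add: h_def)
  have hk: "\<bar>h n x\<bar> \<le> k" for n x
    unfolding h_def abs_mult using \<open>k > 0\<close> mult_mono[of "\<bar>max (- k) (min k (g n x))\<bar>" k "\<bar>max 0 (min 1 (k + 1 - norm x))\<bar>" 1]
    by auto
  have sq: "integrable lborel (\<lambda>x. (h n x)^2)" for n
    by (rule integrable_continuous_compact_support[of _ "k + 1"]) (auto intro!: continuous_intros h simp: h0)
  have "(\<lambda>n. \<integral>x. (b' x - h n x)^2 \<partial>lborel) \<longlonglongrightarrow> (\<integral>x. 0 \<partial>(lborel::'a measure))"
  proof (rule integral_dominated_convergence[where w = "\<lambda>x. 4 * k^2 * indicator (cball 0 (k + 1)) x"])
    show "integrable lborel (\<lambda>x. 4 * k^2 * indicator (cball 0 (k + 1)) x :: real)"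
      by (intro integrable_mult_right integrable_real_indicator emeasure_bounded_finite) auto
    show "AE x in lborel. (\<lambda>n. (b' x - h n x)^2) \<longlonglongrightarrow> 0"
    proof (rule AE_I'[OF N'(1)], safe)
      fix x assume *: "\<not> (\<lambda>n. (b' x - h n x)^2) \<longlonglongrightarrow> 0"
      show "x \<in> N'"
      proof (rule ccontr)
        assume "x \<notin> N'"
        then have "(\<lambda>n. g n x) \<longlonglongrightarrow> b' x" using N'(2) g(2) by blast
        then have "(\<lambda>n. h n x) \<longlonglongrightarrow> max (- k) (min k (b' x)) * max 0 (min 1 (k + 1 - norm x))"
          unfolding h_def by (intro tendsto_intros)
        also have "max (- k) (min k (b' x)) * max 0 (min 1 (k + 1 - norm x)) = b' x"
          using b'(1)[of x] b'(2)[of x] by (cases "k \<le> norm x") auto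
        finally have "(\<lambda>n. (b' x - h n x)^2) \<longlonglongrightarrow> (b' x - b' x)^2" by (intro tendsto_intros)
        with * show False by simp
      qed
    qed
    show "AE x in lborel. norm ((b' x - h n x)^2) \<le> 4 * k^2 * indicator (cball 0 (k + 1)) x" for n
    proof (intro AE_I2)
      fix x
      show "norm ((b' x - h n x)^2) \<le> 4 * k^2 * indicator (cball 0 (k + 1)) x"
      proof (cases "norm x \<le> k + 1")
        case True
        have "\<bar>b' x - h n x\<bar> \<le> 2 * k" using b'(1)[of x] hk[of n x] by linarith
        then have "(b' x - h n x)^2 \<le> (2 * k)^2" using \<open>k > 0\<close> by (metis abs_ge_zero power2_abs power_mono)
        then show ?thesis using True by (simp add: power_mult_distrib)
      next
        case False
        then show ?thesis using b'(2)[of x] h0[of x n] by simp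
      qed
    qed
  qed auto
  then have "(\<lambda>n. \<integral>x. (b' x - h n x)^2 \<partial>lborel) \<longlonglongrightarrow> 0" by simp
  from order_tendstoD(2)[OF this, of "\<epsilon> / 4"] \<open>\<epsilon> > 0\<close>
  obtain n where n: "(\<integral>x. (b' x - h n x)^2 \<partial>lborel) < \<epsilon> / 4"
    using eventually_happens' sequentially_bot by fastforce
  have i: "integrable lborel (\<lambda>x. (b x - b' x)^2)" "integrable lborel (\<lambda>x. (b' x - h n x)^2)"
    "integrable lborel (\<lambda>x. (b x - h n x)^2)"
    by (intro integrable_diff_square; simp add: b b' sq)+
  have "(\<integral>x. (b x - h n x)^2 \<partial>lborel) \<le> (\<integral>x. 2 * (b x - b' x)^2 + 2 * (b' x - h n x)^2 \<partial>lborel)"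
  proof (rule integral_mono)
    fix x
    have "0 \<le> ((b x - b' x) - (b' x - h n x))^2" by simp
    then show "(b x - h n x)^2 \<le> 2 * (b x - b' x)^2 + 2 * (b' x - h n x)^2"
      by (simp add: power2_eq_square algebra_simps)
  qed (use i in auto)
  also have "\<dots> < \<epsilon>" using i bb' n by simp
  finally show ?thesis using h h0 \<open>k > 0\<close> by (intro that[of "h n" "k + 1"]) auto
qed

text \<open>If \<open>b\<close> is continuous with compact support, uniform continuity suffices. In
  general the error of replacing \<open>b\<close> by such a function is uniform in the translation,
  because translations preserve the integral.\<close>

lemma isCont_correlation:
  fixes a b :: "'a::euclidean_space \<Rightarrow> real"
  assumes a: "a \<in> borel_measurable borel" "integrable lborel (\<lambda>x. (a x)^2)"
    and b: "b \<in> borel_measurable borel" "integrable lborel (\<lambda>x. (b x)^2)"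
  shows "isCont (\<lambda>z. \<integral>x. a x * b (x + z) \<partial>lborel) 0"
  unfolding isCont_def
proof (rule LIM_I)
  note [measurable] = a(1) b(1)
  fix \<delta> :: real assume "\<delta> > 0"
  define I where "I = (\<integral>x. (a x)^2 \<partial>lborel)"
  have I: "I \<ge> 0" by (simp add: I_def)
  \<comment> \<open>Budget: the replacement error costs at most \<open>\<delta> * 3 / 8\<close> at
    \<open>z\<close> and again at 0, the continuous part \<open>\<delta> / 8\<close>. The summand 1
    allows \<open>I = 0\<close>.\<close>
  define s where "s = \<delta> / (2 * (I + 1))"
  have s: "s > 0" "s * I \<le> \<delta> / 2" using I \<open>\<delta> > 0\<close> by (auto simp: s_def field_simps)
  obtain g R where g: "continuous_on UNIV g" and g0: "\<And>x. R \<le> norm x \<Longrightarrow> g x = 0" and "R > 0"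
    and bg: "(\<integral>x. (b x - g x)^2 \<partial>lborel) < s * \<delta> / 4"
    using integral_square_approx_continuous[OF b, of "s * \<delta> / 4"] s \<open>\<delta> > 0\<close> by auto
  have [measurable]: "g \<in> borel_measurable borel" using g by (rule borel_measurable_continuous_onI)
  have g2: "integrable lborel (\<lambda>x. (g x)^2)"
    by (rule integrable_continuous_compact_support[of _ R]) (auto intro!: continuous_intros g simp: g0)
  have bg2: "integrable lborel (\<lambda>x. (b x - g x)^2)"
    by (intro integrable_diff_square) (auto simp: b g2)
  have tail: "\<bar>\<integral>x. a x * (b (x + z) - g (x + z)) \<partial>lborel\<bar> \<le> \<delta> * 3 / 8" for z
  proof -
    have "integrable lborel (\<lambda>x. (b (x + z) - g (x + z))^2)"
      using bg2 by (subst integrable_lborel_translate[where f = "\<lambda>x. (b x - g x)^2"]) auto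
    then have "\<bar>\<integral>x. a x * (b (x + z) - g (x + z)) \<partial>lborel\<bar>
       \<le> (s * I + (\<integral>x. (b (x + z) - g (x + z))^2 \<partial>lborel) / s) / 2"
      unfolding I_def by (intro integral_mult_le_young) (auto simp: a s)
    also have "(\<integral>x. (b (x + z) - g (x + z))^2 \<partial>lborel) = (\<integral>x. (b x - g x)^2 \<partial>lborel)"
      by (rule integral_lborel_translate) simp
    finally have "\<bar>\<integral>x. a x * (b (x + z) - g (x + z)) \<partial>lborel\<bar> \<le> (s * I + (\<integral>x. (b x - g x)^2 \<partial>lborel) / s) / 2" .
    also have "\<dots> \<le> (\<delta> / 2 + \<delta> / 4) / 2"
      using bg s by (intro divide_right_mono add_mono) (auto simp: field_simps)
    finally show ?thesis by simp
  qed
  define C where "C = (\<integral>x. \<bar>a x\<bar> * indicator (cball 0 (R + 1)) x \<partial>lborel)"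
  have "integrable lborel (\<lambda>x::'a. indicator (cball 0 (R + 1)) x :: real)"
    by (intro integrable_real_indicator emeasure_bounded_finite) auto
  moreover have "(\<lambda>x::'a. (indicator (cball 0 (R + 1)) x :: real)^2) = indicator (cball 0 (R + 1))"
    by (auto simp: indicator_def)
  ultimately have ind2: "integrable lborel (\<lambda>x::'a. (indicator (cball 0 (R + 1)) x :: real)^2)" by simp
  have intC: "integrable lborel (\<lambda>x. \<bar>a x\<bar> * indicator (cball 0 (R + 1)) x)"
    by (intro integrable_mult_square borel_measurable_indicator) (auto simp: a ind2)
  have C: "C \<ge> 0" unfolding C_def by simp
  have "uniformly_continuous_on (cball 0 (R + 2)) g"
    by (intro compact_uniformly_continuous) (auto intro: continuous_on_subset[OF g])
  then obtain d where d: "d > 0" "\<And>x y. norm x \<le> R + 2 \<Longrightarrow> norm y \<le> R + 2 \<Longrightarrow> dist y x < d \<Longrightarrow>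
      \<bar>g y - g x\<bar> < \<delta> / (8 * (C + 1))"
    unfolding uniformly_continuous_on_def dist_real_def using C \<open>\<delta> > 0\<close>
    by (metis (no_types, lifting) add_nonneg_pos divide_pos_pos mem_cball_0 mult_pos_pos zero_less_numeral zero_less_one)
  show "\<exists>r>0. \<forall>z. z \<noteq> 0 \<and> norm (z - 0) < r \<longrightarrow>
     norm ((\<integral>x. a x * b (x + z) \<partial>lborel) - (\<integral>x. a x * b (x + 0) \<partial>lborel)) < \<delta>"
  proof (intro exI[of _ "min d 1"] conjI allI impI)
    fix z :: 'a assume "z \<noteq> 0 \<and> norm (z - 0) < min d 1"
    then have z: "norm z < d" "norm z < 1" by auto
    have gz: "\<bar>g (x + z) - g x\<bar> \<le> \<delta> / (8 * (C + 1)) * indicator (cball 0 (R + 1)) x" for x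
    proof (cases "norm x \<le> R + 1")
      case True
      then have "norm (x + z) \<le> R + 2" using norm_triangle_ineq[of x z] z by linarith
      then show ?thesis using d(2)[of x "x + z"] True z by (auto simp: dist_norm)
    next
      case False
      then have "R \<le> norm (x + z)" using norm_triangle_ineq2[of x "-z"] z by simp
      then show ?thesis using False g0 by simp
    qed
    have mid: "\<bar>\<integral>x. a x * (g (x + z) - g x) \<partial>lborel\<bar> \<le> \<delta> / 8"
    proof -
      have i: "integrable lborel (\<lambda>x. a x * (g (x + z) - g x))"
        using integrable_lborel_translate[where f = "\<lambda>x. (g x)^2"] g2
        by (intro integrable_mult_square integrable_diff_square) (auto simp: a)
      have "\<bar>\<integral>x. a x * (g (x + z) - g x) \<partial>lborel\<bar> \<le> (\<integral>x. \<bar>a x * (g (x + z) - g x)\<bar> \<partial>lborel)"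
        by (rule integral_abs_bound)
      also have "\<dots> \<le> (\<integral>x. \<delta> / (8 * (C + 1)) * (\<bar>a x\<bar> * indicator (cball 0 (R + 1)) x) \<partial>lborel)"
      proof (rule integral_mono)
        show "\<bar>a x * (g (x + z) - g x)\<bar> \<le> \<delta> / (8 * (C + 1)) * (\<bar>a x\<bar> * indicator (cball 0 (R + 1)) x)" for x
          using mult_left_mono[OF gz[of x], of "\<bar>a x\<bar>"] by (simp add: abs_mult mult_ac)
      qed (use i intC in auto)
      also have "\<dots> = \<delta> / (8 * (C + 1)) * C" using intC by (simp add: C_def)
      also have "\<dots> \<le> \<delta> / 8" using C \<open>\<delta> > 0\<close> by (simp add: field_simps)
      finally show ?thesis .
    qed
    have i: "integrable lborel (\<lambda>x. a x * b (x + w))" "integrable lborel (\<lambda>x. a x * g (x + w))" for w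
      using integrable_lborel_translate[where f = "\<lambda>x. (g x)^2"] g2
       integrable_lborel_translate[where f = "\<lambda>x. (b x)^2"] b(2)
      by (intro integrable_mult_square; simp add: a)+
    have eq: "(\<integral>x. a x * b (x + w) \<partial>lborel) = (\<integral>x. a x * (b (x + w) - g (x + w)) \<partial>lborel) + (\<integral>x. a x * g (x + w) \<partial>lborel)" for w
      using i[of w] by (simp add: right_diff_distrib)
    have eq2: "(\<integral>x. a x * g (x + z) \<partial>lborel) = (\<integral>x. a x * (g (x + z) - g x) \<partial>lborel) + (\<integral>x. a x * g (x + 0) \<partial>lborel)"
      using i(2)[of z] i(2)[of 0] by (simp add: right_diff_distrib)
    show "norm ((\<integral>x. a x * b (x + z) \<partial>lborel) - (\<integral>x. a x * b (x + 0) \<partial>lborel)) < \<delta>"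
      using tail[of z] tail[of 0] mid eq[of z] eq[of 0] eq2 \<open>\<delta> > 0\<close> unfolding real_norm_def by linarith
  qed (use d in auto)
qed

subsection \<open>The product rule for weak gradients\<close>

text \<open>These are the integrability conditions for Fubini before and after a shear of the plane
  of variables; the sheared one holds because translations preserve the integral of
  \<open>\<bar>b\<bar>\<close>.\<close>

lemma integrable_pair_kernel:
  fixes a b :: "'a::euclidean_space \<Rightarrow> real" and K :: "'a \<Rightarrow> 'a \<Rightarrow> real"
  assumes a: "integrable lborel a" and b: "integrable lborel b"
    and [measurable]: "case_prod K \<in> borel_measurable (borel \<Otimes>\<^sub>M borel)" and K: "\<And>x y. \<bar>K x y\<bar> \<le> M"
  shows "integrable (lborel \<Otimes>\<^sub>M lborel) (\<lambda>(x, y). a x * K x y * b y)"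
    and "integrable (lborel \<Otimes>\<^sub>M lborel) (\<lambda>(x, y). a x * K x y * b (x + y))"
proof -
  have [measurable]: "a \<in> borel_measurable borel" "b \<in> borel_measurable borel"
    using a b by (auto dest: borel_measurable_integrable)
  have w1: "integrable (lborel \<Otimes>\<^sub>M lborel) (\<lambda>(x, y). a x * b y)"
    by (intro lborel_pair.Fubini_integrable) (auto simp: abs_mult intro!: a b)
  have bx: "integrable lborel (\<lambda>y. b (x + y))" for x
    using integrable_lborel_translate[of b x] b by (simp add: add.commute)
  have "(\<integral>y. \<bar>b (x + y)\<bar> \<partial>lborel) = (\<integral>y. \<bar>b y\<bar> \<partial>lborel)" for x
    using integral_lborel_translate[of "\<lambda>y. \<bar>b y\<bar>" x] by (simp add: add.commute)
  then have w2: "integrable (lborel \<Otimes>\<^sub>M lborel) (\<lambda>(x, y). a x * b (x + y))"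
    by (intro lborel_pair.Fubini_integrable) (auto simp: abs_mult intro!: a bx)
  have bound: "\<bar>s * K x y * t\<bar> \<le> \<bar>M * (s * t)\<bar>" for s t x y
  proof -
    have "\<bar>K x y\<bar> \<le> \<bar>M\<bar>" using K[of x y] by linarith
    then have "\<bar>K x y\<bar> * (\<bar>s\<bar> * \<bar>t\<bar>) \<le> \<bar>M\<bar> * (\<bar>s\<bar> * \<bar>t\<bar>)" by (intro mult_right_mono) auto
    then show ?thesis by (simp add: abs_mult mult_ac)
  qed
  show "integrable (lborel \<Otimes>\<^sub>M lborel) (\<lambda>(x, y). a x * K x y * b y)"
    by (rule Bochner_Integration.integrable_bound[OF integrable_mult_right[OF w1, of M]])
       (auto intro!: AE_I2 bound)
  show "integrable (lborel \<Otimes>\<^sub>M lborel) (\<lambda>(x, y). a x * K x y * b (x + y))"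
    by (rule Bochner_Integration.integrable_bound[OF integrable_mult_right[OF w2, of M]])
       (auto intro!: AE_I2 bound)
qed

text \<open>The Borel counterpart of \<open>L2loc\<close>: Fubini is applied on products of
  \<open>lborel\<close>, so Borel representatives are used throughout the analysis.\<close>

definition locally_L2 :: "('a::euclidean_space \<Rightarrow> real) \<Rightarrow> bool" where
  "locally_L2 f \<longleftrightarrow> f \<in> borel_measurable borel \<and>
     (\<forall>R. integrable lborel (\<lambda>x. (indicator (cball 0 R) x * f x)^2))"

lemma locally_L2_measurable: "locally_L2 f \<Longrightarrow> f \<in> borel_measurable borel"
  by (simp add: locally_L2_def)

lemma integrable_of_square:
  fixes f :: "'a::euclidean_space \<Rightarrow> real"
  assumes [measurable]: "f \<in> borel_measurable borel" and f: "integrable lborel (\<lambda>x. (f x)^2)"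
    and f0: "\<And>x. R < norm x \<Longrightarrow> f x = 0"
  shows "integrable lborel f"
proof -
  have i: "integrable lborel (\<lambda>x::'a. indicator (cball 0 R) x :: real)"
    by (intro integrable_real_indicator emeasure_bounded_finite) auto
  moreover have "(\<lambda>x::'a. (indicator (cball 0 R) x :: real)^2) = indicator (cball 0 R)"
    by (auto simp: indicator_def)
  ultimately have "integrable lborel (\<lambda>x. f x * indicator (cball 0 R) x)"
    using f by (intro integrable_mult_square borel_measurable_indicator) auto
  also have "(\<lambda>x. f x * indicator (cball 0 R) x) = f"
    using f0 by (force simp: indicator_def)
  finally show ?thesis .
qed

lemma locally_L2_mult_continuous:
  fixes w :: "'a::euclidean_space \<Rightarrow> real"
  assumes f: "locally_L2 f" and w: "continuous_on UNIV w"
  shows "locally_L2 (\<lambda>x. f x * w x)"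
  unfolding locally_L2_def
proof (intro conjI allI)
  have [measurable]: "f \<in> borel_measurable borel" "w \<in> borel_measurable borel"
    using f w by (auto simp: locally_L2_def intro: borel_measurable_continuous_onI)
  show "(\<lambda>x. f x * w x) \<in> borel_measurable borel" by simp
  fix R
  have "bounded (w ` cball 0 R)"
    by (intro compact_imp_bounded compact_continuous_image continuous_on_subset[OF w]) auto
  then obtain M where M: "\<And>x. x \<in> cball 0 R \<Longrightarrow> \<bar>w x\<bar> \<le> M"
    unfolding bounded_iff by (metis imageI real_norm_def)
  show "integrable lborel (\<lambda>x. (indicator (cball 0 R) x * (f x * w x))^2)"
  proof (rule Bochner_Integration.integrable_bound)
    show "integrable lborel (\<lambda>x. M^2 * (indicator (cball 0 R) x * f x)^2)"
      using f by (auto simp: locally_L2_def)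
    have "(w x)^2 \<le> M^2" if "norm x \<le> R" for x
      using M[of x] that by (simp add: abs_le_square_iff[symmetric])
    then show "AE x in lborel. norm ((indicator (cball 0 R) x * (f x * w x))^2) \<le> norm (M^2 * (indicator (cball 0 R) x * f x)^2)"
      by (intro AE_I2) (auto simp: indicator_def power_mult_distrib mult_right_mono mult.commute[of "(f _)^2"])
    show "(\<lambda>x. (indicator (cball 0 R) x * (f x * w x))^2) \<in> borel_measurable lborel"
      by (intro borel_measurable_power borel_measurable_times borel_measurable_indicator) auto
  qed
qed

lemma locally_L2_compact_support:
  fixes f :: "'a::euclidean_space \<Rightarrow> real"
  assumes f: "locally_L2 f" and f0: "\<And>x. R \<le> norm x \<Longrightarrow> f x = 0"
  shows "integrable lborel (\<lambda>x. (f x)^2)"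
proof -
  have "(\<lambda>x. (indicator (cball 0 R) x * f x)^2) = (\<lambda>x. (f x)^2)"
    using f0 by (force simp: indicator_def)
  then show ?thesis using f unfolding locally_L2_def by metis
qed

lemma locally_L2_times_compact:
  fixes w :: "'a::euclidean_space \<Rightarrow> real"
  assumes f: "locally_L2 f" and w: "continuous_on UNIV w" and w0: "\<And>x. R \<le> norm x \<Longrightarrow> w x = 0"
  shows "integrable lborel (\<lambda>x. (f x * w x)^2)"
  by (intro locally_L2_compact_support[where R = R] locally_L2_mult_continuous f w) (simp add: w0)

lemma locally_L2_mult_integrable:
  fixes w :: "'a::euclidean_space \<Rightarrow> real"
  assumes f: "locally_L2 f" and g: "locally_L2 g" and w: "continuous_on UNIV w" and w0: "\<And>x. R \<le> norm x \<Longrightarrow> w x = 0"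
  shows "integrable lborel (\<lambda>x. f x * g x * w x)"
proof -
  have [measurable]: "f \<in> borel_measurable borel" "g \<in> borel_measurable borel" "w \<in> borel_measurable borel"
    using f g w by (auto simp: locally_L2_def intro: borel_measurable_continuous_onI)
  have "integrable lborel (\<lambda>x. (f x * w x) * (indicator (cball 0 R) x * g x))"
    using locally_L2_times_compact[OF f w w0] g
    by (intro integrable_mult_square borel_measurable_times borel_measurable_indicator) (auto simp: locally_L2_def)
  also have "(\<lambda>x. (f x * w x) * (indicator (cball 0 R) x * g x)) = (\<lambda>x. f x * g x * w x)"
    using w0 by (force simp: indicator_def)
  finally show ?thesis .
qed

lemma locally_L2_const: "locally_L2 (\<lambda>x::'a::euclidean_space. c)"
proof -
  have "integrable lborel (\<lambda>x::'a. indicator (cball 0 R) x * c^2)" for R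
    by (intro integrable_mult_left integrable_real_indicator emeasure_bounded_finite) auto
  moreover have "(\<lambda>x::'a. (indicator (cball 0 R) x * c)^2) = (\<lambda>x. indicator (cball 0 R) x * c^2)" for R
    by (auto simp: indicator_def)
  ultimately show ?thesis by (simp add: locally_L2_def)
qed

lemma locally_L2_add:
  assumes f: "locally_L2 f" and g: "locally_L2 g"
  shows "locally_L2 (\<lambda>x. f x + g x)"
  unfolding locally_L2_def
proof (intro conjI allI)
  have [measurable]: "f \<in> borel_measurable borel" "g \<in> borel_measurable borel"
    using f g by (auto simp: locally_L2_def)
  show "(\<lambda>x. f x + g x) \<in> borel_measurable borel" by simp
  fix R
  have "integrable lborel (\<lambda>x. (indicator (cball 0 R) x * f x - - (indicator (cball 0 R) x * g x))^2)"
    using f g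
    by (intro integrable_diff_square borel_measurable_times borel_measurable_uminus borel_measurable_indicator)
       (auto simp: locally_L2_def)
  then show "integrable lborel (\<lambda>x. (indicator (cball 0 R) x * (f x + g x))^2)"
    by (simp add: algebra_simps)
qed

lemma locally_L2_sum: "finite I \<Longrightarrow> (\<And>i. i \<in> I \<Longrightarrow> locally_L2 (f i)) \<Longrightarrow> locally_L2 (\<lambda>x. \<Sum>i\<in>I. f i x)"
  by (induction I rule: finite_induct) (auto intro: locally_L2_const locally_L2_add)

lemma locally_L2_test_integrable:
  fixes w :: "'a::euclidean_space \<Rightarrow> real"
  assumes f: "locally_L2 f" and w: "continuous_on UNIV w" and w0: "\<And>x. R \<le> norm x \<Longrightarrow> w x = 0"
  shows "integrable lborel (\<lambda>x. f x * w x)"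
  using locally_L2_mult_integrable[OF f locally_L2_const[of 1] w w0] by simp

section \<open>Mollified pairings by Fubini\<close>

context
  fixes a b :: "'a::euclidean_space \<Rightarrow> real" and R :: real
  assumes a: "a \<in> borel_measurable borel" "integrable lborel (\<lambda>x. (a x)^2)" "\<And>x. R \<le> norm x \<Longrightarrow> a x = 0"
    and b: "locally_L2 b"
begin

text \<open>Kernels below live in the unit ball and \<open>a\<close> in the ball of radius
  \<open>R\<close>, so only values of \<open>b\<close> within radius \<open>R + 1\<close> are seen.
  The truncation is globally integrable.\<close>

private definition "b' x = indicator (cball 0 (R + 1)) x * b x"

lemma b': "b' \<in> borel_measurable borel" "integrable lborel (\<lambda>x. (b' x)^2)" "integrable lborel b'"
proof -
  show m: "b' \<in> borel_measurable borel" and s: "integrable lborel (\<lambda>x. (b' x)^2)"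
    using b by (auto simp: b'_def[abs_def] locally_L2_def intro!: borel_measurable_times borel_measurable_indicator)
  show "integrable lborel b'"
    by (rule integrable_of_square[OF m s, of "R + 1"]) (simp add: b'_def)
qed

lemma a_integrable: "integrable lborel a"
  using a by (intro integrable_of_square[of a R]) auto

lemma a_b': "norm z \<le> 1 \<Longrightarrow> a x * b' (x + z) = a x * b (x + z)"
  using a(3)[of x] norm_triangle_ineq[of x z] by (cases "R \<le> norm x") (auto simp: b'_def)

context
  fixes K :: "'a \<Rightarrow> real"
  assumes K: "continuous_on UNIV K" "\<And>x. 1 \<le> norm x \<Longrightarrow> K x = 0"
begin

lemma kernel_measurable: "K \<in> borel_measurable borel"
  using K(1) by (rule borel_measurable_continuous_onI)

lemma kernel_bounded: obtains M where "\<And>x. \<bar>K x\<bar> \<le> M"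
proof -
  have "bounded (K ` cball 0 1)"
    by (intro compact_imp_bounded compact_continuous_image continuous_on_subset[OF K(1)]) auto
  then obtain M where M: "\<And>x. x \<in> cball 0 1 \<Longrightarrow> \<bar>K x\<bar> \<le> M"
    unfolding bounded_iff by (metis imageI real_norm_def)
  have "\<bar>K x\<bar> \<le> \<bar>M\<bar>" for x using M[of x] K(2)[of x] by (cases "norm x \<le> 1") auto
  then show ?thesis by (rule that)
qed

lemma a_K_b': "a x * K (x - y) * b' y = a x * K (x - y) * b y"
  using a_b'[of "y - x" x] K(2)[of "x - y"] by (cases "1 \<le> norm (x - y)") (auto simp: norm_minus_commute mult.assoc mult.left_commute)

lemma a_K_b'_shear: "a x * K z * b' (x + z) = a x * K z * b (x + z)"
  using a_b'[of z x] K(2)[of z] by (cases "1 \<le> norm z") (auto simp: mult.assoc mult.left_commute)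

lemma integrable_kernel: "integrable (lborel \<Otimes>\<^sub>M lborel) (\<lambda>(x, y). a x * K (x - y) * b y)"
proof -
  note [measurable] = kernel_measurable
  obtain M where M: "\<And>x. \<bar>K x\<bar> \<le> M" using kernel_bounded by blast
  have "integrable (lborel \<Otimes>\<^sub>M lborel) (\<lambda>(x, y). a x * K (x - y) * b' y)"
    by (rule integrable_pair_kernel(1)[OF a_integrable b'(3) _ M]) measurable
  then show ?thesis by (simp only: a_K_b')
qed

lemma integrable_kernel_shear: "integrable (lborel \<Otimes>\<^sub>M lborel) (\<lambda>(x, z). a x * K z * b (x + z))"
proof -
  note [measurable] = kernel_measurable
  obtain M where M: "\<And>x. \<bar>K x\<bar> \<le> M" using kernel_bounded by blast
  have "integrable (lborel \<Otimes>\<^sub>M lborel) (\<lambda>(x, z). a x * K z * b' (x + z))"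
    by (rule integrable_pair_kernel(2)[OF a_integrable b'(3) _ M]) measurable
  then show ?thesis by (simp only: a_K_b'_shear)
qed

lemma kernel_fubini:
  "(\<integral>y. (\<integral>x. a x * K (x - y) \<partial>lborel) * b y \<partial>lborel) = (\<integral>x. a x * (\<integral>y. K (x - y) * b y \<partial>lborel) \<partial>lborel)"
  and integrable_kernel_snd: "integrable lborel (\<lambda>y. (\<integral>x. a x * K (x - y) \<partial>lborel) * b y)"
  using lborel_pair.Fubini_integral[OF integrable_kernel] lborel_pair.integrable_snd[OF integrable_kernel]
  by (simp_all add: mult.assoc flip: integral_mult_left_zero integral_mult_right_zero)

lemma integrable_kernel_correlation: "integrable lborel (\<lambda>z. K z * (\<integral>x. a x * b (x + z) \<partial>lborel))"
  using lborel_pair.integrable_snd[OF integrable_kernel_shear]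
  by (simp add: mult_ac flip: integral_mult_right_zero)

text \<open>The substitution \<open>y = x + z\<close> separates the kernel from the data: mollifying
  \<open>b\<close> amounts to averaging the correlation of \<open>a\<close> and \<open>b\<close>
  against \<open>K\<close>, so continuity of the correlation governs shrinking kernels.\<close>

lemma kernel_shear:
  assumes even: "\<And>z. K (- z) = K z"
  shows "(\<integral>x. a x * (\<integral>y. K (x - y) * b y \<partial>lborel) \<partial>lborel) = (\<integral>z. K z * (\<integral>x. a x * b (x + z) \<partial>lborel) \<partial>lborel)"
proof -
  note [measurable] = kernel_measurable locally_L2_measurable[OF b]
  have "(\<integral>y. K (x - y) * b y \<partial>lborel) = (\<integral>z. K z * b (x + z) \<partial>lborel)" for x
    using integral_lborel_translate[of "\<lambda>y. K (x - y) * b y" x] by (simp add: even add.commute)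
  then have "(\<integral>x. a x * (\<integral>y. K (x - y) * b y \<partial>lborel) \<partial>lborel)
     = (\<integral>x. (\<integral>z. a x * K z * b (x + z) \<partial>lborel) \<partial>lborel)"
    by (simp add: mult.assoc flip: integral_mult_right_zero)
  also have "\<dots> = (\<integral>z. (\<integral>x. a x * K z * b (x + z) \<partial>lborel) \<partial>lborel)"
    by (rule lborel_pair.Fubini_integral[OF integrable_kernel_shear, symmetric])
  also have "\<dots> = (\<integral>z. K z * (\<integral>x. a x * b (x + z) \<partial>lborel) \<partial>lborel)"
    by (simp add: mult_ac flip: integral_mult_right_zero)
  finally show ?thesis .
qed

end

lemma isCont_correlation_local: "isCont (\<lambda>z. \<integral>x. a x * b (x + z) \<partial>lborel) 0"
proof -
  have "\<forall>\<^sub>F z::'a in nhds 0. norm z < 1"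
    using eventually_nhds_in_open[of "ball (0::'a) 1" 0] by simp
  then have "\<forall>\<^sub>F z in nhds 0. (\<integral>x. a x * b' (x + z) \<partial>lborel) = (\<integral>x. a x * b (x + z) \<partial>lborel)"
    by eventually_elim (simp add: a_b')
  then show ?thesis
    using isCont_correlation[OF a(1,2) b'(1,2)] isCont_cong by fast
qed

end

text \<open>Through \<open>kernel_shear\<close> the hypothesis says that the total correlation
  \<open>C\<close> has zero integral against every small bump. Were \<open>C 0\<close> nonzero,
  continuity would give \<open>C\<close> its sign near 0, and positivity of the bump would make the
  integral nonzero.\<close>

lemma correlation_eq_0:
  fixes a b :: "'k \<Rightarrow> real^'d \<Rightarrow> real"
  assumes I: "finite I"
    and a: "\<And>k. k \<in> I \<Longrightarrow> a k \<in> borel_measurable borel" "\<And>k. k \<in> I \<Longrightarrow> integrable lborel (\<lambda>x. (a k x)^2)"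
      "\<And>k x. k \<in> I \<Longrightarrow> R \<le> norm x \<Longrightarrow> a k x = 0"
    and b: "\<And>k. k \<in> I \<Longrightarrow> locally_L2 (b k)"
    and eq: "\<And>r. 0 < r \<Longrightarrow> r \<le> 1 \<Longrightarrow>
      (\<Sum>k\<in>I. \<integral>x. a k x * (\<integral>y. bump (r^2) 1 0 (x - y) * b k y \<partial>lborel) \<partial>lborel) = 0"
  shows "(\<Sum>k\<in>I. \<integral>x. a k x * b k x \<partial>lborel) = 0"
proof -
  define C where "C z = (\<Sum>k\<in>I. \<integral>x. a k x * b k (x + z) \<partial>lborel)" for z
  have cont: "isCont C 0" unfolding C_def
    using isCont_correlation_local[OF a b] by (intro continuous_sum) auto
  define K where "K r = (bump (r^2) 1 0 :: real^'d \<Rightarrow> real)" for r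
  have K: "continuous_on UNIV (K r)" for r
    unfolding K_def by (intro test_fn_continuous test_fn_bump) simp
  have K0: "K r x = 0" if "r \<le> norm x" "0 < r" for r x
    using that by (simp add: K_def bump_def flat_eq_0 power_mono)
  have Kpos: "0 < K r x" if "norm x < r" for r x
    using that by (simp add: K_def bump_def flat_pos power_strict_mono)
  have Keven: "K r (- x) = K r x" for r x by (simp add: K_def bump_def)
  have Kge: "0 \<le> K r x" for r x by (simp add: K_def bump_nonneg)
  have KC: "integrable lborel (\<lambda>z. K r z * C z)" "(\<integral>z. K r z * C z \<partial>lborel) = 0" if r: "0 < r" "r \<le> 1" for r
  proof -
    have i: "integrable lborel (\<lambda>z. K r z * (\<integral>x. a k x * b k (x + z) \<partial>lborel))" if "k \<in> I" for k
      using that r by (intro integrable_kernel_correlation[OF a b K]) (auto simp: K0)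
    then show "integrable lborel (\<lambda>z. K r z * C z)"
      unfolding C_def sum_distrib_left by (intro Bochner_Integration.integrable_sum)
    have "(\<integral>z. K r z * C z \<partial>lborel) = (\<Sum>k\<in>I. \<integral>z. K r z * (\<integral>x. a k x * b k (x + z) \<partial>lborel) \<partial>lborel)"
      unfolding C_def sum_distrib_left by (intro Bochner_Integration.integral_sum i)
    also have "\<dots> = (\<Sum>k\<in>I. \<integral>x. a k x * (\<integral>y. K r (x - y) * b k y \<partial>lborel) \<partial>lborel)"
      using r by (intro sum.cong refl kernel_shear[OF a b K, symmetric]) (auto simp: K0 Keven)
    also have "\<dots> = 0" using eq[OF r] by (simp add: K_def)
    finally show "(\<integral>z. K r z * C z \<partial>lborel) = 0" .
  qed
  have "C 0 = 0"
  proof (rule ccontr)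
    assume "C 0 \<noteq> 0"
    then have "\<bar>C 0\<bar> / 2 > 0" by simp
    then obtain d where d: "d > 0" "\<And>z. dist z 0 < d \<Longrightarrow> dist (C z) (C 0) < \<bar>C 0\<bar> / 2"
      using cont unfolding continuous_at by (metis isCont_def cont continuous_at_eps_delta)
    define r where "r = min d 1"
    have r: "0 < r" "r \<le> 1" using d by (auto simp: r_def)
    have Kint: "integrable lborel (K r)"
      using r by (intro integrable_continuous_compact_support[OF K, of r]) (auto simp: K0)
    \<comment> \<open>Multiplying by the sign of \<open>C 0\<close> treats both signs at
      once.\<close>
    have "0 = (\<integral>z. K r z * C z * sgn (C 0) \<partial>lborel)"
      using KC[OF r] by simp
    also have "\<dots> \<ge> (\<integral>z. K r z * (\<bar>C 0\<bar> / 2) \<partial>lborel)"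
    proof (rule integral_mono)
      show "integrable lborel (\<lambda>z. K r z * (\<bar>C 0\<bar> / 2))" using Kint by simp
      show "integrable lborel (\<lambda>z. K r z * C z * sgn (C 0))" using KC[OF r] by simp
      fix z
      show "K r z * (\<bar>C 0\<bar> / 2) \<le> K r z * C z * sgn (C 0)"
      proof (cases "norm z < r")
        case True
        then have "\<bar>C z - C 0\<bar> < \<bar>C 0\<bar> / 2" using d(2)[of z] by (simp add: r_def dist_norm)
        then have "\<bar>C 0\<bar> / 2 \<le> C z * sgn (C 0)" by (auto simp: sgn_if abs_if split: if_splits)
        then show ?thesis using mult_left_mono[OF _ Kge[of r z]] by (simp add: mult.assoc)
      qed (use K0 r in auto)
    qed
    finally have "(\<integral>z. K r z \<partial>lborel) * (\<bar>C 0\<bar> / 2) \<le> 0" by simp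
    then have "(\<integral>z. K r z \<partial>lborel) \<le> 0" using \<open>C 0 \<noteq> 0\<close> by (simp add: mult_le_0_iff)
    then have "(\<integral>z. K r z \<partial>lborel) = 0" using Bochner_Integration.integral_nonneg[of lborel "K r", OF Kge] by simp
    then have ae: "AE z in lborel. K r z = 0"
      using integral_nonneg_eq_0_iff_AE[OF Kint] Kge by simp
    then have "AE z in lborel. z \<notin> ball (0::real^'d) r"
      using Kpos by (auto elim!: eventually_mono) (metis less_irrefl)
    then have "emeasure lborel (ball (0::real^'d) r) = 0"
      by (subst (asm) AE_iff_measurable[where N = "ball 0 r"]) auto
    moreover have "0 < emeasure lborel (ball (0::real^'d) r)"
      using r by (simp add: emeasure_ball)
    ultimately show False by simp
  qed
  then show ?thesis by (simp add: C_def)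
qed

lemma sum_UNIV_option: "(\<Sum>k\<in>UNIV. F k) = F None + (\<Sum>i\<in>UNIV. F (Some i))"
  for F :: "'k::finite option \<Rightarrow> real"
  by (simp add: UNIV_option_conv sum.reindex)

text \<open>Mollifying \<open>v\<close> amounts to testing the equation with \<open>x \<mapsto> \<eta> x * \<rho>\<^sub>r (x - y)\<close> and integrating against
  \<open>v y\<close>, so only products of test functions are needed, and never the smoothness of a convolution.\<close>

lemma weak_product_rule:
  fixes f H :: "'d::finite \<Rightarrow> real^'d \<Rightarrow> real" and g v :: "real^'d \<Rightarrow> real"
  assumes f: "\<And>i. locally_L2 (f i)" and g: "locally_L2 g"
    and eq: "\<And>\<phi>. test_fn \<phi> \<Longrightarrow> (\<integral>x. (\<Sum>i\<in>UNIV. f i x * pd i \<phi> x) + g x * \<phi> x \<partial>lborel) = 0"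
    and v: "locally_L2 v" and H: "\<And>i. locally_L2 (H i)"
    and grad: "\<And>\<phi> i. test_fn \<phi> \<Longrightarrow> (\<integral>x. v x * pd i \<phi> x \<partial>lborel) = - (\<integral>x. H i x * \<phi> x \<partial>lborel)"
    and \<eta>: "test_fn \<eta>"
  shows "(\<integral>x. (\<Sum>i\<in>UNIV. f i x * (pd i \<eta> x * v x + \<eta> x * H i x)) + g x * (\<eta> x * v x) \<partial>lborel) = 0"
proof -
  obtain R where R: "R > 0" "\<And>x. R \<le> norm x \<Longrightarrow> \<eta> x = 0" "\<And>x i. R \<le> norm x \<Longrightarrow> pd i \<eta> x = 0"
    using test_fn_support[OF \<eta>] by blast
  note \<eta>c = test_fn_continuous[OF \<eta>] test_fn_pd_continuous[OF \<eta>]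
  \<comment> \<open>When the derivatives of \<eta> times the kernel are expanded,
    \<open>a None\<close> is the coefficient of the kernel and \<open>a (Some i)\<close> that of its
    derivative in direction \<open>i\<close>; \<open>b\<close> lists the partners \<open>v\<close>
    and \<open>H i\<close>. The option type lets \<open>correlation_eq_0\<close> handle all terms in
    one sum, since only the sum vanishes.\<close>
  define a where "a k x = (case k of None \<Rightarrow> (\<Sum>i\<in>UNIV. f i x * pd i \<eta> x) + g x * \<eta> x | Some i \<Rightarrow> f i x * \<eta> x)" for k x
  define b where "b k = (case k of None \<Rightarrow> v | Some i \<Rightarrow> H i)" for k
  have aL: "locally_L2 (a k)" for k
    unfolding a_def using f g \<eta>c
    by (cases k) (auto intro!: locally_L2_add locally_L2_sum locally_L2_mult_continuous)
  have a0: "a k x = 0" if "R \<le> norm x" for k x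
    using R that by (simp add: a_def split: option.split)
  have bL: "locally_L2 (b k)" for k
    unfolding b_def using v H by (simp split: option.split)
  note am = locally_L2_measurable[OF aL] and a2 = locally_L2_compact_support[OF aL a0]
  have "(\<Sum>k\<in>UNIV. \<integral>x. a k x * b k x \<partial>lborel) = 0"
  proof (rule correlation_eq_0[OF _ am a2 a0 bL])
    fix r :: real assume r: "0 < r" "r \<le> 1"
    define \<rho> where "\<rho> y x = bump (r^2) 1 y x" for y x :: "real^'d"
    have \<rho>: "test_fn (\<rho> y)" for y unfolding \<rho>_def[abs_def] by (rule test_fn_bump) simp
    have \<rho>0: "test_fn (\<rho> 0)" by (rule \<rho>)
    have \<rho>_diff: "\<rho> y x = \<rho> 0 (x - y)" for x y by (simp add: \<rho>_def bump_def)
    have \<rho>_sym: "\<rho> y x = \<rho> x y" for x y unfolding \<rho>_def by (rule bump_commute)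
    have pd_diff: "pd i (\<rho> y) x = pd i (\<rho> 0) (x - y)" for i x y
      unfolding \<rho>_def[abs_def] by (simp add: bump_pd)
    have pd_swap: "pd i (\<rho> y) x = - pd i (\<rho> x) y" for i x y
      unfolding \<rho>_def[abs_def] by (rule bump_pd_swap)
    have supp: "\<rho> 0 z = 0" "pd i (\<rho> 0) z = 0" if "1 \<le> norm z" for z i
    proof -
      have "r^2 \<le> (norm z)^2" using that r by (intro power_mono) auto
      then show "\<rho> 0 z = 0" "pd i (\<rho> 0) z = 0"
        unfolding \<rho>_def[abs_def] by (simp_all add: bump_def[of _ _ _ z] bump_pd flat_eq_0)
    qed
    note K = test_fn_continuous[OF \<rho>0] and K0 = supp(1)
    note K' = test_fn_pd_continuous[OF \<rho>0] and K0' = supp(2)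
    \<comment> \<open>This is the equation tested with \<eta> times the kernel centred at
      \<open>y\<close>.\<close>
    have inner: "(\<integral>x. a None x * \<rho> 0 (x - y) \<partial>lborel) + (\<Sum>i\<in>UNIV. \<integral>x. a (Some i) x * pd i (\<rho> 0) (x - y) \<partial>lborel) = 0" for y
    proof -
      have c1: "continuous_on UNIV (\<lambda>x. \<rho> 0 (x - y))"
        by (intro continuous_on_compose2[OF K] continuous_intros) simp
      have c2: "continuous_on UNIV (\<lambda>x. pd i (\<rho> 0) (x - y))" for i
        by (intro continuous_on_compose2[OF K'] continuous_intros) simp
      have s: "\<rho> 0 (x - y) = 0" "pd i (\<rho> 0) (x - y) = 0" if "1 + norm y \<le> norm x" for x i
      proof -
        have "1 \<le> norm (x - y)" using that norm_triangle_ineq2[of x y] by linarith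
        then show "\<rho> 0 (x - y) = 0" "pd i (\<rho> 0) (x - y) = 0" by (auto simp: supp)
      qed
      have i1: "integrable lborel (\<lambda>x. a None x * \<rho> 0 (x - y))"
        by (rule locally_L2_test_integrable[OF aL c1 s(1)])
      have i2: "integrable lborel (\<lambda>x. a (Some i) x * pd i (\<rho> 0) (x - y))" for i
        by (rule locally_L2_test_integrable[OF aL c2 s(2)])
      have "0 = (\<integral>x. (\<Sum>i\<in>UNIV. f i x * pd i (\<lambda>x. \<eta> x * \<rho> y x) x) + g x * (\<eta> x * \<rho> y x) \<partial>lborel)"
        by (rule eq[symmetric]) (intro test_fn_mult \<eta> \<rho>)
      also have "\<dots> = (\<integral>x. a None x * \<rho> 0 (x - y) + (\<Sum>i\<in>UNIV. a (Some i) x * pd i (\<rho> 0) (x - y)) \<partial>lborel)"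
        unfolding pd_mult[OF \<eta> \<rho>] pd_diff[of _ y]
        by (intro Bochner_Integration.integral_cong refl)
           (simp add: a_def \<rho>_diff[of y] algebra_simps sum.distrib sum_distrib_left sum_distrib_right)
      also have "\<dots> = (\<integral>x. a None x * \<rho> 0 (x - y) \<partial>lborel) + (\<Sum>i\<in>UNIV. \<integral>x. a (Some i) x * pd i (\<rho> 0) (x - y) \<partial>lborel)"
        using i1 i2 by (simp add: Bochner_Integration.integral_sum)
      finally show ?thesis by simp
    qed
    \<comment> \<open>The minus sign from moving the derivative to \<open>y\<close> cancels the one
      in the definition of the weak gradient.\<close>
    have grad\<rho>: "(\<integral>y. pd i (\<rho> 0) (x - y) * v y \<partial>lborel) = (\<integral>y. \<rho> 0 (x - y) * H i y \<partial>lborel)" for i x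
    proof -
      have "(\<integral>y. pd i (\<rho> 0) (x - y) * v y \<partial>lborel) = (\<integral>y. - (v y * pd i (\<rho> x) y) \<partial>lborel)"
        by (intro Bochner_Integration.integral_cong refl)
           (simp only: pd_diff[symmetric] pd_swap[of i _ x], simp)
      also have "\<dots> = (\<integral>y. H i y * \<rho> x y \<partial>lborel)" using grad[OF \<rho>[of x], of i] by simp
      also have "\<dots> = (\<integral>y. \<rho> 0 (x - y) * H i y \<partial>lborel)"
        by (intro Bochner_Integration.integral_cong refl) (simp only: \<rho>_sym[of x] \<rho>_diff[of _ x] mult.commute)
      finally show ?thesis .
    qed
    have "0 = (\<integral>y. ((\<integral>x. a None x * \<rho> 0 (x - y) \<partial>lborel) + (\<Sum>i\<in>UNIV. \<integral>x. a (Some i) x * pd i (\<rho> 0) (x - y) \<partial>lborel)) * v y \<partial>lborel)"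
      by (simp add: inner)
    also have "\<dots> = (\<integral>y. (\<integral>x. a None x * \<rho> 0 (x - y) \<partial>lborel) * v y \<partial>lborel)
       + (\<Sum>i\<in>UNIV. \<integral>y. (\<integral>x. a (Some i) x * pd i (\<rho> 0) (x - y) \<partial>lborel) * v y \<partial>lborel)"
      using integrable_kernel_snd[OF am[of None] a2 a0 v K K0] integrable_kernel_snd[OF am[of "Some _"] a2 a0 v K' K0']
      unfolding distrib_right sum_distrib_right
      by (subst Bochner_Integration.integral_add)
         (auto simp: Bochner_Integration.integral_sum intro!: Bochner_Integration.integrable_sum)
    also have "\<dots> = (\<integral>x. a None x * (\<integral>y. \<rho> 0 (x - y) * v y \<partial>lborel) \<partial>lborel)
       + (\<Sum>i\<in>UNIV. \<integral>x. a (Some i) x * (\<integral>y. pd i (\<rho> 0) (x - y) * v y \<partial>lborel) \<partial>lborel)"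
      using kernel_fubini[OF am a2 a0 v K K0] kernel_fubini[OF am a2 a0 v K' K0'] by simp
    finally show "(\<Sum>k\<in>UNIV. \<integral>x. a k x * (\<integral>y. bump (r^2) 1 0 (x - y) * b k y \<partial>lborel) \<partial>lborel) = 0"
      by (simp add: sum_UNIV_option grad\<rho> b_def \<rho>_def)
  qed simp_all
  then have "0 = (\<integral>x. a None x * v x \<partial>lborel) + (\<Sum>i\<in>UNIV. \<integral>x. a (Some i) x * H i x \<partial>lborel)"
    by (simp add: sum_UNIV_option b_def)
  also have "\<dots> = (\<integral>x. a None x * v x + (\<Sum>i\<in>UNIV. a (Some i) x * H i x) \<partial>lborel)"
  proof -
    define w where "w x = max 0 (min 1 (R + 1 - norm x))" for x :: "real^'d"
    have w: "continuous_on UNIV w" unfolding w_def by (intro continuous_intros)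
    have aw: "a k x * b k x = a k x * b k x * w x" for k x
      using a0[of x k] by (cases "R \<le> norm x") (auto simp: w_def)
    have "integrable lborel (\<lambda>x. a k x * b k x)" for k
      by (subst aw) (rule locally_L2_mult_integrable[OF aL bL w, of "R + 1"], simp add: w_def)
    from this[of None] this[of "Some _"] show ?thesis
      by (simp add: b_def Bochner_Integration.integral_sum)
  qed
  also have "\<dots> = (\<integral>x. (\<Sum>i\<in>UNIV. f i x * (pd i \<eta> x * v x + \<eta> x * H i x)) + g x * (\<eta> x * v x) \<partial>lborel)"
    by (intro Bochner_Integration.integral_cong refl)
       (simp add: a_def algebra_simps sum.distrib sum_distrib_left sum_distrib_right)
  finally show ?thesis by simp
qed

subsection \<open>Means of uniformly locally integrable functions\<close>

lemma borel_sets_ball [measurable]: "ball c r \<in> sets borel" "cball c r \<in> sets borel"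
  for c :: "'a::euclidean_space"
  by simp_all

text \<open>The nonnegative integral makes finiteness part of the condition; a Bochner integral
  would assign the value 0 to a function that is not integrable.\<close>

definition unif_loc :: "('a::euclidean_space \<Rightarrow> real) \<Rightarrow> bool" where
  "unif_loc h \<longleftrightarrow> h \<in> borel_measurable borel \<and>
     (\<exists>C. 0 \<le> C \<and> (\<forall>x. (\<integral>\<^sup>+y. ennreal \<bar>h y\<bar> * indicator (ball x 1) y \<partial>lborel) \<le> ennreal C))"

lemma unif_loc_measurable: "unif_loc h \<Longrightarrow> h \<in> borel_measurable borel"
  by (simp add: unif_loc_def)

lemma unif_loc_dominated:
  assumes h: "unif_loc h" and k: "k \<in> borel_measurable borel" and le: "\<And>x. \<bar>k x\<bar> \<le> \<bar>h x\<bar>"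
  shows "unif_loc k"
proof -
  obtain C where C: "0 \<le> C" "\<And>x. (\<integral>\<^sup>+y. ennreal \<bar>h y\<bar> * indicator (ball x 1) y \<partial>lborel) \<le> ennreal C"
    using h by (auto simp: unif_loc_def)
  have "(\<integral>\<^sup>+y. ennreal \<bar>k y\<bar> * indicator (ball x 1) y \<partial>lborel) \<le> ennreal C" for x
  proof -
    have "(\<integral>\<^sup>+y. ennreal \<bar>k y\<bar> * indicator (ball x 1) y \<partial>lborel)
      \<le> (\<integral>\<^sup>+y. ennreal \<bar>h y\<bar> * indicator (ball x 1) y \<partial>lborel)"
      using le by (intro nn_integral_mono mult_right_mono ennreal_leI) auto
    with C(2)[of x] show ?thesis by (rule order_trans[rotated])
  qed
  with k C(1) show ?thesis by (auto simp: unif_loc_def)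
qed

lemma unif_loc_add:
  assumes h: "unif_loc h" and k: "unif_loc k"
  shows "unif_loc (\<lambda>x. h x + k x)"
proof -
  have [measurable]: "h \<in> borel_measurable borel" "k \<in> borel_measurable borel"
    using h k by (auto simp: unif_loc_def)
  obtain C where C: "0 \<le> C" "\<And>x. (\<integral>\<^sup>+y. ennreal \<bar>h y\<bar> * indicator (ball x 1) y \<partial>lborel) \<le> ennreal C"
    using h by (auto simp: unif_loc_def)
  obtain D where D: "0 \<le> D" "\<And>x. (\<integral>\<^sup>+y. ennreal \<bar>k y\<bar> * indicator (ball x 1) y \<partial>lborel) \<le> ennreal D"
    using k by (auto simp: unif_loc_def)
  have "(\<integral>\<^sup>+y. ennreal \<bar>h y + k y\<bar> * indicator (ball x 1) y \<partial>lborel) \<le> ennreal (C + D)" for x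
  proof -
    have "(\<integral>\<^sup>+y. ennreal \<bar>h y + k y\<bar> * indicator (ball x 1) y \<partial>lborel)
      \<le> (\<integral>\<^sup>+y. ennreal \<bar>h y\<bar> * indicator (ball x 1) y + ennreal \<bar>k y\<bar> * indicator (ball x 1) y \<partial>lborel)"
      by (intro nn_integral_mono) (auto simp: indicator_def simp flip: ennreal_plus intro!: ennreal_leI)
    also have "\<dots> = (\<integral>\<^sup>+y. ennreal \<bar>h y\<bar> * indicator (ball x 1) y \<partial>lborel) + (\<integral>\<^sup>+y. ennreal \<bar>k y\<bar> * indicator (ball x 1) y \<partial>lborel)"
      by (intro nn_integral_add) measurable
    also have "\<dots> \<le> ennreal C + ennreal D" by (intro add_mono C D)
    also have "\<dots> = ennreal (C + D)" using C D by simp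
    finally show ?thesis .
  qed
  then show ?thesis using C(1) D(1) unfolding unif_loc_def by (auto intro!: exI[of _ "C + D"])
qed

lemma unif_loc_cmult:
  assumes h: "unif_loc h"
  shows "unif_loc (\<lambda>x. c * h x)"
proof -
  have [measurable]: "h \<in> borel_measurable borel" using h by (auto simp: unif_loc_def)
  obtain C where C: "0 \<le> C" "\<And>x. (\<integral>\<^sup>+y. ennreal \<bar>h y\<bar> * indicator (ball x 1) y \<partial>lborel) \<le> ennreal C"
    using h by (auto simp: unif_loc_def)
  have "(\<integral>\<^sup>+y. ennreal \<bar>c * h y\<bar> * indicator (ball x 1) y \<partial>lborel) \<le> ennreal (\<bar>c\<bar> * C)" for x
  proof -
    have "(\<integral>\<^sup>+y. ennreal \<bar>c * h y\<bar> * indicator (ball x 1) y \<partial>lborel)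
       = (\<integral>\<^sup>+y. ennreal \<bar>c\<bar> * (ennreal \<bar>h y\<bar> * indicator (ball x 1) y) \<partial>lborel)"
      by (simp add: abs_mult ennreal_mult mult.assoc)
    also have "\<dots> = ennreal \<bar>c\<bar> * (\<integral>\<^sup>+y. ennreal \<bar>h y\<bar> * indicator (ball x 1) y \<partial>lborel)"
      by (intro nn_integral_cmult) measurable
    also have "\<dots> \<le> ennreal \<bar>c\<bar> * ennreal C" by (intro mult_left_mono C) auto
    also have "\<dots> = ennreal (\<bar>c\<bar> * C)" using C by (simp add: ennreal_mult)
    finally show ?thesis .
  qed
  then show ?thesis using C(1) unfolding unif_loc_def by (auto intro!: exI[of _ "\<bar>c\<bar> * C"])
qed

lemma unif_loc_const: "unif_loc (\<lambda>x::'a::euclidean_space. c)"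
proof -
  have "(\<integral>\<^sup>+y. ennreal \<bar>c\<bar> * indicator (ball x 1) y \<partial>(lborel :: 'a measure)) \<le> ennreal (\<bar>c\<bar> * unit_ball_vol DIM('a))" for x
    by (simp add: nn_integral_cmult emeasure_ball ennreal_mult)
  then show ?thesis by (auto simp: unif_loc_def intro!: exI[of _ "\<bar>c\<bar> * unit_ball_vol DIM('a)"])
qed

lemma unif_loc_sum: "finite I \<Longrightarrow> (\<And>i. i \<in> I \<Longrightarrow> unif_loc (f i)) \<Longrightarrow> unif_loc (\<lambda>x. \<Sum>i\<in>I. f i x)"
  by (induction I rule: finite_induct) (auto intro: unif_loc_const unif_loc_add)

lemma unif_loc_bounded_mult:
  assumes h: "unif_loc h" and a: "a \<in> borel_measurable borel" "\<And>x. \<bar>a x\<bar> \<le> M"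
  shows "unif_loc (\<lambda>x. a x * h x)"
proof (rule unif_loc_dominated[OF unif_loc_cmult[OF h, of M]])
  show "(\<lambda>x. a x * h x) \<in> borel_measurable borel"
    using h a by (auto simp: unif_loc_def)
  fix x
  have "\<bar>a x\<bar> \<le> \<bar>M\<bar>" using a(2)[of x] by linarith
  then show "\<bar>a x * h x\<bar> \<le> \<bar>M * h x\<bar>" by (simp add: abs_mult mult_right_mono)
qed

definition unif_L2 :: "('a::euclidean_space \<Rightarrow> real) \<Rightarrow> bool" where
  "unif_L2 v \<longleftrightarrow> v \<in> borel_measurable borel \<and> unif_loc (\<lambda>x. (v x)^2)"

lemma unif_L2_square: "unif_L2 v \<Longrightarrow> unif_loc (\<lambda>x. (v x)^2)"
  by (simp add: unif_L2_def)

lemma unif_loc_mult: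
  assumes "unif_L2 v" "unif_L2 w"
  shows "unif_loc (\<lambda>x. v x * w x)"
proof (rule unif_loc_dominated[OF unif_loc_cmult[of _ "1/2", OF unif_loc_add]])
  show "unif_loc (\<lambda>x. (v x)^2)" "unif_loc (\<lambda>x. (w x)^2)" "(\<lambda>x. v x * w x) \<in> borel_measurable borel"
    using assms by (auto simp: unif_L2_def)
  show "\<bar>v x * w x\<bar> \<le> \<bar>1 / 2 * ((v x)^2 + (w x)^2)\<bar>" for x
    using abs_mult_le_young[of 1 "v x" "w x"] by simp
qed

lemma unif_L2_add:
  assumes v: "unif_L2 v" and w: "unif_L2 w"
  shows "unif_L2 (\<lambda>x. v x + w x)"
  unfolding unif_L2_def
proof
  show "(\<lambda>x. v x + w x) \<in> borel_measurable borel" using assms by (auto simp: unif_L2_def)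
  have "unif_loc (\<lambda>x. (v x)^2 + (w x)^2 + 2 * (v x * w x))"
    by (intro unif_loc_add unif_loc_cmult unif_loc_mult unif_L2_square v w)
  then show "unif_loc (\<lambda>x. (v x + w x)^2)" by (simp add: power2_sum mult.assoc)
qed

lemma unif_L2_cmult: "unif_L2 v \<Longrightarrow> unif_L2 (\<lambda>x. c * v x)"
  using unif_loc_cmult[of "\<lambda>x. (v x)^2" "c^2"] by (auto simp: unif_L2_def power_mult_distrib)

lemma unif_L2_const: "unif_L2 (\<lambda>x. c)"
  by (simp add: unif_L2_def unif_loc_const)

lemma unif_L2_sum: "finite I \<Longrightarrow> (\<And>i. i \<in> I \<Longrightarrow> unif_L2 (f i)) \<Longrightarrow> unif_L2 (\<lambda>x. \<Sum>i\<in>I. f i x)"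
  by (induction I rule: finite_induct) (auto intro: unif_L2_const unif_L2_add)

lemma unif_L2_bounded_mult:
  assumes v: "unif_L2 v" and a: "a \<in> borel_measurable borel" "\<And>x. \<bar>a x\<bar> \<le> M"
  shows "unif_L2 (\<lambda>x. a x * v x)"
  unfolding unif_L2_def
proof
  show "(\<lambda>x. a x * v x) \<in> borel_measurable borel" using assms by (auto simp: unif_L2_def)
  have "\<bar>(a x)^2\<bar> \<le> M^2" for x using a(2)[of x] by (simp add: abs_le_square_iff[symmetric])
  then have "unif_loc (\<lambda>x. (a x)^2 * (v x)^2)"
    using v a by (intro unif_loc_bounded_mult) (auto simp: unif_L2_def)
  then show "unif_loc (\<lambda>x. (a x * v x)^2)" by (simp add: power_mult_distrib)
qed

text \<open>Averaging over centres replaces a covering argument: integrating the mass in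
  \<open>ball x 1\<close> over \<open>x\<close> counts each point with the volume of the unit ball,
  and only centres in \<open>cball 0 (R + 1)\<close> contribute. Since \<open>1 \<le> R\<close>
  gives \<open>R + 1 \<le> 2 * R\<close>, the factor \<open>2 ^ DIM('a)\<close> appears.\<close>

lemma unif_loc_growth:
  fixes h :: "'a::euclidean_space \<Rightarrow> real"
  assumes h: "unif_loc h"
  obtains C where "C \<ge> 0" "\<And>R. 1 \<le> R \<Longrightarrow>
    (\<integral>\<^sup>+y. ennreal \<bar>h y\<bar> * indicator (cball 0 R) y \<partial>lborel) \<le> ennreal (C * R ^ DIM('a))"
proof -
  have [measurable]: "h \<in> borel_measurable borel" using h by (auto simp: unif_loc_def)
  obtain C where C: "0 \<le> C" "\<And>x. (\<integral>\<^sup>+y. ennreal \<bar>h y\<bar> * indicator (ball x 1) y \<partial>lborel) \<le> ennreal C"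
    using h by (auto simp: unif_loc_def)
  define V where "V = unit_ball_vol (real DIM('a))"
  have V: "V > 0" by (simp add: V_def)
  have "(\<integral>\<^sup>+y. ennreal \<bar>h y\<bar> * indicator (cball 0 R) y \<partial>lborel) \<le> ennreal (C * 2 ^ DIM('a) * R ^ DIM('a))"
    if R: "1 \<le> R" for R
  proof -
    let ?I = "\<integral>\<^sup>+y. ennreal \<bar>h y\<bar> * indicator (cball 0 R) y \<partial>lborel"
    have [measurable]: "Measurable.pred (lborel \<Otimes>\<^sub>M lborel) (\<lambda>p::'a \<times> 'a. fst p \<in> ball (snd p) 1)"
      unfolding mem_ball by measurable
    have "?I * ennreal V = (\<integral>\<^sup>+y. (\<integral>\<^sup>+x. ennreal \<bar>h y\<bar> * indicator (cball 0 R) y * indicator (ball y 1) x \<partial>lborel) \<partial>lborel)"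
      by (simp add: nn_integral_cmult_indicator emeasure_ball V_def nn_integral_multc)
    also have "\<dots> = (\<integral>\<^sup>+x. (\<integral>\<^sup>+y. ennreal \<bar>h y\<bar> * indicator (cball 0 R) y * indicator (ball y 1) x \<partial>lborel) \<partial>lborel)"
    proof (rule lborel_pair.Fubini'[symmetric])
      have "(\<lambda>(y, x). ennreal \<bar>h y\<bar> * indicator (cball 0 R) y * indicator {p. fst p \<in> ball (snd p) 1} (x, y))
         \<in> borel_measurable (lborel \<Otimes>\<^sub>M lborel)"
        unfolding split_beta by measurable
      then show "(\<lambda>(y, x). ennreal \<bar>h y\<bar> * indicator (cball 0 R) y * indicator (ball y 1) x)
         \<in> borel_measurable (lborel \<Otimes>\<^sub>M lborel)"
        by (simp add: indicator_def dist_commute cong: if_cong)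
    qed
    also have "\<dots> \<le> (\<integral>\<^sup>+x. ennreal C * indicator (cball 0 (R + 1)) x \<partial>(lborel :: 'a measure))"
    proof (rule nn_integral_mono)
      fix x :: 'a
      show "(\<integral>\<^sup>+y. ennreal \<bar>h y\<bar> * indicator (cball 0 R) y * indicator (ball y 1) x \<partial>lborel) \<le> ennreal C * indicator (cball 0 (R + 1)) x"
      proof (cases "norm x \<le> R + 1")
        case True
        have "(\<integral>\<^sup>+y. ennreal \<bar>h y\<bar> * indicator (cball 0 R) y * indicator (ball y 1) x \<partial>lborel)
          \<le> (\<integral>\<^sup>+y. ennreal \<bar>h y\<bar> * indicator (ball x 1) y \<partial>lborel)"
          by (intro nn_integral_mono) (auto simp: indicator_def dist_commute)
        also have "\<dots> \<le> ennreal C" by (rule C)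
        finally show ?thesis using True by simp
      next
        case False
        have "ennreal \<bar>h y\<bar> * indicator (cball 0 R) y * indicator (ball y 1) x = 0" for y
          using False norm_triangle_ineq2[of x y] by (auto simp: indicator_def dist_norm norm_minus_commute)
        then show ?thesis by (simp only: nn_integral_const) simp
      qed
    qed
    also have "\<dots> = ennreal (C * V * (R + 1) ^ DIM('a))"
      using C R by (simp add: nn_integral_cmult emeasure_cball V_def ennreal_mult mult.assoc)
    also have "\<dots> \<le> ennreal (C * V * (2 * R) ^ DIM('a))"
      using C V R by (intro ennreal_leI mult_left_mono power_mono) auto
    also have "\<dots> = ennreal (C * 2 ^ DIM('a) * R ^ DIM('a)) * ennreal V"
      using C V R by (simp add: ennreal_mult[symmetric] power_mult_distrib mult_ac)
    finally have "?I * ennreal V \<le> ennreal (C * 2 ^ DIM('a) * R ^ DIM('a)) * ennreal V" .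
    then show ?thesis
      using V by (subst (asm) mult.commute, subst (asm) (2) mult.commute, subst (asm) ennreal_mult_le_mult_iff) auto
  qed
  then show ?thesis using C(1) by (intro that[of "C * 2 ^ DIM('a)"]) auto
qed

lemma unif_L2_imp_locally_L2:
  assumes v: "unif_L2 v"
  shows "locally_L2 v"
  unfolding locally_L2_def
proof (intro conjI allI)
  show vm: "v \<in> borel_measurable borel" using v by (simp add: unif_L2_def)
  note [measurable] = vm
  fix R
  obtain C where C: "C \<ge> 0" "\<And>R. 1 \<le> R \<Longrightarrow>
    (\<integral>\<^sup>+y. ennreal \<bar>(v y)^2\<bar> * indicator (cball 0 R) y \<partial>lborel) \<le> ennreal (C * R ^ DIM('a))"
    using unif_loc_growth[OF unif_L2_square[OF v]] by blast
  show "integrable lborel (\<lambda>x. (indicator (cball 0 R) x * v x)^2)"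
  proof (rule integrableI_bounded)
    have "(\<integral>\<^sup>+x. ennreal (norm ((indicator (cball 0 R) x * v x)^2)) \<partial>lborel)
      \<le> (\<integral>\<^sup>+y. ennreal \<bar>(v y)^2\<bar> * indicator (cball 0 (max R 1)) y \<partial>lborel)"
      by (intro nn_integral_mono) (auto simp: indicator_def)
    also have "\<dots> \<le> ennreal (C * (max R 1) ^ DIM('a))" by (rule C(2)) simp
    finally show "(\<integral>\<^sup>+x. ennreal (norm ((indicator (cball 0 R) x * v x)^2)) \<partial>lborel) < \<infinity>"
      using le_less_trans by fastforce
    show "(\<lambda>x. (indicator (cball 0 R) x * v x)^2) \<in> borel_measurable lborel"
      by (intro borel_measurable_power borel_measurable_times borel_measurable_indicator) auto
  qed
qed

text \<open>The 4 makes the cutoff vanish from radius \<open>2 * L\<close> on, while on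
  \<open>cball 0 L\<close> the argument of \<open>flat 0\<close> is at least 3 and the weight is at
  least \<open>exp (- 1 / 3)\<close>.\<close>

definition weight :: "real \<Rightarrow> real^'d \<Rightarrow> real" where
  "weight L = bump 4 (1 / L^2) 0"

lemma test_fn_weight: "L > 0 \<Longrightarrow> test_fn (weight L)"
  unfolding weight_def by (rule test_fn_bump) simp

lemma weight_nonneg: "0 \<le> weight L x"
  by (simp add: weight_def bump_nonneg)

lemma weight_le_1: "weight L x \<le> 1"
  by (simp add: weight_def bump_def flat_def)

lemma weight_arg_nonpos: "L > 0 \<Longrightarrow> 2 * L \<le> norm x \<Longrightarrow> 4 - 1 / L^2 * (norm x)^2 \<le> 0"
  using power_mono[of "2 * L" "norm x" 2] by (simp add: field_simps power_mult_distrib)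

lemma weight_eq_0: "L > 0 \<Longrightarrow> 2 * L \<le> norm x \<Longrightarrow> weight L x = 0"
  using weight_arg_nonpos[of L x] by (simp add: weight_def bump_def flat_eq_0)

lemma weight_ge:
  assumes "L > 0" "norm x \<le> L"
  shows "exp (- 1 / 3) \<le> weight L x"
proof -
  define t where "t = 4 - 1 / L^2 * (norm x)^2"
  have "(norm x)^2 \<le> L^2" using assms by (intro power_mono) auto
  then have t: "3 \<le> t" using assms by (simp add: t_def field_simps)
  then have "1 / t \<le> 1 / 3" by (intro divide_left_mono) auto
  then have "exp (- 1 / 3) \<le> flat 0 t" using t by (simp add: flat_def)
  then show ?thesis by (simp add: weight_def bump_def t_def)
qed

text \<open>In the variable \<open>s = 1 / t\<close> this is \<open>s^2 \<le> 2 * exp s\<close>. As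
  \<open>flat 2\<close> is the derivative of \<open>flat 0\<close>, the bound leaves a full factor
  \<open>1 / L\<close> in \<open>weight_pd_le\<close>.\<close>

lemma flat_2_le: "flat 2 t \<le> 2"
proof (cases "t > 0")
  case True
  have "1 + (1 / t) + (1 / t)^2 / 2 \<le> exp (1 / t)"
    using True by (intro exp_lower_Taylor_quadratic) auto
  moreover have "0 < 1 / t" using True by simp
  ultimately have "(1 / t)^2 \<le> 2 * exp (1 / t)" by linarith
  then have "(1 / t)^2 / exp (1 / t) \<le> 2" by (subst pos_divide_le_eq) auto
  also have "(1 / t)^2 / exp (1 / t) = flat 2 t"
    using True by (simp add: flat_def exp_minus field_simps)
  finally show ?thesis .
qed (simp add: flat_def)

lemma weight_pd_le:
  assumes "L > 0"
  shows "\<bar>pd i (weight L) x\<bar> \<le> 8 / L * indicator (cball 0 (2 * L)) x"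
proof (cases "norm x \<le> 2 * L")
  case True
  have "\<bar>pd i (weight L) x\<bar> = 2 / L^2 * \<bar>x $ i\<bar> * flat 2 (4 - 1 / L^2 * (norm x)^2)"
    unfolding weight_def using flat_nonneg by (simp add: bump_pd abs_mult)
  also have "\<dots> \<le> 2 / L^2 * (2 * L) * 2"
    using True component_le_norm_cart[of x i] flat_2_le flat_nonneg
    by (intro mult_mono mult_nonneg_nonneg) auto
  also have "\<dots> = 8 / L" using assms by (simp add: field_simps power2_eq_square)
  finally show ?thesis using True by simp
next
  case False
  then have "flat 2 (4 - 1 / L^2 * (norm x)^2) = 0"
    using assms by (intro flat_eq_0 weight_arg_nonpos) auto
  then show ?thesis using False unfolding weight_def by (simp add: bump_pd)
qed

text \<open>The normalization is by scale and not by total weight, so constants are averaged to a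
  fixed multiple of themselves. Only the order of growth matters for the comparison with ball
  averages.\<close>

definition wavg :: "(real^'d \<Rightarrow> real) \<Rightarrow> real \<Rightarrow> real" where
  "wavg h L = (\<integral>x. h x * weight L x \<partial>lborel) / L ^ CARD('d)"

text \<open>The bound \<open>C / L\<close> makes the boundary terms of integrations by parts against \<open>weight L\<close> vanish as \<open>L \<rightarrow> \<infinity>\<close>.\<close>

lemma unif_loc_weighted:
  fixes h :: "real^'d \<Rightarrow> real"
  assumes h: "unif_loc h"
  shows "L > 0 \<Longrightarrow> integrable lborel (\<lambda>x. h x * weight L x)"
    and "L > 0 \<Longrightarrow> integrable lborel (\<lambda>x. h x * pd i (weight L) x)"
    and "\<exists>C\<ge>0. \<forall>L\<ge>1. \<bar>wavg h L\<bar> \<le> C \<and> \<bar>\<integral>x. h x * pd i (weight L) x \<partial>lborel\<bar> / L ^ CARD('d) \<le> C / L"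
proof -
  have [measurable]: "h \<in> borel_measurable borel" using h by (auto simp: unif_loc_def)
  obtain C where C: "C \<ge> 0" "\<And>R. 1 \<le> R \<Longrightarrow>
    (\<integral>\<^sup>+y. ennreal \<bar>h y\<bar> * indicator (cball 0 R) y \<partial>lborel) \<le> ennreal (C * R ^ CARD('d))"
    using unif_loc_growth[OF h] by auto
  \<comment> \<open>One estimate serves both weights: \<open>M\<close> is 1 for the cutoff and
    \<open>8 / L\<close> for its derivative. The condition \<open>1 / 2 \<le> L\<close> ensures
    \<open>1 \<le> 2 * L\<close>, the range of the growth bound.\<close>
  have gen: "integrable lborel (\<lambda>x. h x * w x)" "1 / 2 \<le> L \<Longrightarrow> \<bar>\<integral>x. h x * w x \<partial>lborel\<bar> \<le> M * (C * (2 * L) ^ CARD('d))"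
    if [measurable]: "w \<in> borel_measurable borel" and w: "\<And>x. \<bar>w x\<bar> \<le> M * indicator (cball 0 (2 * L)) x" and M: "0 \<le> M"
    for w M L
  proof -
    have "(\<integral>\<^sup>+x. ennreal (norm (h x * w x)) \<partial>lborel) \<le> ennreal (M * (C * R ^ CARD('d)))"
      if "1 \<le> R" "2 * L \<le> R" for R
    proof -
      have "(\<integral>\<^sup>+x. ennreal (norm (h x * w x)) \<partial>lborel)
        \<le> (\<integral>\<^sup>+x. ennreal M * (ennreal \<bar>h x\<bar> * indicator (cball 0 R) x) \<partial>lborel)"
      proof (rule nn_integral_mono)
        fix x
        have "\<bar>w x\<bar> \<le> M * indicator (cball 0 R) x"
          using w[of x] M that(2) by (cases "norm x \<le> 2 * L") auto
        then have "norm (h x * w x) \<le> M * (\<bar>h x\<bar> * indicator (cball 0 R) x)"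
          using mult_left_mono[of "\<bar>w x\<bar>" "M * indicator (cball 0 R) x" "\<bar>h x\<bar>"] by (simp add: abs_mult mult_ac)
        then show "ennreal (norm (h x * w x)) \<le> ennreal M * (ennreal \<bar>h x\<bar> * indicator (cball 0 R) x)"
          using M by (auto simp: ennreal_mult[symmetric] indicator_def intro: ennreal_leI split: if_splits)
      qed
      also have "\<dots> = ennreal M * (\<integral>\<^sup>+x. ennreal \<bar>h x\<bar> * indicator (cball 0 R) x \<partial>lborel)"
        by (intro nn_integral_cmult) measurable
      also have "\<dots> \<le> ennreal M * ennreal (C * R ^ CARD('d))"
        by (intro mult_left_mono C(2) that) auto
      also have "\<dots> = ennreal (M * (C * R ^ CARD('d)))" using M C that by (simp add: ennreal_mult)
      finally show ?thesis .
    qed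
    note bound = this
    have "(\<integral>\<^sup>+x. ennreal (norm (h x * w x)) \<partial>lborel) < \<infinity>"
      using bound[of "max 1 (2 * L)"] le_less_trans[OF _ ennreal_less_top] by simp
    then show i: "integrable lborel (\<lambda>x. h x * w x)" by (intro integrableI_bounded) auto
    assume "1 / 2 \<le> L"
    then have "(\<integral>\<^sup>+x. ennreal (norm (h x * w x)) \<partial>lborel) \<le> ennreal (M * (C * (2 * L) ^ CARD('d)))"
      by (intro bound) auto
    then have "(\<integral>x. norm (h x * w x) \<partial>lborel) \<le> M * (C * (2 * L) ^ CARD('d))"
      using i M C \<open>1 / 2 \<le> L\<close> by (subst (asm) nn_integral_eq_integral) auto
    then show "\<bar>\<integral>x. h x * w x \<partial>lborel\<bar> \<le> M * (C * (2 * L) ^ CARD('d))"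
      using integral_norm_bound[of lborel "\<lambda>x. h x * w x"] unfolding real_norm_def by linarith
  qed
  have wm: "weight L \<in> borel_measurable borel" "pd i (weight L) \<in> borel_measurable borel"
    if "L > 0" for L :: real and i :: 'd
    using test_fn_weight[OF that] by (auto intro: borel_measurable_continuous_onI test_fn_continuous test_fn_pd_continuous)
  have wle: "\<bar>weight L x\<bar> \<le> 1 * indicator (cball 0 (2 * L)) x" if "L > 0" for L and x :: "real^'d"
    using weight_le_1[of L x] weight_nonneg[of L x] weight_eq_0[of L x] that by (auto simp: indicator_def)
  show "integrable lborel (\<lambda>x. h x * weight L x)" if "L > 0"
    by (rule gen(1)[OF wm(1) wle]) (use that in auto)
  show "integrable lborel (\<lambda>x. h x * pd i (weight L) x)" if "L > 0"
    by (rule gen(1)[OF wm(2) weight_pd_le]) (use that in auto)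
  show "\<exists>C\<ge>0. \<forall>L\<ge>1. \<bar>wavg h L\<bar> \<le> C \<and> \<bar>\<integral>x. h x * pd i (weight L) x \<partial>lborel\<bar> / L ^ CARD('d) \<le> C / L"
  proof (intro exI[of _ "8 * (C * 2 ^ CARD('d))"] conjI allI impI)
    fix L :: real assume L: "1 \<le> L"
    then have Ld: "L ^ CARD('d) > 0" by simp
    have "\<bar>\<integral>x. h x * weight L x \<partial>lborel\<bar> \<le> 1 * (C * (2 * L) ^ CARD('d))"
      by (rule gen(2)[OF wm(1) wle]) (use L in auto)
    then have "\<bar>wavg h L\<bar> \<le> 1 * (C * (2 * L) ^ CARD('d)) / L ^ CARD('d)"
      unfolding wavg_def abs_divide abs_of_pos[OF Ld] using Ld by - (rule divide_right_mono, assumption, simp)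
    also have "\<dots> = C * 2 ^ CARD('d)" using L by (simp add: power_mult_distrib)
    also have "\<dots> \<le> 8 * (C * 2 ^ CARD('d))" using C by simp
    finally show "\<bar>wavg h L\<bar> \<le> 8 * (C * 2 ^ CARD('d))" .
    have "\<bar>\<integral>x. h x * pd i (weight L) x \<partial>lborel\<bar> \<le> 8 / L * (C * (2 * L) ^ CARD('d))"
      by (rule gen(2)[OF wm(2) weight_pd_le]) (use L in auto)
    then have "\<bar>\<integral>x. h x * pd i (weight L) x \<partial>lborel\<bar> / L ^ CARD('d) \<le> 8 / L * (C * (2 * L) ^ CARD('d)) / L ^ CARD('d)"
      using Ld by - (rule divide_right_mono, assumption, simp)
    also have "\<dots> = 8 * (C * 2 ^ CARD('d)) / L" using L by (simp add: power_mult_distrib)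
    finally show "\<bar>\<integral>x. h x * pd i (weight L) x \<partial>lborel\<bar> / L ^ CARD('d) \<le> 8 * (C * 2 ^ CARD('d)) / L" .
  qed (use C in auto)
qed

section \<open>Generalized means\<close>

context limit_filter
begin

definition mean :: "(real^'d \<Rightarrow> real) \<Rightarrow> real" where
  "mean h = Lim F (wavg h)"

lemma ev_pos: "\<forall>\<^sub>F L in F. L > 0"
  using le_at_top eventually_gt_at_top filter_leD by blast

lemma tendsto_mean:
  assumes "unif_loc h"
  shows "(wavg h \<longlongrightarrow> mean h) F"
proof -
  obtain C where "\<forall>L\<ge>1. \<bar>wavg h L\<bar> \<le> C"
    using unif_loc_weighted(3)[OF assms] by blast
  then have "\<forall>\<^sub>F L in at_top. \<bar>wavg h L\<bar> \<le> C"
    by (auto simp: eventually_at_top_linorder)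
  from convergent[OF this] obtain l where "(wavg h \<longlongrightarrow> l) F" by blast
  then show ?thesis unfolding mean_def using tendsto_Lim[OF not_bot] by metis
qed

lemma mean_eqI: "(wavg h \<longlongrightarrow> l) F \<Longrightarrow> mean h = l"
  unfolding mean_def by (rule tendsto_Lim[OF not_bot])

lemma mean_add:
  assumes "unif_loc h" "unif_loc k"
  shows "mean (\<lambda>x. h x + k x) = mean h + mean k"
proof (rule mean_eqI)
  have "\<forall>\<^sub>F L in F. wavg h L + wavg k L = wavg (\<lambda>x. h x + k x) L"
    using ev_pos by eventually_elim
      (simp add: wavg_def distrib_right add_divide_distrib unif_loc_weighted(1)[OF assms(1)] unif_loc_weighted(1)[OF assms(2)])
  from Lim_transform_eventually[OF tendsto_add[OF assms[THEN tendsto_mean]] this]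
  show "(wavg (\<lambda>x. h x + k x) \<longlongrightarrow> mean h + mean k) F" .
qed

lemma mean_cmult:
  assumes "unif_loc h"
  shows "mean (\<lambda>x. c * h x) = c * mean h"
proof (rule mean_eqI)
  have "wavg (\<lambda>x. c * h x) = (\<lambda>L. c * wavg h L)"
    by (simp add: wavg_def[abs_def] mult.assoc)
  then show "(wavg (\<lambda>x. c * h x) \<longlongrightarrow> c * mean h) F"
    using tendsto_mult_left[OF tendsto_mean[OF assms], of c] by simp
qed

lemma mean_zero: "mean (\<lambda>x. 0) = 0"
  by (rule mean_eqI) (simp add: wavg_def[abs_def])

lemma mean_sum:
  "finite I \<Longrightarrow> (\<And>i. i \<in> I \<Longrightarrow> unif_loc (f i)) \<Longrightarrow> mean (\<lambda>x. \<Sum>i\<in>I. f i x) = (\<Sum>i\<in>I. mean (f i))"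
  by (induction I rule: finite_induct) (auto simp: mean_zero mean_add unif_loc_sum)

lemma mean_mono:
  assumes "unif_loc h" "unif_loc k" "\<And>x. h x \<le> k x"
  shows "mean h \<le> mean k"
proof (rule tendsto_le[OF not_bot tendsto_mean[OF assms(2)] tendsto_mean[OF assms(1)]])
  show "\<forall>\<^sub>F L in F. wavg h L \<le> wavg k L"
    using ev_pos
  proof eventually_elim
    case (elim L)
    then show ?case unfolding wavg_def
      by (intro divide_right_mono integral_mono unif_loc_weighted(1) assms mult_right_mono weight_nonneg) auto
  qed
qed

lemma mean_nonneg: "unif_loc h \<Longrightarrow> (\<And>x. 0 \<le> h x) \<Longrightarrow> 0 \<le> mean h"
  using mean_mono[of "\<lambda>_. 0" h] mean_zero unif_loc_const[of 0] by metis

lemma mean_minus: "unif_loc h \<Longrightarrow> mean (\<lambda>x. - h x) = - mean h"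
  using mean_cmult[of h "-1"] by simp

end

subsection \<open>The energy identity\<close>

text \<open>The gradient is part of the element: it is determined only up to null sets, and as given
  data it makes all forms bilinear without a choice of representative.\<close>

definition unif_H1 :: "((real^'d \<Rightarrow> 'm \<Rightarrow> real) \<times> (real^'d \<Rightarrow> 'd \<Rightarrow> 'm \<Rightarrow> real)) set" where
  "unif_H1 = {x. (\<forall>\<alpha>. unif_L2 (\<lambda>z. fst x z \<alpha>)) \<and> (\<forall>i \<alpha>. unif_L2 (\<lambda>z. snd x z i \<alpha>)) \<and>
     (\<forall>\<phi> i \<alpha>. test_fn \<phi> \<longrightarrow>
        (\<integral>z. fst x z \<alpha> * pd i \<phi> z \<partial>lborel) = - (\<integral>z. snd x z i \<alpha> * \<phi> z \<partial>lborel))}"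

lemma unif_H1D:
  assumes "x \<in> unif_H1"
  shows "unif_L2 (\<lambda>z. fst x z \<alpha>)" "unif_L2 (\<lambda>z. snd x z i \<alpha>)"
    "test_fn \<phi> \<Longrightarrow> (\<integral>z. fst x z \<alpha> * pd i \<phi> z \<partial>lborel) = - (\<integral>z. snd x z i \<alpha> * \<phi> z \<partial>lborel)"
  using assms by (auto simp: unif_H1_def)

lemma integrable_times_test_fn:
  assumes "unif_L2 v" "test_fn \<phi>"
  shows "integrable lborel (\<lambda>z. v z * \<phi> z)" "integrable lborel (\<lambda>z. v z * pd i \<phi> z)"
proof -
  obtain R where R: "R > 0" "\<And>x. R \<le> norm x \<Longrightarrow> \<phi> x = 0" "\<And>x i. R \<le> norm x \<Longrightarrow> pd i \<phi> x = 0"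
    using test_fn_support[OF assms(2)] by blast
  note v = unif_L2_imp_locally_L2[OF assms(1)]
  show "integrable lborel (\<lambda>z. v z * \<phi> z)"
    by (rule locally_L2_test_integrable[OF v test_fn_continuous[OF assms(2)] R(2)])
  show "integrable lborel (\<lambda>z. v z * pd i \<phi> z)"
    by (rule locally_L2_test_integrable[OF v test_fn_pd_continuous[OF assms(2)] R(3)])
qed

lemma subspace_unif_H1: "subspace unif_H1"
  unfolding subspace_def
proof (intro conjI ballI allI)
  show "0 \<in> unif_H1" by (simp add: unif_H1_def zero_fun_def unif_L2_const)
  fix x :: "(real^'d \<Rightarrow> 'm \<Rightarrow> real) \<times> (real^'d \<Rightarrow> 'd \<Rightarrow> 'm \<Rightarrow> real)" assume x: "x \<in> unif_H1"
  show "c *\<^sub>R x \<in> unif_H1" for c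
    using unif_H1D[OF x] by (simp add: unif_H1_def scaleR_fun_def unif_L2_cmult mult.assoc)
  fix y :: "(real^'d \<Rightarrow> 'm \<Rightarrow> real) \<times> (real^'d \<Rightarrow> 'd \<Rightarrow> 'm \<Rightarrow> real)" assume y: "y \<in> unif_H1"
  show "x + y \<in> unif_H1"
    using unif_H1D[OF x] unif_H1D[OF y]
    by (simp add: unif_H1_def plus_fun_def unif_L2_add distrib_right integrable_times_test_fn)
qed

context limit_filter
begin

lemma bilinear_form_on_mean:
  fixes b :: "'a::real_vector \<Rightarrow> 'a \<Rightarrow> real^'d \<Rightarrow> real"
  assumes "subspace V"
    and ul: "\<And>x y. x \<in> V \<Longrightarrow> y \<in> V \<Longrightarrow> unif_loc (b x y)"
    and "\<And>x y w z. b (x + y) w z = b x w z + b y w z" "\<And>x y w z. b w (x + y) z = b w x z + b w y z"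
    and "\<And>c x w z. b (c *\<^sub>R x) w z = c * b x w z" "\<And>c x w z. b w (c *\<^sub>R x) z = c * b w x z"
  shows "bilinear_form_on V (\<lambda>x y. mean (b x y))"
proof
  fix x y w c assume [simp]: "x \<in> V" "y \<in> V" "w \<in> V"
  have eq: "b (x + y) w = (\<lambda>z. b x w z + b y w z)" "b w (x + y) = (\<lambda>z. b w x z + b w y z)" for x y w
    by (intro ext assms)+
  show "mean (b (x + y) w) = mean (b x w) + mean (b y w)" "mean (b w (x + y)) = mean (b w x) + mean (b w y)"
    unfolding eq by (auto intro!: mean_add ul)
next
  fix x w c assume [simp]: "x \<in> V" "w \<in> V"
  have eq: "b (c *\<^sub>R x) w = (\<lambda>z. c * b x w z)" "b w (c *\<^sub>R x) = (\<lambda>z. c * b w x z)" for x w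
    by (intro ext assms)+
  show "mean (b (c *\<^sub>R x) w) = c * mean (b x w)" "mean (b w (c *\<^sub>R x)) = c * mean (b w x)"
    unfolding eq by (auto intro!: mean_cmult ul)
qed fact

end

section \<open>Mean forms of the elliptic system\<close>

locale elliptic_system = limit_filter F for F +
  fixes A :: "real^'d \<Rightarrow> 'd \<Rightarrow> 'd \<Rightarrow> 'm::finite \<Rightarrow> 'm \<Rightarrow> real" and \<mu> M :: real
  assumes mu_pos: "0 < \<mu>"
    and elliptic: "\<And>y (\<xi>::'d \<Rightarrow> 'm \<Rightarrow> real). \<mu> * (\<Sum>i\<in>UNIV. \<Sum>\<alpha>\<in>UNIV. (\<xi> i \<alpha>)^2)
         \<le> (\<Sum>i\<in>UNIV. \<Sum>j\<in>UNIV. \<Sum>\<alpha>\<in>UNIV. \<Sum>\<beta>\<in>UNIV. A y i j \<alpha> \<beta> * \<xi> i \<alpha> * \<xi> j \<beta>)"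
    and A_measurable: "\<And>i j \<alpha> \<beta>. (\<lambda>y. A y i j \<alpha> \<beta>) \<in> borel_measurable borel"
    and A_bounded: "\<And>y i j \<alpha> \<beta>. \<bar>A y i j \<alpha> \<beta>\<bar> \<le> M"
begin

definition mass :: "((real^'d \<Rightarrow> 'm \<Rightarrow> real) \<times> (real^'d \<Rightarrow> 'd \<Rightarrow> 'm \<Rightarrow> real)) \<Rightarrow> _ \<Rightarrow> real^'d \<Rightarrow> real" where
  "mass x y z = (\<Sum>\<alpha>\<in>UNIV. fst x z \<alpha> * fst y z \<alpha>)"

definition dirichlet :: "((real^'d \<Rightarrow> 'm \<Rightarrow> real) \<times> (real^'d \<Rightarrow> 'd \<Rightarrow> 'm \<Rightarrow> real)) \<Rightarrow> _ \<Rightarrow> real^'d \<Rightarrow> real" where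
  "dirichlet x y z = (\<Sum>i\<in>UNIV. \<Sum>\<alpha>\<in>UNIV. snd x z i \<alpha> * snd y z i \<alpha>)"

text \<open>The first argument plays the solution and carries the indices \<open>j \<beta>\<close>,
  the second is the test element with \<open>i \<alpha>\<close>; the order matters since
  \<open>A\<close> need not be symmetric.\<close>

definition energy :: "((real^'d \<Rightarrow> 'm \<Rightarrow> real) \<times> (real^'d \<Rightarrow> 'd \<Rightarrow> 'm \<Rightarrow> real)) \<Rightarrow> _ \<Rightarrow> real^'d \<Rightarrow> real" where
  "energy x y z = (\<Sum>i\<in>UNIV. \<Sum>j\<in>UNIV. \<Sum>\<alpha>\<in>UNIV. \<Sum>\<beta>\<in>UNIV. A z i j \<alpha> \<beta> * snd y z i \<alpha> * snd x z j \<beta>)"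

text \<open>The gradient of the linear field indexed by \<open>j\<close> and \<beta> selects this
  column of \<open>A\<close>. Tested with \<open>y\<close>, the right-hand side of the corrector
  equation is minus this density.\<close>

definition load :: "'d \<Rightarrow> 'm \<Rightarrow> ((real^'d \<Rightarrow> 'm \<Rightarrow> real) \<times> (real^'d \<Rightarrow> 'd \<Rightarrow> 'm \<Rightarrow> real)) \<Rightarrow> real^'d \<Rightarrow> real" where
  "load j \<beta> y z = (\<Sum>i\<in>UNIV. \<Sum>\<alpha>\<in>UNIV. A z i j \<alpha> \<beta> * snd y z i \<alpha>)"

lemma A_mult: "unif_L2 v \<Longrightarrow> unif_L2 (\<lambda>z. A z i j \<alpha> \<beta> * v z)"
  by (rule unif_L2_bounded_mult[OF _ A_measurable A_bounded])

lemma unif_L2_A: "unif_L2 (\<lambda>z. A z i j \<alpha> \<beta>)"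
  using A_mult[OF unif_L2_const[of 1]] by simp

lemma unif_loc_forms:
  assumes "x \<in> unif_H1" "y \<in> unif_H1"
  shows "unif_loc (mass x y)" "unif_loc (dirichlet x y)" "unif_loc (energy x y)" "unif_loc (load j \<beta> y)"
  unfolding mass_def[abs_def] dirichlet_def[abs_def] energy_def[abs_def] load_def[abs_def]
  by (intro unif_loc_sum finite unif_loc_mult A_mult unif_L2_A unif_H1D assms)+

lemma mass_inner: "semi_inner_on unif_H1 (\<lambda>x y. mean (mass x y))"
proof -
  interpret bilinear_form_on unif_H1 "\<lambda>x y. mean (mass x y)"
    by (rule bilinear_form_on_mean[OF subspace_unif_H1 unif_loc_forms(1)])
       (auto simp: mass_def plus_fun_def scaleR_fun_def sum.distrib sum_distrib_left algebra_simps)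
  show ?thesis
  proof
    fix x y :: "(real^'d \<Rightarrow> 'm \<Rightarrow> real) \<times> (real^'d \<Rightarrow> 'd \<Rightarrow> 'm \<Rightarrow> real)"
    show "mean (mass x y) = mean (mass y x)" by (simp add: mass_def[abs_def] mult.commute)
    assume "x \<in> unif_H1"
    then show "0 \<le> mean (mass x x)"
      by (intro mean_nonneg unif_loc_forms) (auto simp: mass_def sum_nonneg)
  qed
qed

lemma dirichlet_inner: "semi_inner_on unif_H1 (\<lambda>x y. mean (dirichlet x y))"
proof -
  interpret bilinear_form_on unif_H1 "\<lambda>x y. mean (dirichlet x y)"
    by (rule bilinear_form_on_mean[OF subspace_unif_H1 unif_loc_forms(2)])
       (auto simp: dirichlet_def plus_fun_def scaleR_fun_def sum.distrib sum_distrib_left algebra_simps)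
  show ?thesis
  proof
    fix x y :: "(real^'d \<Rightarrow> 'm \<Rightarrow> real) \<times> (real^'d \<Rightarrow> 'd \<Rightarrow> 'm \<Rightarrow> real)"
    show "mean (dirichlet x y) = mean (dirichlet y x)" by (simp add: dirichlet_def[abs_def] mult.commute)
    assume "x \<in> unif_H1"
    then show "0 \<le> mean (dirichlet x x)"
      by (intro mean_nonneg unif_loc_forms) (auto simp: dirichlet_def sum_nonneg)
  qed
qed

text \<open>Multiplied by \<open>2 * t\<close>, the hypothesis at \<open>s = t\<close> says that a
  quadratic in \<open>t\<close> is nonnegative for positive \<open>t\<close>; for the other
  \<open>t\<close> all its terms are nonnegative. Its discriminant gives the claim.\<close>

lemma le_sqrt_mult_of_young:
  fixes X a b :: real
  assumes "\<And>s. s > 0 \<Longrightarrow> \<bar>X\<bar> \<le> (s * a + b / s) / 2" and "0 \<le> a" "0 \<le> b"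
  shows "\<bar>X\<bar> \<le> sqrt a * sqrt b"
proof -
  have "(- \<bar>X\<bar>)^2 \<le> a * b"
  proof (rule nonneg_quadratic_discriminant)
    fix t :: real
    show "0 \<le> a * t^2 + 2 * - \<bar>X\<bar> * t + b"
    proof (cases "t > 0")
      case True
      have "2 * t * \<bar>X\<bar> \<le> 2 * t * ((t * a + b / t) / 2)"
        using assms(1)[OF True] True by (intro mult_left_mono) auto
      also have "\<dots> = a * t^2 + b" using True by (simp add: field_simps power2_eq_square)
      finally show ?thesis by (simp add: mult_ac)
    next
      case False
      then have "\<bar>X\<bar> * t \<le> 0" by (simp add: mult_nonneg_nonpos)
      moreover have "0 \<le> a * t^2" using assms(2) by simp
      moreover have "2 * - \<bar>X\<bar> * t = - 2 * (\<bar>X\<bar> * t)" by simp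
      ultimately show ?thesis using assms(3) by linarith
    qed
  qed fact
  then have "sqrt (X^2) \<le> sqrt (a * b)" by (intro real_sqrt_le_mono) simp
  then show ?thesis by (simp add: real_sqrt_mult)
qed

text \<open>This is Cauchy--Schwarz for densities that are sums of many products: the pointwise
  Young inequality is averaged by linearity and monotonicity, and only then optimized over
  \<open>s\<close>.\<close>

lemma mean_abs_le_young:
  assumes "unif_loc h" "unif_loc k" "unif_loc g"
    and "\<And>s x. s > 0 \<Longrightarrow> \<bar>h x\<bar> \<le> (s * k x + g x / s) / 2" and "\<And>x. 0 \<le> k x" "\<And>x. 0 \<le> g x"
  shows "\<bar>mean h\<bar> \<le> sqrt (mean k) * sqrt (mean g)"
proof (rule le_sqrt_mult_of_young)
  fix s :: real assume s: "s > 0"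
  have eq: "(\<lambda>x. (s * k x + g x / s) / 2) = (\<lambda>x. (s / 2) * k x + (1 / (2 * s)) * g x)"
    using s by (auto simp: field_simps)
  have ul: "unif_loc (\<lambda>x. (s * k x + g x / s) / 2)"
    unfolding eq by (intro unif_loc_add unif_loc_cmult assms)
  have m: "mean (\<lambda>x. (s * k x + g x / s) / 2) = (s * mean k + mean g / s) / 2"
    unfolding eq mean_add[OF unif_loc_cmult[OF assms(2)] unif_loc_cmult[OF assms(3)]]
      mean_cmult[OF assms(2)] mean_cmult[OF assms(3)]
    using s by (simp add: field_simps)
  have b: "h x \<le> (s * k x + g x / s) / 2" "- h x \<le> (s * k x + g x / s) / 2" for x
    using assms(4)[OF s, of x] by linarith+
  have "mean h \<le> mean (\<lambda>x. (s * k x + g x / s) / 2)"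
    by (rule mean_mono[OF assms(1) ul b(1)])
  moreover have "- mean h \<le> mean (\<lambda>x. (s * k x + g x / s) / 2)"
    using mean_mono[OF unif_loc_cmult[OF assms(1), of "-1"] ul] b(2) mean_minus[OF assms(1)] by simp
  ultimately show "\<bar>mean h\<bar> \<le> (s * mean k + mean g / s) / 2" using m by linarith
qed (intro mean_nonneg assms)+

text \<open>Each square in \<open>dirichlet\<close> occurs \<open>CARD('d) * CARD('m)\<close> times
  in the fourfold sum of \<open>energy\<close>. The added 1 keeps the constant positive even if
  \<open>M = 0\<close>.\<close>

definition "opbound = \<bar>M\<bar> * real CARD('d) * real CARD('m) + 1"

lemma opbound_pos: "0 < opbound"
  by (simp add: opbound_def add_nonneg_pos)

lemma energy_bounded:
  assumes x: "x \<in> unif_H1" and y: "y \<in> unif_H1"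
  shows "\<bar>mean (energy x y)\<bar> \<le> opbound * sqrt (mean (dirichlet x x)) * sqrt (mean (dirichlet y y))"
proof -
  define N where "N = \<bar>M\<bar> * real CARD('d) * real CARD('m)"
  have N: "0 \<le> N" by (simp add: N_def)
  have dnn: "0 \<le> dirichlet x x z" for x z by (simp add: dirichlet_def sum_nonneg)
  have "\<bar>mean (energy x y)\<bar> \<le> sqrt (mean (\<lambda>z. N * dirichlet x x z)) * sqrt (mean (\<lambda>z. N * dirichlet y y z))"
  proof (rule mean_abs_le_young)
    fix s :: real and z assume s: "s > 0"
    have "\<bar>energy x y z\<bar> \<le> (\<Sum>i\<in>UNIV. \<Sum>j\<in>UNIV. \<Sum>\<alpha>\<in>UNIV. \<Sum>\<beta>\<in>UNIV. \<bar>M\<bar> / 2 * (s * (snd x z j \<beta>)^2 + (snd y z i \<alpha>)^2 / s))"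
      unfolding energy_def
    proof (intro order_trans[OF sum_abs] sum_mono)
      fix i j \<alpha> \<beta>
      have "\<bar>A z i j \<alpha> \<beta> * snd y z i \<alpha> * snd x z j \<beta>\<bar> = \<bar>A z i j \<alpha> \<beta>\<bar> * \<bar>snd x z j \<beta> * snd y z i \<alpha>\<bar>"
        by (simp add: abs_mult mult_ac)
      also have "\<dots> \<le> \<bar>M\<bar> * ((s * (snd x z j \<beta>)^2 + (snd y z i \<alpha>)^2 / s) / 2)"
        using A_bounded[of z i j \<alpha> \<beta>] s by (intro mult_mono abs_mult_le_young) auto
      finally show "\<bar>A z i j \<alpha> \<beta> * snd y z i \<alpha> * snd x z j \<beta>\<bar> \<le> \<bar>M\<bar> / 2 * (s * (snd x z j \<beta>)^2 + (snd y z i \<alpha>)^2 / s)"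
        by simp
    qed
    also have "\<dots> = (s * (N * dirichlet x x z) + N * dirichlet y y z / s) / 2"
      unfolding dirichlet_def N_def power2_eq_square[symmetric]
      by (simp add: sum.distrib sum_distrib_left[symmetric] sum_divide_distrib[symmetric])
         (simp add: field_simps)
    finally show "\<bar>energy x y z\<bar> \<le> (s * (N * dirichlet x x z) + N * dirichlet y y z / s) / 2" .
  qed (auto intro!: unif_loc_cmult unif_loc_forms x y simp: N dnn)
  also have "\<dots> = N * (sqrt (mean (dirichlet x x)) * sqrt (mean (dirichlet y y)))"
    using N by (simp add: mean_cmult unif_loc_forms x y real_sqrt_mult)
  also have "\<dots> \<le> opbound * (sqrt (mean (dirichlet x x)) * sqrt (mean (dirichlet y y)))"
    using N by (intro mult_right_mono mult_nonneg_nonneg)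
      (auto simp: opbound_def N_def intro!: mean_nonneg unif_loc_forms x y dnn)
  finally show ?thesis by (simp add: mult.assoc)
qed

lemma energy_coercive:
  assumes x: "x \<in> unif_H1"
  shows "\<mu> * mean (dirichlet x x) \<le> mean (energy x x)"
proof -
  have "mean (\<lambda>z. \<mu> * dirichlet x x z) \<le> mean (energy x x)"
    using elliptic[of "snd x _"]
    by (intro mean_mono unif_loc_cmult unif_loc_forms x) (auto simp: dirichlet_def energy_def power2_eq_square)
  then show ?thesis by (simp add: mean_cmult unif_loc_forms x)
qed

sublocale coercive_form_on unif_H1 "\<lambda>x y. mean (dirichlet x y)" "\<lambda>x y. mean (energy x y)" \<mu> opbound
proof -
  interpret q: semi_inner_on unif_H1 "\<lambda>x y. mean (dirichlet x y)" by (rule dirichlet_inner)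
  interpret B: bilinear_form_on unif_H1 "\<lambda>x y. mean (energy x y)"
    by (rule bilinear_form_on_mean[OF subspace_unif_H1 unif_loc_forms(3)])
       (auto simp: energy_def plus_fun_def scaleR_fun_def sum.distrib sum_distrib_left algebra_simps)
  show "coercive_form_on unif_H1 (\<lambda>x y. mean (dirichlet x y)) (\<lambda>x y. mean (energy x y)) \<mu> opbound"
    by unfold_locales
       (simp_all only: mu_pos energy_coercive q.nrm_def energy_bounded opbound_pos)
qed

lemma load_functional:
  "functional_on (\<lambda>y. - mean (load j \<beta> y)) (sqrt (mean (\<lambda>z. \<Sum>i\<in>UNIV. \<Sum>\<alpha>\<in>UNIV. (A z i j \<alpha> \<beta>)^2)))"
  unfolding functional_on_def
proof (intro conjI ballI allI)
  fix x y :: "(real^'d \<Rightarrow> 'm \<Rightarrow> real) \<times> (real^'d \<Rightarrow> 'd \<Rightarrow> 'm \<Rightarrow> real)" and c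
  assume x: "x \<in> unif_H1"
  have eq: "load j \<beta> (x + y) = (\<lambda>z. load j \<beta> x z + load j \<beta> y z)" "load j \<beta> (c *\<^sub>R x) = (\<lambda>z. c * load j \<beta> x z)" for x y c
    by (auto simp: load_def plus_fun_def scaleR_fun_def sum.distrib sum_distrib_left algebra_simps)
  show "- mean (load j \<beta> (c *\<^sub>R x)) = c * - mean (load j \<beta> x)"
    unfolding eq by (simp add: mean_cmult unif_loc_forms(4)[OF x x])
  show "- mean (load j \<beta> (x + y)) = - mean (load j \<beta> x) + - mean (load j \<beta> y)" if y: "y \<in> unif_H1"
    unfolding eq by (simp add: mean_add unif_loc_forms(4)[OF x x] unif_loc_forms(4)[OF y y])
  have "\<bar>mean (load j \<beta> x)\<bar> \<le> sqrt (mean (\<lambda>z. \<Sum>i\<in>UNIV. \<Sum>\<alpha>\<in>UNIV. (A z i j \<alpha> \<beta>)^2)) * sqrt (mean (dirichlet x x))"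
  proof (rule mean_abs_le_young)
    show "unif_loc (\<lambda>z. \<Sum>i\<in>UNIV. \<Sum>\<alpha>\<in>UNIV. (A z i j \<alpha> \<beta>)^2)"
      by (intro unif_loc_sum finite unif_L2_square unif_L2_A)
    fix s :: real and z assume s: "s > 0"
    have "\<bar>load j \<beta> x z\<bar> \<le> (\<Sum>i\<in>UNIV. \<Sum>\<alpha>\<in>UNIV. (s * (A z i j \<alpha> \<beta>)^2 + (snd x z i \<alpha>)^2 / s) / 2)"
      unfolding load_def using s by (intro order_trans[OF sum_abs] sum_mono abs_mult_le_young)
    also have "\<dots> = (s * (\<Sum>i\<in>UNIV. \<Sum>\<alpha>\<in>UNIV. (A z i j \<alpha> \<beta>)^2) + dirichlet x x z / s) / 2"
      by (simp add: dirichlet_def sum.distrib sum_distrib_left sum_divide_distrib power2_eq_square add_divide_distrib)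
    finally show "\<bar>load j \<beta> x z\<bar> \<le> (s * (\<Sum>i\<in>UNIV. \<Sum>\<alpha>\<in>UNIV. (A z i j \<alpha> \<beta>)^2) + dirichlet x x z / s) / 2" .
  qed (auto intro!: unif_loc_forms x simp: dirichlet_def sum_nonneg)
  then show "\<bar>- mean (load j \<beta> x)\<bar> \<le> sqrt (mean (\<lambda>z. \<Sum>i\<in>UNIV. \<Sum>\<alpha>\<in>UNIV. (A z i j \<alpha> \<beta>)^2)) * nrm x"
    by (simp add: nrm_def)
qed

section \<open>The weak equation in the mean\<close>

definition solves :: "'d \<Rightarrow> 'm \<Rightarrow> real \<Rightarrow> (real^'d \<Rightarrow> 'm \<Rightarrow> real) \<times> (real^'d \<Rightarrow> 'd \<Rightarrow> 'm \<Rightarrow> real) \<Rightarrow> bool" where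
  "solves j \<beta> l x \<longleftrightarrow> (\<forall>\<phi> :: real^'d \<Rightarrow> 'm \<Rightarrow> real. (\<forall>\<alpha>. test_fn (\<lambda>z. \<phi> z \<alpha>)) \<longrightarrow>
     (\<integral>z. (\<Sum>i\<in>UNIV. \<Sum>\<alpha>\<in>UNIV. \<Sum>k\<in>UNIV. \<Sum>\<gamma>\<in>UNIV. A z i k \<alpha> \<gamma> * snd x z k \<gamma> * pd i (\<lambda>y. \<phi> y \<alpha>) z)
          + l * (\<Sum>\<alpha>\<in>UNIV. fst x z \<alpha> * \<phi> z \<alpha>) \<partial>lborel)
     = - (\<integral>z. (\<Sum>i\<in>UNIV. \<Sum>\<alpha>\<in>UNIV. A z i j \<alpha> \<beta> * pd i (\<lambda>y. \<phi> y \<alpha>) z) \<partial>lborel))"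

text \<open>The field \<open>A\<close> applied to the gradient of the corrector plus that of the
  linear field. With both combined the equation has no right-hand side, which is the shape
  \<open>weak_product_rule\<close> expects.\<close>

definition flux :: "'d \<Rightarrow> 'm \<Rightarrow> (real^'d \<Rightarrow> 'm \<Rightarrow> real) \<times> (real^'d \<Rightarrow> 'd \<Rightarrow> 'm \<Rightarrow> real) \<Rightarrow> 'm \<Rightarrow> 'd \<Rightarrow> real^'d \<Rightarrow> real" where
  "flux j \<beta> x \<alpha> i z = (\<Sum>k\<in>UNIV. \<Sum>\<gamma>\<in>UNIV. A z i k \<alpha> \<gamma> * snd x z k \<gamma>) + A z i j \<alpha> \<beta>"

lemma unif_L2_flux: "x \<in> unif_H1 \<Longrightarrow> unif_L2 (flux j \<beta> x \<alpha> i)"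
  unfolding flux_def[abs_def] by (intro unif_L2_add unif_L2_sum finite A_mult unif_L2_A unif_H1D)

text \<open>\<open>weak_product_rule\<close> is scalar, so the system is split by testing with
  fields that have a single nonzero component.\<close>

lemma solves_component:
  assumes x: "x \<in> unif_H1" and sol: "solves j \<beta> l x" and \<phi>: "test_fn \<phi>"
  shows "(\<integral>z. (\<Sum>i\<in>UNIV. flux j \<beta> x \<alpha> i z * pd i \<phi> z) + (l * fst x z \<alpha>) * \<phi> z \<partial>lborel) = 0"
proof -
  define \<psi> where "\<psi> z \<alpha>' = (if \<alpha>' = \<alpha> then \<phi> z else 0)" for z \<alpha>'
  have \<psi>: "(\<lambda>z. \<psi> z \<alpha>') = (if \<alpha>' = \<alpha> then \<phi> else (\<lambda>z. 0))" for \<alpha>'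
    by (auto simp: \<psi>_def)
  have test: "test_fn (\<lambda>z. \<psi> z \<alpha>')" for \<alpha>' by (simp add: \<psi> \<phi> test_fn_zero)
  have pd\<psi>: "pd i (\<lambda>z. \<psi> z \<alpha>') z = (if \<alpha>' = \<alpha> then pd i \<phi> z else 0)" for i \<alpha>' z
    by (simp add: \<psi> pd_zero)
  define G where "G i z = (\<Sum>k\<in>UNIV. \<Sum>\<gamma>\<in>UNIV. A z i k \<alpha> \<gamma> * snd x z k \<gamma>)" for i z
  have 1: "(\<Sum>i\<in>UNIV. \<Sum>\<alpha>'\<in>UNIV. \<Sum>k\<in>UNIV. \<Sum>\<gamma>\<in>UNIV. A z i k \<alpha>' \<gamma> * snd x z k \<gamma> * pd i (\<lambda>y. \<psi> y \<alpha>') z)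
      = (\<Sum>i\<in>UNIV. G i z * pd i \<phi> z)" for z
  proof (intro sum.cong refl)
    fix i
    have "(\<Sum>\<alpha>'\<in>UNIV. \<Sum>k\<in>UNIV. \<Sum>\<gamma>\<in>UNIV. A z i k \<alpha>' \<gamma> * snd x z k \<gamma> * pd i (\<lambda>y. \<psi> y \<alpha>') z)
      = (\<Sum>\<alpha>'\<in>UNIV. if \<alpha>' = \<alpha> then G i z * pd i \<phi> z else 0)"
      by (intro sum.cong refl) (simp add: pd\<psi> G_def sum_distrib_right)
    also have "\<dots> = G i z * pd i \<phi> z" by simp
    finally show "(\<Sum>\<alpha>'\<in>UNIV. \<Sum>k\<in>UNIV. \<Sum>\<gamma>\<in>UNIV. A z i k \<alpha>' \<gamma> * snd x z k \<gamma> * pd i (\<lambda>y. \<psi> y \<alpha>') z)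
      = G i z * pd i \<phi> z" .
  qed
  have 2: "(\<Sum>\<alpha>'\<in>UNIV. fst x z \<alpha>' * \<psi> z \<alpha>') = fst x z \<alpha> * \<phi> z" for z
    by (simp add: \<psi>_def if_distrib cong: if_cong)
  have 3: "(\<Sum>i\<in>UNIV. \<Sum>\<alpha>'\<in>UNIV. A z i j \<alpha>' \<beta> * pd i (\<lambda>y. \<psi> y \<alpha>') z) = (\<Sum>i\<in>UNIV. A z i j \<alpha> \<beta> * pd i \<phi> z)" for z
    by (simp add: pd\<psi> if_distrib cong: if_cong)
  have G: "unif_L2 (G i)" for i
    unfolding G_def[abs_def] by (intro unif_L2_sum finite A_mult unif_H1D x)
  have i1: "integrable lborel (\<lambda>z. (\<Sum>i\<in>UNIV. G i z * pd i \<phi> z) + l * (fst x z \<alpha> * \<phi> z))"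
    by (intro Bochner_Integration.integrable_add Bochner_Integration.integrable_sum integrable_mult_right
        integrable_times_test_fn G unif_H1D x \<phi>)
  have i2: "integrable lborel (\<lambda>z. \<Sum>i\<in>UNIV. A z i j \<alpha> \<beta> * pd i \<phi> z)"
    by (intro Bochner_Integration.integrable_sum integrable_times_test_fn unif_L2_A \<phi>)
  have "(\<integral>z. (\<Sum>i\<in>UNIV. G i z * pd i \<phi> z) + l * (fst x z \<alpha> * \<phi> z) \<partial>lborel)
      = - (\<integral>z. (\<Sum>i\<in>UNIV. A z i j \<alpha> \<beta> * pd i \<phi> z) \<partial>lborel)"
    using sol[unfolded solves_def, rule_format, of \<psi>, OF test] unfolding 1 2 3 .
  then have "(\<integral>z. ((\<Sum>i\<in>UNIV. G i z * pd i \<phi> z) + l * (fst x z \<alpha> * \<phi> z)) + (\<Sum>i\<in>UNIV. A z i j \<alpha> \<beta> * pd i \<phi> z) \<partial>lborel) = 0"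
    using i1 i2 by (subst Bochner_Integration.integral_add) auto
  also have "(\<lambda>z. ((\<Sum>i\<in>UNIV. G i z * pd i \<phi> z) + l * (fst x z \<alpha> * \<phi> z)) + (\<Sum>i\<in>UNIV. A z i j \<alpha> \<beta> * pd i \<phi> z))
    = (\<lambda>z. (\<Sum>i\<in>UNIV. flux j \<beta> x \<alpha> i z * pd i \<phi> z) + (l * fst x z \<alpha>) * \<phi> z)"
    by (simp add: flux_def G_def distrib_right sum.distrib algebra_simps)
  finally show ?thesis .
qed

lemma mean_flux:
  assumes x: "x \<in> unif_H1" and sol: "solves j \<beta> l x" and y: "y \<in> unif_H1"
  shows "mean (\<lambda>z. (\<Sum>i\<in>UNIV. flux j \<beta> x \<alpha> i z * snd y z i \<alpha>) + l * (fst x z \<alpha> * fst y z \<alpha>)) = 0"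
    (is "mean ?h = 0")
proof (rule mean_eqI)
  note uf = unif_L2_flux[OF x, of j \<beta> \<alpha>]
  have ulh: "unif_loc ?h"
    by (intro unif_loc_add unif_loc_cmult unif_loc_sum finite unif_loc_mult uf unif_H1D x y)
  have ulv: "unif_loc (\<lambda>z. flux j \<beta> x \<alpha> i z * fst y z \<alpha>)" for i
    by (intro unif_loc_mult uf unif_H1D y)
  have eq: "wavg ?h L = - (\<Sum>i\<in>UNIV. (\<integral>z. (flux j \<beta> x \<alpha> i z * fst y z \<alpha>) * pd i (weight L) z \<partial>lborel) / L ^ CARD('d))"
    if L: "L > 0" for L
  proof -
    \<comment> \<open>The product of \<open>weight L\<close> and the \<alpha>-component of
      \<open>fst y\<close> is only weakly differentiable; the product rule makes it an admissible
      test function.\<close>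
    have "0 = (\<integral>z. (\<Sum>i\<in>UNIV. flux j \<beta> x \<alpha> i z * (pd i (weight L) z * fst y z \<alpha> + weight L z * snd y z i \<alpha>))
        + (l * fst x z \<alpha>) * (weight L z * fst y z \<alpha>) \<partial>lborel)"
      by (rule weak_product_rule[symmetric]; (intro unif_L2_imp_locally_L2 uf unif_L2_cmult unif_H1D x y solves_component sol test_fn_weight L; assumption?))
    also have "\<dots> = (\<integral>z. ?h z * weight L z + (\<Sum>i\<in>UNIV. (flux j \<beta> x \<alpha> i z * fst y z \<alpha>) * pd i (weight L) z) \<partial>lborel)"
      by (intro Bochner_Integration.integral_cong refl)
         (simp add: algebra_simps sum.distrib sum_distrib_left)
    also have "\<dots> = (\<integral>z. ?h z * weight L z \<partial>lborel) + (\<Sum>i\<in>UNIV. \<integral>z. (flux j \<beta> x \<alpha> i z * fst y z \<alpha>) * pd i (weight L) z \<partial>lborel)"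
      using unif_loc_weighted(1)[OF ulh L] unif_loc_weighted(2)[OF ulv L]
      by (subst Bochner_Integration.integral_add) (auto simp: Bochner_Integration.integral_sum)
    finally have e: "(\<integral>z. ?h z * weight L z \<partial>lborel)
        = - (\<Sum>i\<in>UNIV. \<integral>z. (flux j \<beta> x \<alpha> i z * fst y z \<alpha>) * pd i (weight L) z \<partial>lborel)"
      by linarith
    show ?thesis
      unfolding wavg_def e sum_divide_distrib[symmetric] by simp
  qed
  have lim: "((\<lambda>L. (\<integral>z. (flux j \<beta> x \<alpha> i z * fst y z \<alpha>) * pd i (weight L) z \<partial>lborel) / L ^ CARD('d)) \<longlongrightarrow> 0) F" for i
  proof -
    obtain C where C: "\<And>L. 1 \<le> L \<Longrightarrow> \<bar>\<integral>z. (flux j \<beta> x \<alpha> i z * fst y z \<alpha>) * pd i (weight L) z \<partial>lborel\<bar> / L ^ CARD('d) \<le> C / L"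
      using unif_loc_weighted(3)[OF ulv[of i]] by blast
    have "((\<lambda>L. C / L) \<longlongrightarrow> 0) at_top"
      by (intro tendsto_divide_0[OF tendsto_const] filterlim_at_top_imp_at_infinity filterlim_ident)
    then have "((\<lambda>L. (\<integral>z. (flux j \<beta> x \<alpha> i z * fst y z \<alpha>) * pd i (weight L) z \<partial>lborel) / L ^ CARD('d)) \<longlongrightarrow> 0) at_top"
    proof (rule Lim_null_comparison[rotated])
      show "\<forall>\<^sub>F L in at_top. norm ((\<integral>z. (flux j \<beta> x \<alpha> i z * fst y z \<alpha>) * pd i (weight L) z \<partial>lborel) / L ^ CARD('d)) \<le> C / L"
        using eventually_ge_at_top[of 1] by eventually_elim (use C in auto)
    qed
    then show ?thesis using le_at_top by (rule tendsto_mono[rotated])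
  qed
  have "((\<lambda>L. - (\<Sum>i\<in>UNIV. (\<integral>z. (flux j \<beta> x \<alpha> i z * fst y z \<alpha>) * pd i (weight L) z \<partial>lborel) / L ^ CARD('d))) \<longlongrightarrow> - (\<Sum>i\<in>(UNIV::'d set). 0)) F"
    by (intro tendsto_intros lim)
  then have "((\<lambda>L. - (\<Sum>i\<in>UNIV. (\<integral>z. (flux j \<beta> x \<alpha> i z * fst y z \<alpha>) * pd i (weight L) z \<partial>lborel) / L ^ CARD('d))) \<longlongrightarrow> 0) F"
    by simp
  moreover have "\<forall>\<^sub>F L in F. - (\<Sum>i\<in>UNIV. (\<integral>z. (flux j \<beta> x \<alpha> i z * fst y z \<alpha>) * pd i (weight L) z \<partial>lborel) / L ^ CARD('d)) = wavg ?h L"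
    using ev_pos by eventually_elim (simp only: eq)
  ultimately show "(wavg ?h \<longlongrightarrow> 0) F" by (rule Lim_transform_eventually)
qed

lemma mean_equation:
  assumes x: "x \<in> unif_H1" and sol: "solves j \<beta> l x" and y: "y \<in> unif_H1"
  shows "mean (energy x y) + l * mean (mass x y) = - mean (load j \<beta> y)"
proof -
  have pw: "(\<Sum>\<alpha>\<in>UNIV. (\<Sum>i\<in>UNIV. flux j \<beta> x \<alpha> i z * snd y z i \<alpha>) + l * (fst x z \<alpha> * fst y z \<alpha>))
      = (energy x y z + load j \<beta> y z) + l * mass x y z" for z
  proof -
    have "(\<Sum>\<alpha>\<in>UNIV. \<Sum>i\<in>UNIV. flux j \<beta> x \<alpha> i z * snd y z i \<alpha>) = (\<Sum>i\<in>UNIV. \<Sum>\<alpha>\<in>UNIV. flux j \<beta> x \<alpha> i z * snd y z i \<alpha>)"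
      by (rule sum.swap)
    also have "\<dots> = (\<Sum>i\<in>UNIV. \<Sum>\<alpha>\<in>UNIV. \<Sum>k\<in>UNIV. \<Sum>\<gamma>\<in>UNIV. A z i k \<alpha> \<gamma> * snd y z i \<alpha> * snd x z k \<gamma>) + load j \<beta> y z"
      by (simp add: flux_def load_def algebra_simps sum.distrib sum_distrib_left)
    also have "(\<Sum>i\<in>UNIV. \<Sum>\<alpha>\<in>UNIV. \<Sum>k\<in>UNIV. \<Sum>\<gamma>\<in>UNIV. A z i k \<alpha> \<gamma> * snd y z i \<alpha> * snd x z k \<gamma>) = energy x y z"
      unfolding energy_def by (intro sum.cong refl sum.swap)
    finally show ?thesis by (simp add: sum.distrib mass_def sum_distrib_left)
  qed
  have ul: "unif_loc (\<lambda>z. (\<Sum>i\<in>UNIV. flux j \<beta> x \<alpha> i z * snd y z i \<alpha>) + l * (fst x z \<alpha> * fst y z \<alpha>))" for \<alpha>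
    by (intro unif_loc_add unif_loc_cmult unif_loc_sum finite unif_loc_mult unif_L2_flux unif_H1D x y)
  note f = unif_loc_forms(1,3)[OF x y] unif_loc_forms(4)[OF x y, of j \<beta>]
  have "0 = mean (\<lambda>z. \<Sum>\<alpha>\<in>UNIV. (\<Sum>i\<in>UNIV. flux j \<beta> x \<alpha> i z * snd y z i \<alpha>) + l * (fst x z \<alpha> * fst y z \<alpha>))"
    by (simp add: mean_sum[OF finite ul] mean_flux[OF x sol y])
  also have "\<dots> = mean (energy x y) + mean (load j \<beta> y) + l * mean (mass x y)"
    unfolding pw mean_add[OF unif_loc_add[OF f(2,3)] unif_loc_cmult[OF f(1)]] mean_add[OF f(2,3)] mean_cmult[OF f(1)] ..
  finally show ?thesis by simp
qed

theorem mass_vanishes: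
  assumes x: "\<And>T. T > 0 \<Longrightarrow> x T \<in> unif_H1" and sol: "\<And>T. T > 0 \<Longrightarrow> solves j \<beta> (1 / T^2) (x T)"
  shows "((\<lambda>T. 1 / T^2 * mean (mass (x T) (x T))) \<longlongrightarrow> 0) at_top"
proof -
  have sq: "1 / (1 / sqrt l)^2 = l" "1 / sqrt l > 0" if "l > 0" for l
    using that by (auto simp: power_divide)
  \<comment> \<open>\<open>resolvent_vanishes\<close> lets \<open>l\<close> tend to 0 from the
    right, so the family is reindexed by \<open>l = 1 / T^2\<close>, that is
    \<open>T = 1 / sqrt l\<close>.\<close>
  define u where "u l = x (1 / sqrt l)" for l
  have u: "u l \<in> unif_H1" "solves j \<beta> l (u l)" if "l > 0" for l
    using x[OF sq(2)[OF that]] sol[OF sq(2)[OF that]] that by (auto simp: u_def sq)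
  have "((\<lambda>l. l * mean (mass (u l) (u l))) \<longlongrightarrow> 0) (at_right 0)"
    by (rule resolvent_vanishes[OF mass_inner load_functional[of j \<beta>] u(1)]) (simp_all add: mean_equation u)
  moreover have "filterlim (\<lambda>T::real. 1 / T^2) (at_right 0) at_top"
    unfolding filterlim_at
  proof
    show "((\<lambda>T::real. 1 / T^2) \<longlongrightarrow> 0) at_top"
      by (intro tendsto_divide_0[OF tendsto_const] filterlim_at_top_imp_at_infinity filterlim_pow_at_top filterlim_ident) simp
    show "\<forall>\<^sub>F T::real in at_top. 1 / T^2 \<in> {0<..} \<and> 1 / T^2 \<noteq> 0"
      using eventually_gt_at_top[of 0] by eventually_elim simp
  qed
  ultimately have "((\<lambda>T. 1 / T^2 * mean (mass (u (1 / T^2)) (u (1 / T^2)))) \<longlongrightarrow> 0) at_top"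
    by (rule filterlim_compose)
  moreover have "\<forall>\<^sub>F T in at_top. 1 / T^2 * mean (mass (u (1 / T^2)) (u (1 / T^2))) = 1 / T^2 * mean (mass (x T) (x T))"
    using eventually_gt_at_top[of 0] by eventually_elim (simp add: u_def real_sqrt_divide)
  ultimately show ?thesis by (rule Lim_transform_eventually)
qed

end

subsection \<open>Borel representatives\<close>

lemma trig_poly_bounded: "trig_poly p \<Longrightarrow> \<exists>M. \<forall>y. \<bar>p y\<bar> \<le> M"
proof -
  assume "trig_poly p"
  then obtain n :: nat and lam c s where p: "\<And>y. p y = (\<Sum>k<n. c k * cos (lam k \<bullet> y) + s k * sin (lam k \<bullet> y))"
    unfolding trig_poly_def by blast
  have "\<bar>p y\<bar> \<le> (\<Sum>k<n. \<bar>c k\<bar> + \<bar>s k\<bar>)" for y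
    unfolding p
  proof (intro order_trans[OF sum_abs] sum_mono)
    fix k
    have "\<bar>c k * cos (lam k \<bullet> y)\<bar> \<le> \<bar>c k\<bar>" "\<bar>s k * sin (lam k \<bullet> y)\<bar> \<le> \<bar>s k\<bar>"
      by (auto simp: abs_mult intro!: mult_left_le)
    then show "\<bar>c k * cos (lam k \<bullet> y) + s k * sin (lam k \<bullet> y)\<bar> \<le> \<bar>c k\<bar> + \<bar>s k\<bar>" by linarith
  qed
  then show ?thesis by blast
qed

lemma trig_poly_measurable: "trig_poly p \<Longrightarrow> p \<in> borel_measurable borel"
proof -
  assume "trig_poly p"
  then obtain n :: nat and lam c s where "p = (\<lambda>y. \<Sum>k<n. c k * cos (lam k \<bullet> y) + s k * sin (lam k \<bullet> y))"
    unfolding trig_poly_def by blast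
  then show ?thesis by (auto intro!: borel_measurable_continuous_onI continuous_intros)
qed

lemma unif_almost_periodic_bounded:
  assumes "unif_almost_periodic f"
  obtains M where "\<And>y. \<bar>f y\<bar> \<le> M"
proof -
  obtain p where p: "trig_poly p" "\<And>y. \<bar>f y - p y\<bar> < 1"
    using assms unfolding unif_almost_periodic_def by (meson zero_less_one)
  obtain M where M: "\<And>y. \<bar>p y\<bar> \<le> M" using trig_poly_bounded[OF p(1)] by blast
  have "\<bar>f y\<bar> \<le> M + 1" for y using p(2)[of y] M[of y] by linarith
  then show ?thesis by (rule that)
qed

lemma unif_almost_periodic_measurable:
  assumes "unif_almost_periodic f"
  shows "f \<in> borel_measurable borel"
proof -
  have "\<exists>p. trig_poly p \<and> (\<forall>y. \<bar>f y - p y\<bar> < inverse (real (Suc n)))" for n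
    using assms unfolding unif_almost_periodic_def by simp
  then obtain p where p: "\<And>n. trig_poly (p n)" "\<And>n y. \<bar>f y - p n y\<bar> < inverse (real (Suc n))" by metis
  show ?thesis
  proof (rule borel_measurable_LIMSEQ_real)
    show "p n \<in> borel_measurable borel" for n by (rule trig_poly_measurable[OF p(1)])
    fix y
    have "(\<lambda>n. p n y - f y) \<longlonglongrightarrow> 0"
      using p(2)[of y] by (intro Lim_null_comparison[OF _ LIMSEQ_inverse_real_of_nat])
        (auto intro!: always_eventually less_imp_le simp: abs_minus_commute)
    then show "(\<lambda>n. p n y) \<longlonglongrightarrow> f y" by (simp add: LIM_zero_iff)
  qed
qed

text \<open>Completeness of the Lebesgue measure makes \<open>f\<close> measurable as soon as it
  agrees almost everywhere with a Borel function.\<close>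

lemma integral_lebesgue_eq_lborel:
  fixes f f' :: "'a::euclidean_space \<Rightarrow> real"
  assumes f': "f' \<in> borel_measurable borel" and ae: "AE z in lborel. f z = f' z"
  shows "(\<integral>z. f z \<partial>lebesgue) = (\<integral>z. f' z \<partial>lborel)"
proof -
  have m: "f' \<in> borel_measurable lebesgue" using f' by (intro measurable_completion) simp
  have "f \<in> borel_measurable lebesgue"
    by (rule borel_measurable_AE[OF m]) (use ae in \<open>auto simp: AE_completion_iff elim: eventually_mono\<close>)
  then have "(\<integral>z. f z \<partial>lebesgue) = (\<integral>z. f' z \<partial>lebesgue)"
    using m ae by (intro integral_cong_AE) (auto simp: AE_completion_iff)
  also have "\<dots> = (\<integral>z. f' z \<partial>lborel)" using f' by (intro integral_completion) simp
  finally show ?thesis .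
qed

lemma set_integrable_square_ball: "L2loc f \<Longrightarrow> set_integrable lebesgue (ball x 1) (\<lambda>z. (f z)^2)"
  by (rule set_integrable_subset[of lebesgue "cball x 1"]) (auto simp: L2loc_def)

text \<open>A bound on a Bochner integral becomes one on a nonnegative integral. Integrability of
  \<open>S\<close> is what gives the bound content, as the Bochner integral of a function that is
  not integrable is 0.\<close>

lemma nn_integral_ball_le:
  fixes S S' :: "'a::euclidean_space \<Rightarrow> real"
  assumes S: "set_integrable lebesgue (ball x 1) S" "\<And>z. 0 \<le> S z"
    and C: "(LINT z:ball x 1|lebesgue. S z) \<le> C"
    and le: "AE z in lborel. \<bar>S' z\<bar> \<le> S z"
  shows "(\<integral>\<^sup>+z. ennreal \<bar>S' z\<bar> * indicator (ball x 1) z \<partial>lborel) \<le> ennreal C"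
proof -
  have "(\<integral>\<^sup>+z. ennreal \<bar>S' z\<bar> * indicator (ball x 1) z \<partial>lborel)
    \<le> (\<integral>\<^sup>+z. ennreal (indicator (ball x 1) z *\<^sub>R S z) \<partial>lborel)"
  proof (rule nn_integral_mono_AE)
    show "AE z in lborel. ennreal \<bar>S' z\<bar> * indicator (ball x 1) z \<le> ennreal (indicator (ball x 1) z *\<^sub>R S z)"
      using le by eventually_elim (auto simp: indicator_def intro: ennreal_leI)
  qed
  also have "\<dots> = (\<integral>\<^sup>+z. ennreal (indicator (ball x 1) z *\<^sub>R S z) \<partial>lebesgue)"
    by (simp add: nn_integral_completion)
  also have "\<dots> = ennreal (LINT z:ball x 1|lebesgue. S z)"
    using S unfolding set_integrable_def set_lebesgue_integral_def
    by (intro nn_integral_eq_integral) (auto simp: indicator_def)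
  also have "\<dots> \<le> ennreal C" using C by (rule ennreal_leI)
  finally show ?thesis .
qed

text \<open>Each of the finitely many components of the corrector and its gradient is replaced by a
  Borel function that agrees with it off a null set, which alters no integral. Local square
  integrability turns the bound on unit balls into uniform local integrability.\<close>

lemma (in elliptic_system) approx_corrector_representative:
  assumes "approx_corrector A T j \<beta> u"
  obtains x where "x \<in> unif_H1" "AE z in lborel. \<forall>\<alpha>. u z \<alpha> = fst x z \<alpha>" "solves j \<beta> (1 / T^2) x"
proof -
  obtain G C where wg: "weak_gradient u G"
    and C': "\<forall>x. (LINT y:ball x 1|lebesgue. (\<Sum>i\<in>UNIV. \<Sum>\<alpha>\<in>UNIV. (G y i \<alpha>)^2) + (\<Sum>\<alpha>\<in>UNIV. (u y \<alpha>)^2)) \<le> C"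
    and sol: "\<forall>\<phi> :: real^'d \<Rightarrow> 'm \<Rightarrow> real. (\<forall>\<alpha>. test_fn (\<lambda>x. \<phi> x \<alpha>)) \<longrightarrow>
           (\<integral>x. (\<Sum>i\<in>UNIV. \<Sum>\<alpha>\<in>UNIV. \<Sum>k\<in>UNIV. \<Sum>\<gamma>\<in>UNIV.
                     A x i k \<alpha> \<gamma> * G x k \<gamma> * pd i (\<lambda>y. \<phi> y \<alpha>) x)
                 + (1 / T^2) * (\<Sum>\<alpha>\<in>UNIV. u x \<alpha> * \<phi> x \<alpha>) \<partial>lebesgue)
           = - (\<integral>x. (\<Sum>i\<in>UNIV. \<Sum>\<alpha>\<in>UNIV. A x i j \<alpha> \<beta> * pd i (\<lambda>y. \<phi> y \<alpha>) x) \<partial>lebesgue)"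
    using assms unfolding approx_corrector_def by (elim exE conjE) (rule that)
  note C = C'[rule_format]
  have uL: "L2loc (\<lambda>z. u z \<alpha>)" and GL: "L2loc (\<lambda>z. G z i \<alpha>)" for i \<alpha>
    using wg by (auto simp: weak_gradient_def)
  have rep: "\<exists>w. w \<in> borel_measurable borel \<and> (AE z in lborel. f z = w z)" if "L2loc f" for f :: "real^'d \<Rightarrow> real"
    using completion_ex_borel_measurable_real[of f lborel] that by (simp add: L2loc_def Bex_def)
  have "\<forall>\<alpha>. \<exists>w. w \<in> borel_measurable borel \<and> (AE z in lborel. u z \<alpha> = w z)"
    using rep[OF uL] by blast
  from choice[OF this] obtain v where v: "\<And>\<alpha>. v \<alpha> \<in> borel_measurable borel" "\<And>\<alpha>. AE z in lborel. u z \<alpha> = v \<alpha> z"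
    by blast
  have "\<forall>p. \<exists>w. w \<in> borel_measurable borel \<and> (AE z in lborel. G z (fst p) (snd p) = w z)"
    using rep[OF GL] by blast
  from choice[OF this] obtain h where h: "\<And>p. h p \<in> borel_measurable borel" "\<And>p. AE z in lborel. G z (fst p) (snd p) = h p z"
    by blast
  define H where "H i \<alpha> = h (i, \<alpha>)" for i \<alpha>
  have H: "H i \<alpha> \<in> borel_measurable borel" "AE z in lborel. G z i \<alpha> = H i \<alpha> z" for i \<alpha>
    using h[of "(i, \<alpha>)"] by (simp_all add: H_def)
  note [measurable] = v(1) H(1) A_measurable
  define x where "x = ((\<lambda>z \<alpha>. v \<alpha> z), (\<lambda>z i \<alpha>. H i \<alpha> z))"
  have x: "fst x z \<alpha> = v \<alpha> z" "snd x z i \<alpha> = H i \<alpha> z" for z i \<alpha> by (auto simp: x_def)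
  have ae: "AE z in lborel. (\<forall>\<alpha>. u z \<alpha> = v \<alpha> z) \<and> (\<forall>i \<alpha>. G z i \<alpha> = H i \<alpha> z)"
    by (intro eventually_conj eventually_all_finite v H)
  define S where "S z = (\<Sum>i\<in>UNIV. \<Sum>\<alpha>\<in>UNIV. (G z i \<alpha>)^2) + (\<Sum>\<alpha>\<in>UNIV. (u z \<alpha>)^2)" for z
  have S0: "0 \<le> S z" for z by (simp add: S_def sum_nonneg)
  have Su: "(u z \<alpha>)^2 \<le> S z" and SG: "(G z i \<alpha>)^2 \<le> S z" for z i \<alpha>
  proof -
    have "(u z \<alpha>)^2 \<le> (\<Sum>\<alpha>\<in>UNIV. (u z \<alpha>)^2)" by (intro member_le_sum) auto
    moreover have "(G z i \<alpha>)^2 \<le> (\<Sum>\<alpha>\<in>UNIV. (G z i \<alpha>)^2)" by (intro member_le_sum) auto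
    moreover have "(\<Sum>\<alpha>\<in>UNIV. (G z i \<alpha>)^2) \<le> (\<Sum>i\<in>UNIV. \<Sum>\<alpha>\<in>UNIV. (G z i \<alpha>)^2)"
      by (rule member_le_sum) (auto intro: sum_nonneg)
    moreover have "0 \<le> (\<Sum>\<alpha>\<in>UNIV. (u z \<alpha>)^2)" "0 \<le> (\<Sum>i\<in>UNIV. \<Sum>\<alpha>\<in>UNIV. (G z i \<alpha>)^2)"
      by (auto intro!: sum_nonneg)
    ultimately show "(u z \<alpha>)^2 \<le> S z" "(G z i \<alpha>)^2 \<le> S z" unfolding S_def by linarith+
  qed
  have Sint: "set_integrable lebesgue (ball w 1) S" for w
    unfolding S_def set_integrable_def scaleR_add_right scaleR_sum_right
    by (intro Bochner_Integration.integrable_add Bochner_Integration.integrable_sum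
        set_integrable_square_ball[unfolded set_integrable_def] uL GL)
  have ul: "unif_L2 w" if [measurable]: "w \<in> borel_measurable borel" and w: "AE z in lborel. (w z)^2 \<le> S z" for w
  proof -
    \<comment> \<open>The maximum with 0 supplies the nonnegative constant that
      \<open>unif_loc\<close> demands.\<close>
    have "(\<integral>\<^sup>+z. ennreal \<bar>(w z)^2\<bar> * indicator (ball y 1) z \<partial>lborel) \<le> ennreal (max C 0)" for y
      using w C[of y] by (intro nn_integral_ball_le[OF Sint S0]) (auto simp: S_def)
    then show ?thesis unfolding unif_L2_def unif_loc_def by (auto intro!: exI[of _ "max C 0"])
  qed
  have x_H1: "x \<in> unif_H1"
    unfolding unif_H1_def x mem_Collect_eq
  proof (intro conjI allI impI)
    show "unif_L2 (v \<alpha>)" for \<alpha>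
      using v(2)[of \<alpha>] by (intro ul v(1), eventually_elim) (metis Su)
    show "unif_L2 (H i \<alpha>)" for i \<alpha>
      using H(2)[of i \<alpha>] by (intro ul H(1), eventually_elim) (metis SG)
    fix \<phi> :: "real^'d \<Rightarrow> real" and i \<alpha> assume \<phi>: "test_fn \<phi>"
    have [measurable]: "\<phi> \<in> borel_measurable borel" "pd i \<phi> \<in> borel_measurable borel"
      using \<phi> by (auto intro: borel_measurable_continuous_onI test_fn_continuous test_fn_pd_continuous)
    have "(\<integral>z. v \<alpha> z * pd i \<phi> z \<partial>lborel) = (\<integral>z. u z \<alpha> * pd i \<phi> z \<partial>lebesgue)"
      using v(2)[of \<alpha>] by (intro integral_lebesgue_eq_lborel[symmetric]) (auto elim: eventually_mono)
    also have "\<dots> = - (\<integral>z. G z i \<alpha> * \<phi> z \<partial>lebesgue)"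
      using wg \<phi> by (auto simp: weak_gradient_def)
    also have "(\<integral>z. G z i \<alpha> * \<phi> z \<partial>lebesgue) = (\<integral>z. H i \<alpha> z * \<phi> z \<partial>lborel)"
      using H(2)[of i \<alpha>] by (intro integral_lebesgue_eq_lborel) (auto elim: eventually_mono)
    finally show "(\<integral>z. v \<alpha> z * pd i \<phi> z \<partial>lborel) = - (\<integral>z. H i \<alpha> z * \<phi> z \<partial>lborel)" .
  qed
  have "solves j \<beta> (1 / T^2) x"
    unfolding solves_def x
  proof (intro allI impI)
    fix \<phi> :: "real^'d \<Rightarrow> 'm \<Rightarrow> real" assume \<phi>: "\<forall>\<alpha>. test_fn (\<lambda>z. \<phi> z \<alpha>)"
    have [measurable]: "(\<lambda>z. \<phi> z \<alpha>) \<in> borel_measurable borel" "pd i (\<lambda>z. \<phi> z \<alpha>) \<in> borel_measurable borel" for i \<alpha>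
      using \<phi> by (auto intro!: borel_measurable_continuous_onI test_fn_continuous test_fn_pd_continuous)
    have "(\<integral>z. (\<Sum>i\<in>UNIV. \<Sum>\<alpha>\<in>UNIV. \<Sum>k\<in>UNIV. \<Sum>\<gamma>\<in>UNIV. A z i k \<alpha> \<gamma> * H k \<gamma> z * pd i (\<lambda>y. \<phi> y \<alpha>) z)
          + 1 / T^2 * (\<Sum>\<alpha>\<in>UNIV. v \<alpha> z * \<phi> z \<alpha>) \<partial>lborel)
      = (\<integral>z. (\<Sum>i\<in>UNIV. \<Sum>\<alpha>\<in>UNIV. \<Sum>k\<in>UNIV. \<Sum>\<gamma>\<in>UNIV. A z i k \<alpha> \<gamma> * G z k \<gamma> * pd i (\<lambda>y. \<phi> y \<alpha>) z)
          + 1 / T^2 * (\<Sum>\<alpha>\<in>UNIV. u z \<alpha> * \<phi> z \<alpha>) \<partial>lebesgue)"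
    proof (rule integral_lebesgue_eq_lborel[symmetric])
      show "AE z in lborel. (\<Sum>i\<in>UNIV. \<Sum>\<alpha>\<in>UNIV. \<Sum>k\<in>UNIV. \<Sum>\<gamma>\<in>UNIV. A z i k \<alpha> \<gamma> * G z k \<gamma> * pd i (\<lambda>y. \<phi> y \<alpha>) z)
          + 1 / T^2 * (\<Sum>\<alpha>\<in>UNIV. u z \<alpha> * \<phi> z \<alpha>)
        = (\<Sum>i\<in>UNIV. \<Sum>\<alpha>\<in>UNIV. \<Sum>k\<in>UNIV. \<Sum>\<gamma>\<in>UNIV. A z i k \<alpha> \<gamma> * H k \<gamma> z * pd i (\<lambda>y. \<phi> y \<alpha>) z)
          + 1 / T^2 * (\<Sum>\<alpha>\<in>UNIV. v \<alpha> z * \<phi> z \<alpha>)"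
        using ae by eventually_elim simp
    qed measurable
    also have "\<dots> = - (\<integral>z. (\<Sum>i\<in>UNIV. \<Sum>\<alpha>\<in>UNIV. A z i j \<alpha> \<beta> * pd i (\<lambda>y. \<phi> y \<alpha>) z) \<partial>lebesgue)"
      using sol[rule_format, of \<phi>] \<phi> by simp
    also have "(\<integral>z. (\<Sum>i\<in>UNIV. \<Sum>\<alpha>\<in>UNIV. A z i j \<alpha> \<beta> * pd i (\<lambda>y. \<phi> y \<alpha>) z) \<partial>lebesgue)
      = (\<integral>z. (\<Sum>i\<in>UNIV. \<Sum>\<alpha>\<in>UNIV. A z i j \<alpha> \<beta> * pd i (\<lambda>y. \<phi> y \<alpha>) z) \<partial>lborel)"
      by (intro integral_lebesgue_eq_lborel) auto
    finally show "(\<integral>z. (\<Sum>i\<in>UNIV. \<Sum>\<alpha>\<in>UNIV. \<Sum>k\<in>UNIV. \<Sum>\<gamma>\<in>UNIV. A z i k \<alpha> \<gamma> * H k \<gamma> z * pd i (\<lambda>y. \<phi> y \<alpha>) z)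
          + 1 / T^2 * (\<Sum>\<alpha>\<in>UNIV. v \<alpha> z * \<phi> z \<alpha>) \<partial>lborel)
      = - (\<integral>z. (\<Sum>i\<in>UNIV. \<Sum>\<alpha>\<in>UNIV. A z i j \<alpha> \<beta> * pd i (\<lambda>y. \<phi> y \<alpha>) z) \<partial>lborel)" .
  qed
  moreover have "AE z in lborel. \<forall>\<alpha>. u z \<alpha> = fst x z \<alpha>"
    using ae by eventually_elim (simp add: x)
  ultimately show ?thesis using x_H1 that by blast
qed

text \<open>\<^const>\<open>mean_value\<close> is only known to be a limit if the limit exists; otherwise it is the
  unspecified but fixed number \<open>The (\<lambda>_. False)\<close>, which is harmless after division by \<open>T\<^sup>2\<close>.\<close>

lemma (in limit_filter) mean_value_cases:
  fixes h k :: "real^'d \<Rightarrow> real"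
  assumes k: "unif_loc k" "\<And>z. 0 \<le> k z" and ae: "AE z in lborel. h z = k z"
  shows "mean_value h = The (\<lambda>_. False) \<or>
    (0 \<le> mean_value h \<and> mean_value h \<le> exp (1/3) / unit_ball_vol CARD('d) * mean k)"
proof (cases "\<exists>l. ((\<lambda>L::real. (LINT x:ball 0 L|lebesgue. h x) / measure lebesgue (ball (0::real^'d) L)) \<longlongrightarrow> l) at_top")
  case False
  then have "mean_value h = The (\<lambda>_. False)" unfolding mean_value_def t2_space_class.Lim_def by simp
  then show ?thesis ..
next
  case True
  note [measurable] = unif_loc_measurable[OF k(1)]
  define av where "av L = (LINT x:ball 0 L|lebesgue. h x) / measure lebesgue (ball (0::real^'d) L)" for L :: real
  define V where "V = unit_ball_vol (real CARD('d))"
  have V: "V > 0" by (simp add: V_def)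
  obtain l where l: "(av \<longlongrightarrow> l) at_top" using True unfolding av_def by blast
  then have mv: "mean_value h = l" unfolding mean_value_def av_def by (rule tendsto_Lim[rotated]) simp
  \<comment> \<open>The ordinary limit is also the limit along \<open>F\<close>, where it can be
    compared with the generalized mean.\<close>
  have lF: "(av \<longlongrightarrow> l) F" using l le_at_top by (rule tendsto_mono[rotated])
  have bounds: "0 \<le> av L" "av L \<le> exp (1/3) / V * wavg k L" if L: "L > 0" for L
  proof -
    have i: "integrable lborel (\<lambda>z. k z * weight L z)" by (rule unif_loc_weighted(1)[OF k(1) L])
    have [measurable]: "indicator (ball 0 L) \<in> borel_measurable (borel :: (real^'d) measure)" by simp
    have eq: "(LINT x:ball 0 L|lebesgue. h x) = (\<integral>z. indicator (ball 0 L) z * k z \<partial>lborel)"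
      unfolding set_lebesgue_integral_def
    proof (rule integral_lebesgue_eq_lborel)
      show "AE z in lborel. indicator (ball 0 L) z *\<^sub>R h z = indicator (ball 0 L) z * k z"
        using ae by eventually_elim simp
    qed measurable
    \<comment> \<open>The factor \<open>exp (1/3)\<close> is the reciprocal of the lower bound of
      the weight on the ball, so the scaled weight dominates the indicator.\<close>
    have pw: "indicator (ball 0 L) z * k z \<le> exp (1/3) * (k z * weight L z)" for z
    proof (cases "norm z < L")
      case True
      have "exp (1/3) * exp (- 1/3) \<le> exp (1/3) * weight L z"
        using weight_ge[of L z] L True by (intro mult_left_mono) auto
      then have "1 \<le> exp (1/3) * weight L z" by (simp flip: exp_add)
      then have "k z * 1 \<le> k z * (exp (1/3) * weight L z)" using k(2) by (intro mult_left_mono)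
      then show ?thesis using True by (simp add: mult_ac)
    next
      case False
      then show ?thesis using k(2)[of z] weight_nonneg[of L z] by simp
    qed
    have "(\<integral>z. indicator (ball 0 L) z * k z \<partial>lborel) \<le> (\<integral>z. exp (1/3) * (k z * weight L z) \<partial>lborel)"
    proof (rule integral_mono_AE')
      show "integrable lborel (\<lambda>z. exp (1/3) * (k z * weight L z))" using i by simp
    qed (use pw k(2) in \<open>auto intro!: AE_I2 simp: weight_nonneg\<close>)
    also have "\<dots> = exp (1/3) * (\<integral>z. k z * weight L z \<partial>lborel)" by simp
    finally have le: "(\<integral>z. indicator (ball 0 L) z * k z \<partial>lborel) \<le> exp (1/3) * (\<integral>z. k z * weight L z \<partial>lborel)" .
    have vol: "measure lebesgue (ball (0::real^'d) L) = V * L ^ CARD('d)"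
      using L by (simp add: V_def content_ball)
    have VL: "V * L ^ CARD('d) > 0" using V L by simp
    have "0 \<le> (\<integral>z. indicator (ball 0 L) z * k z \<partial>lborel)" using k(2) by (intro Bochner_Integration.integral_nonneg) simp
    then show "0 \<le> av L" unfolding av_def eq vol using VL by simp
    have "av L \<le> exp (1/3) * (\<integral>z. k z * weight L z \<partial>lborel) / (V * L ^ CARD('d))"
      unfolding av_def eq vol using le VL by (intro divide_right_mono) auto
    then show "av L \<le> exp (1/3) / V * wavg k L" by (simp add: wavg_def)
  qed
  have "l \<le> exp (1/3) / V * mean k"
  proof (rule tendsto_le[OF not_bot _ lF])
    show "((\<lambda>L. exp (1/3) / V * wavg k L) \<longlongrightarrow> exp (1/3) / V * mean k) F"
      by (intro tendsto_intros tendsto_mean k)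
    show "\<forall>\<^sub>F L in F. av L \<le> exp (1/3) / V * wavg k L"
      using ev_pos by eventually_elim (rule bounds)
  qed
  moreover have "0 \<le> l"
    by (rule tendsto_lowerbound[OF lF _ not_bot]) (use ev_pos in eventually_elim, rule bounds)
  ultimately show ?thesis by (simp add: mv V_def)
qed

section \<open>Decay of the averaged correctors\<close>

theorem theorem5p5:
  fixes A :: "real^'d \<Rightarrow> 'd \<Rightarrow> 'd \<Rightarrow> 'm::finite \<Rightarrow> 'm \<Rightarrow> real"
    and \<mu> :: real
    and chi :: "real \<Rightarrow> 'd \<Rightarrow> 'm \<Rightarrow> real^'d \<Rightarrow> 'm \<Rightarrow> real"
  assumes mu_pos: "\<mu> > 0"
    and elliptic: "\<And>y (\<xi>::'d \<Rightarrow> 'm \<Rightarrow> real).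
       \<mu> * (\<Sum>i\<in>UNIV. \<Sum>\<alpha>\<in>UNIV. (\<xi> i \<alpha>)^2)
         \<le> (\<Sum>i\<in>UNIV. \<Sum>j\<in>UNIV. \<Sum>\<alpha>\<in>UNIV. \<Sum>\<beta>\<in>UNIV. A y i j \<alpha> \<beta> * \<xi> i \<alpha> * \<xi> j \<beta>)
       \<and> (\<Sum>i\<in>UNIV. \<Sum>j\<in>UNIV. \<Sum>\<alpha>\<in>UNIV. \<Sum>\<beta>\<in>UNIV. A y i j \<alpha> \<beta> * \<xi> i \<alpha> * \<xi> j \<beta>)
         \<le> (1 / \<mu>) * (\<Sum>i\<in>UNIV. \<Sum>\<alpha>\<in>UNIV. (\<xi> i \<alpha>)^2)"
    and almost_periodic: "\<And>i j \<alpha> \<beta>. unif_almost_periodic (\<lambda>y. A y i j \<alpha> \<beta>)"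
    and corrector: "\<And>T j \<beta>. T > 0 \<Longrightarrow> approx_corrector A T j \<beta> (chi T j \<beta>)"
  shows "(((\<lambda>T. (1 / T^2) * mean_value (\<lambda>x. \<Sum>j\<in>UNIV. \<Sum>\<alpha>\<in>UNIV. \<Sum>\<beta>\<in>UNIV. (chi T j \<beta> x \<alpha>)^2)))
           \<longlongrightarrow> 0) at_top"
proof -
  obtain F where "limit_filter F" using ex_limit_filter by blast
  then interpret limit_filter F .
  have "\<exists>M. \<forall>y. \<bar>A y i j \<alpha> \<beta>\<bar> \<le> M" for i j \<alpha> \<beta>
    using unif_almost_periodic_bounded[OF almost_periodic] by metis
  then obtain b where b: "\<And>y i j \<alpha> \<beta>. \<bar>A y i j \<alpha> \<beta>\<bar> \<le> b i j \<alpha> \<beta>" by metis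
  define M where "M = Max (range (\<lambda>(i, j, \<alpha>, \<beta>). b i j \<alpha> \<beta>))"
  have bM: "b i j \<alpha> \<beta> \<le> M" for i j \<alpha> \<beta>
    unfolding M_def by (intro Max_ge) (auto intro!: image_eqI[of _ _ "(i, j, \<alpha>, \<beta>)"])
  interpret elliptic_system F A \<mu> M
  proof
    show "\<bar>A y i j \<alpha> \<beta>\<bar> \<le> M" for y i j \<alpha> \<beta> using b[of y i j \<alpha> \<beta>] bM[of i j \<alpha> \<beta>] by linarith
  qed (use mu_pos elliptic unif_almost_periodic_measurable[OF almost_periodic] in blast)+
  define rep where "rep T j \<beta> x \<longleftrightarrow> x \<in> unif_H1 \<and>
      (AE z in lborel. \<forall>\<alpha>. chi T j \<beta> z \<alpha> = fst x z \<alpha>) \<and> solves j \<beta> (1 / T^2) x" for T j \<beta> x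
  have rep: "\<exists>x. rep T j \<beta> x" if T: "T > 0" for T j \<beta>
  proof -
    obtain x where "x \<in> unif_H1" "AE z in lborel. \<forall>\<alpha>. chi T j \<beta> z \<alpha> = fst x z \<alpha>" "solves j \<beta> (1 / T^2) x"
      by (rule approx_corrector_representative[OF corrector[OF T, of j \<beta>]])
    then show ?thesis unfolding rep_def by blast
  qed
  \<comment> \<open>One representative is fixed for each \<open>T\<close>, \<open>j\<close> and
    \<beta>, so that they form a family in \<open>T\<close>; for \<open>T \<le> 0\<close> the value
    is irrelevant.\<close>
  define x where "x T j \<beta> = (SOME x. rep T j \<beta> x)" for T j \<beta>
  have "rep T j \<beta> (x T j \<beta>)" if "T > 0" for T j \<beta>
    unfolding x_def using rep[OF that] by (rule someI_ex)
  then have x: "\<And>T j \<beta>. T > 0 \<Longrightarrow> x T j \<beta> \<in> unif_H1"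
      "\<And>T j \<beta>. T > 0 \<Longrightarrow> AE z in lborel. \<forall>\<alpha>. chi T j \<beta> z \<alpha> = fst (x T j \<beta>) z \<alpha>"
      "\<And>T j \<beta>. T > 0 \<Longrightarrow> solves j \<beta> (1 / T^2) (x T j \<beta>)"
    unfolding rep_def by blast+
  define h where "h T z = (\<Sum>j\<in>UNIV. \<Sum>\<alpha>\<in>UNIV. \<Sum>\<beta>\<in>UNIV. (chi T j \<beta> z \<alpha>)^2)" for T z
  define S where "S T j \<beta> = mean (mass (x T j \<beta>) (x T j \<beta>))" for T j \<beta>
  define c where "c = exp (1/3) / unit_ball_vol (real CARD('d))"
  define z0 :: real where "z0 = The (\<lambda>_. False)"
  have c: "c \<ge> 0" by (simp add: c_def)
  have S: "S T j \<beta> \<ge> 0" if "T > 0" for T j \<beta>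
    unfolding S_def by (rule semi_inner_on.nonneg[OF mass_inner x(1)[OF that]])
  \<comment> \<open>A single bound covers both alternatives of \<open>mean_value_cases\<close>; the
    factor \<open>1 / T^2\<close> later removes the constant \<open>\<bar>z0\<bar>\<close>.\<close>
  have mv: "\<bar>mean_value (h T)\<bar> \<le> \<bar>z0\<bar> + c * (\<Sum>j\<in>UNIV. \<Sum>\<beta>\<in>UNIV. S T j \<beta>)" if T: "T > 0" for T
  proof -
    let ?k = "\<lambda>z. \<Sum>j\<in>UNIV. \<Sum>\<beta>\<in>UNIV. mass (x T j \<beta>) (x T j \<beta>) z"
    have um: "unif_loc (mass (x T j \<beta>) (x T j \<beta>))" for j \<beta>
      by (intro unif_loc_forms x T)
    have "unif_loc ?k" by (intro unif_loc_sum finite um)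
    moreover have "0 \<le> ?k z" for z by (auto intro!: sum_nonneg simp: mass_def)
    moreover have "AE z in lborel. h T z = ?k z"
    proof -
      have "AE z in lborel. \<forall>j \<beta>. \<forall>\<alpha>. chi T j \<beta> z \<alpha> = fst (x T j \<beta>) z \<alpha>"
        by (intro eventually_all_finite x T)
      then show ?thesis
      proof eventually_elim
        case (elim z)
        then have "h T z = (\<Sum>j\<in>UNIV. \<Sum>\<alpha>\<in>UNIV. \<Sum>\<beta>\<in>UNIV. fst (x T j \<beta>) z \<alpha> * fst (x T j \<beta>) z \<alpha>)"
          by (simp add: h_def power2_eq_square)
        also have "\<dots> = ?k z" unfolding mass_def by (intro sum.cong refl sum.swap)
        finally show ?case .
      qed
    qed
    ultimately have "mean_value (h T) = z0 \<or> (0 \<le> mean_value (h T) \<and> mean_value (h T) \<le> c * mean ?k)"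
      unfolding z0_def c_def by (rule mean_value_cases)
    moreover have "mean ?k = (\<Sum>j\<in>UNIV. \<Sum>\<beta>\<in>UNIV. S T j \<beta>)"
      by (simp add: mean_sum um unif_loc_sum S_def)
    moreover have "0 \<le> c * (\<Sum>j\<in>UNIV. \<Sum>\<beta>\<in>UNIV. S T j \<beta>)"
      using S[OF T] c by (intro mult_nonneg_nonneg sum_nonneg)
    ultimately show ?thesis by auto
  qed
  have lim: "((\<lambda>T. 1 / T^2 * S T j \<beta>) \<longlongrightarrow> 0) at_top" for j \<beta>
    unfolding S_def by (rule mass_vanishes[OF x(1) x(3)])
  have "((\<lambda>T. \<bar>z0\<bar> * (1 / T^2) + c * (\<Sum>j\<in>UNIV. \<Sum>\<beta>\<in>UNIV. 1 / T^2 * S T j \<beta>))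
      \<longlongrightarrow> \<bar>z0\<bar> * 0 + c * (\<Sum>j\<in>(UNIV::'d set). \<Sum>\<beta>\<in>(UNIV::'m set). 0)) at_top"
    by (intro tendsto_intros lim tendsto_divide_0[OF tendsto_const]
        filterlim_at_top_imp_at_infinity filterlim_pow_at_top filterlim_ident) auto
  then have "((\<lambda>T. \<bar>z0\<bar> * (1 / T^2) + c * (\<Sum>j\<in>UNIV. \<Sum>\<beta>\<in>UNIV. 1 / T^2 * S T j \<beta>)) \<longlongrightarrow> 0) at_top"
    by simp
  moreover have "\<forall>\<^sub>F T in at_top. norm (1 / T^2 * mean_value (h T)) \<le> \<bar>z0\<bar> * (1 / T^2) + c * (\<Sum>j\<in>UNIV. \<Sum>\<beta>\<in>UNIV. 1 / T^2 * S T j \<beta>)"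
    using eventually_gt_at_top[of 0]
  proof eventually_elim
    case (elim T)
    have "norm (1 / T^2 * mean_value (h T)) = 1 / T^2 * \<bar>mean_value (h T)\<bar>"
      by (simp add: abs_mult)
    also have "\<dots> \<le> 1 / T^2 * (\<bar>z0\<bar> + c * (\<Sum>j\<in>UNIV. \<Sum>\<beta>\<in>UNIV. S T j \<beta>))"
      by (intro mult_left_mono mv elim) simp
    also have "\<dots> = \<bar>z0\<bar> * (1 / T^2) + c * (\<Sum>j\<in>UNIV. \<Sum>\<beta>\<in>UNIV. 1 / T^2 * S T j \<beta>)"
      by (simp only: sum_distrib_left[symmetric]) (simp add: algebra_simps)
    finally show ?case .
  qed
  ultimately have "((\<lambda>T. 1 / T^2 * mean_value (h T)) \<longlongrightarrow> 0) at_top"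
    by (rule Lim_null_comparison[rotated])
  then show ?thesis unfolding h_def .
qed

end
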